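(* For every $s>-\frac74$ there exists $b=b(s)<\frac12$ such that for all $\alpha>\frac12$ we have $$\|\partial_x(uv)\|_{X^{s,-b}}\le c\,\|u\|_{X^{s,b}\cap D^\alpha}\,\|v\|_{X^{s,b}\cap D^\alpha},$$ where the constant $c$ is independent of $u$ and $v$.
   Context: Let $\langle\cdot\rangle=(1+|\cdot|^2)^{1/2}$ and, for functions $f(t,x)$ on $\mathbb{R}^2$, let $\widetilde f(\tau,\xi)=\int_{\mathbb{R}^2}e^{-ix\xi}e^{-it\tau}f(t,x)\,dx\,dt$. For $s,b,\alpha\in\mathbb{R}$, $X^{s,b}$ and $D^\alpha$ are the completions of the Schwartz space $\mathcal S(\mathbb{R}^2)$ under $$\|f\|_{X^{s,b}}^2=\int_{\mathbb{R}^2}\langle\xi\rangle^{2s}\langle\tau-\xi^5\rangle^{2b}|\widetilde f(\tau,\xi)|^2\,d\xi\,d\tau,$$ $$\|f\|_{D^\alpha}^2=\int_{\mathbb{R}^2}\langle\tau\rangle^{2\alpha}\mathbf 1_{\{|\xi|\le1\}}(\xi)|\widetilde f(\tau,\xi)|^2\,d\xi\,d\tau,$$ and $\|f\|_{X^{s,b}\cap D^\alpha}=\|f\|_{X^{s,b}}+\|f\|_{D^\alpha}$. *)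

theory Defs
  imports "HOL-Analysis.Analysis"
begin

text \<open>Functions of (t,x) are maps from \<^typ>\<open>real \<times> real\<close>; the time variable comes first. On the
  Fourier side the pair is \<open>(\<tau>,\<xi>)\<close> in the same order.\<close>

definition partial_t :: "(real \<times> real \<Rightarrow> complex) \<Rightarrow> real \<times> real \<Rightarrow> complex" where
  "partial_t f = (\<lambda>(t, x). vector_derivative (\<lambda>r. f (r, x)) (at t))"

definition partial_x :: "(real \<times> real \<Rightarrow> complex) \<Rightarrow> real \<times> real \<Rightarrow> complex" where
  "partial_x f = (\<lambda>(t, x). vector_derivative (\<lambda>r. f (t, r)) (at x))"

text \<open>Differentiability is total (Frechet) differentiability, so the first clause makes all
  iterated partial derivatives continuous and says that \<open>f\<close> is smooth.\<close>

definition schwartz :: "(real \<times> real \<Rightarrow> complex) \<Rightarrow> bool" where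
  "schwartz f \<longleftrightarrow>
     (\<forall>i j. (\<forall>z. (partial_t ^^ i) ((partial_x ^^ j) f) differentiable (at z)) \<and>
            (\<forall>k. \<exists>C. \<forall>z. norm z ^ k * norm ((partial_t ^^ i) ((partial_x ^^ j) f) z) \<le> C))"

definition fourier :: "(real \<times> real \<Rightarrow> complex) \<Rightarrow> real \<times> real \<Rightarrow> complex" where
  "fourier f = (\<lambda>(\<tau>, \<xi>).
     \<integral>(t, x). exp (- \<i> * of_real (x * \<xi>)) * exp (- \<i> * of_real (t * \<tau>)) * f (t, x) \<partial>lborel)"

definition jbracket :: "real \<Rightarrow> real" where
  "jbracket y = sqrt (1 + y\<^sup>2)"

text \<open>The norms are applied to Schwartz functions only. Their Fourier transforms are again
  Schwartz and the weights grow at most polynomially, so both integrands are integrable.\<close>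

definition X_norm :: "real \<Rightarrow> real \<Rightarrow> (real \<times> real \<Rightarrow> complex) \<Rightarrow> real" where
  "X_norm s b f = sqrt (\<integral>(\<tau>, \<xi>).
     jbracket \<xi> powr (2 * s) * jbracket (\<tau> - \<xi> ^ 5) powr (2 * b) * (norm (fourier f (\<tau>, \<xi>)))\<^sup>2 \<partial>lborel)"

definition D_norm :: "real \<Rightarrow> (real \<times> real \<Rightarrow> complex) \<Rightarrow> real" where
  "D_norm \<alpha> f = sqrt (\<integral>(\<tau>, \<xi>).
     jbracket \<tau> powr (2 * \<alpha>) * indicator {y. \<bar>y\<bar> \<le> 1} \<xi> * (norm (fourier f (\<tau>, \<xi>)))\<^sup>2 \<partial>lborel)"

definition XD_norm :: "real \<Rightarrow> real \<Rightarrow> real \<Rightarrow> (real \<times> real \<Rightarrow> complex) \<Rightarrow> real" where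
  "XD_norm s b \<alpha> f = X_norm s b f + D_norm \<alpha> f"

text \<open>The completion of the Schwartz space under a norm \<open>N\<close>, as the set of classes of
  \<open>N\<close>-Cauchy sequences modulo \<open>N\<close>-null sequences, with the extended norm.\<close>

definition schwartz_Cauchy ::
    "((real \<times> real \<Rightarrow> complex) \<Rightarrow> real) \<Rightarrow> (nat \<Rightarrow> real \<times> real \<Rightarrow> complex) \<Rightarrow> bool" where
  "schwartz_Cauchy N u \<longleftrightarrow>
     (\<forall>n. schwartz (u n)) \<and>
     (\<forall>e>0. \<exists>M. \<forall>m\<ge>M. \<forall>n\<ge>M. N (\<lambda>z. u m z - u n z) < e)"

definition schwartz_completion ::
    "((real \<times> real \<Rightarrow> complex) \<Rightarrow> real) \<Rightarrow> (nat \<Rightarrow> real \<times> real \<Rightarrow> complex) set set" where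
  "schwartz_completion N =
     {u. schwartz_Cauchy N u} //
     {(u, v). schwartz_Cauchy N u \<and> schwartz_Cauchy N v \<and>
              (\<lambda>n. N (\<lambda>z. u n z - v n z)) \<longlonglongrightarrow> 0}"

definition completion_norm ::
    "((real \<times> real \<Rightarrow> complex) \<Rightarrow> real) \<Rightarrow> (nat \<Rightarrow> real \<times> real \<Rightarrow> complex) set \<Rightarrow> real" where
  "completion_norm N U = (THE l. \<forall>u\<in>U. (\<lambda>n. N (u n)) \<longlonglongrightarrow> l)"

definition X_space :: "real \<Rightarrow> real \<Rightarrow> (nat \<Rightarrow> real \<times> real \<Rightarrow> complex) set set" where
  "X_space s b = schwartz_completion (X_norm s b)"

text \<open>The intersection is the completion under the sum of the two norms: on the Fourier side
  both are the space of measurable functions square integrable against the sum of the two weights,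
  in which the Schwartz functions are dense because the weights are locally bounded.
  (Alone, \<^const>\<open>D_norm\<close> is only a seminorm.)\<close>

definition XD_space :: "real \<Rightarrow> real \<Rightarrow> real \<Rightarrow> (nat \<Rightarrow> real \<times> real \<Rightarrow> complex) set set" where
  "XD_space s b \<alpha> = schwartz_completion (XD_norm s b \<alpha>)"

text \<open>\<open>W\<close> is the class \<open>\<partial>\<^sub>x(UV)\<close>, formed termwise on representatives. Every choice of
  representatives has to give the same class.\<close>

definition is_dx_product ::
    "(nat \<Rightarrow> real \<times> real \<Rightarrow> complex) set \<Rightarrow> (nat \<Rightarrow> real \<times> real \<Rightarrow> complex) set \<Rightarrow>
     (nat \<Rightarrow> real \<times> real \<Rightarrow> complex) set \<Rightarrow> bool" where
  "is_dx_product U V W \<longleftrightarrow>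
     (\<forall>u\<in>U. \<forall>v\<in>V. (\<lambda>n. partial_x (\<lambda>z. u n z * v n z)) \<in> W)"

end

theory Submission
  imports Defs "HOL-Probability.Probability" "HOL-Real_Asymp.Real_Asymp"
begin

text \<open>
  On the Fourier side the estimate is a trilinear form over triples of points
  \<open>(\<tau>\<^sub>i, k\<^sub>i)\<close> with sum zero. The modulations \<open>\<sigma>\<^sub>i = \<tau>\<^sub>i - k\<^sub>i ^ 5\<close> then satisfy
  \<open>\<sigma>\<^sub>1 + \<sigma>\<^sub>2 + \<sigma>\<^sub>3 = - (5/2) k\<^sub>1 k\<^sub>2 k\<^sub>3 (k\<^sub>1\<^sup>2 + k\<^sub>2\<^sup>2 + k\<^sub>3\<^sup>2)\<close>, so the largest of them controls
  the resonance function on the right. Apply Cauchy-Schwarz with the point of largest modulation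
  frozen. Integrating out the time frequency leaves an integral of a bracket to a power below \<open>-1\<close>,
  evaluated at the resonance function \<open>\<phi>\<close>, and by substitution
  \<open>\<integral> \<bar>\<phi>'\<bar> jbracket (A + \<phi>) powr (- \<theta>)\<close> is bounded uniformly in \<open>A\<close>. Hence it is enough to
  bound the squared multiplier, divided by the gain from the largest modulation, pointwise by
  \<open>\<bar>\<phi>'\<bar>\<close>, which is a multiple of the difference of the fourth powers of the two free frequencies,
  up to terms that are trivially integrable.

  With \<open>b = 1/2 - \<kappa>\<close> the required power below \<open>-1\<close> is obtained by moving a little decay from
  the largest modulation to the other two. If an input frequency is small the resonance function
  is too weak, and the weight of \<^const>\<open>D_norm\<close> supplies the decay instead. The only critical
  interaction is that of two high frequencies with a low output; it requires \<open>s > - 7/4\<close>.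
\<close>

section \<open>Brackets and the resonance function\<close>

text \<open>The threshold comes from a power count. Let two inputs of size \<open>M\<close> produce
  an output of frequency \<open>x\<close>, and put \<open>p = - 2 * s\<close>. The squared
  multiplier is about \<open>x^2 * jbracket x powr (- p) * M powr (2 * p)\<close>, the largest
  modulation is at least of order \<open>\<bar>x\<bar> * M^4\<close>, and the derivative of the
  resonance function is of order \<open>M^3\<close>. This leaves the condition
  \<open>2 * p - 4 \<le> 3\<close>, that is \<open>s \<ge> - 7/4\<close>, and the strict inequality
  pays for \<kappa>. Lending \<open>3 * \<kappa>\<close> to each of two modulations leaves the
  exponent \<open>1 - 8 * \<kappa>\<close> on the largest one, and
  \<open>p = 7/2 - 16 * \<kappa>\<close> restores \<open>2 * p - 4 * (1 - 8 * \<kappa>) = 3\<close>.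
  The obstacle is a frozen high frequency: the derivative then vanishes where the free frequencies
  coincide. There all three frequencies are comparable, so the negative powers of \<open>x\<close>
  lower the requirement from \<open>M^3\<close> to \<open>M\<close>, which the last term of the
  kernel covers. The estimate is proved for Schwartz functions. Fourier inversion enters because it
  turns the transform of a product into a convolution; bilinearity then carries the bound to the
  completions.\<close>

lemma jbracket_ge_1: "1 \<le> jbracket y"
  by (simp add: jbracket_def)

lemma jbracket_pos [simp]: "0 < jbracket y"
  using jbracket_ge_1[of y] by linarith

lemma abs_le_jbracket: "\<bar>y\<bar> \<le> jbracket y"
  unfolding jbracket_def by (rule real_le_rsqrt) auto

lemma jbracket_le: "jbracket y \<le> 1 + \<bar>y\<bar>"
  unfolding jbracket_def by (rule real_le_lsqrt) (auto simp: power2_eq_square algebra_simps)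

lemma jbracket_ge: "(1 + \<bar>y\<bar>) / 2 \<le> jbracket y"
  using abs_le_jbracket[of y] jbracket_ge_1[of y] by simp

lemma jbracket_minus [simp]: "jbracket (- y) = jbracket y"
  by (simp add: jbracket_def)

text \<open>\<open>jbracket x\<close> is the modulus of 1 + i x, so this is the triangle inequality
  in the complex plane for 1 + i x and i y.\<close>

lemma jbracket_add: "jbracket (x + y) \<le> jbracket x + jbracket y"
proof -
  have "norm (Complex 1 x + Complex 0 y) \<le> norm (Complex 1 x) + norm (Complex 0 y)"
    by (rule norm_triangle_ineq)
  moreover have "norm (Complex 1 (x + y)) = jbracket (x + y)" "norm (Complex 1 x) = jbracket x"
    by (simp_all add: jbracket_def cmod_def)
  moreover have "norm (Complex 0 y) \<le> jbracket y"
    using abs_le_jbracket[of y] by (simp add: cmod_def)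
  moreover have "Complex 1 x + Complex 0 y = Complex 1 (x + y)"
    by (simp add: complex_eq_iff)
  ultimately show ?thesis by simp
qed

text \<open>A form of Peetre's inequality: both brackets are at least 1, so each of them is bounded
  by their product.\<close>

lemma jbracket_add_mult: "jbracket (x + y) \<le> 2 * jbracket x * jbracket y"
proof -
  have "jbracket x \<le> jbracket x * jbracket y" "jbracket y \<le> jbracket x * jbracket y"
    using jbracket_ge_1[of x] jbracket_ge_1[of y] by simp_all
  then have "jbracket x + jbracket y \<le> 2 * (jbracket x * jbracket y)" by linarith
  then show ?thesis using jbracket_add[of x y] by (simp add: mult.assoc)
qed

lemma jbracket_measurable [measurable]: "jbracket \<in> borel_measurable borel"
  unfolding jbracket_def[abs_def] by measurable

section \<open>Integrals of brackets and substitution on the line\<close>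

lemma nn_integral_uminus_real:
  fixes f :: "real \<Rightarrow> ennreal"
  assumes [measurable]: "f \<in> borel_measurable borel"
  shows "(\<integral>\<^sup>+x. f (- x) \<partial>lborel) = (\<integral>\<^sup>+x. f x \<partial>lborel)"
  by (subst (2) lborel_distr_uminus[symmetric], subst nn_integral_distr) auto

text \<open>Both half lines are taken closed, so the pointwise comparison holds at 0 as well, where
  the right side counts twice, and no null set has to be discarded.\<close>

lemma nn_integral_even_real:
  fixes f :: "real \<Rightarrow> ennreal"
  assumes [measurable]: "f \<in> borel_measurable borel" and even: "\<And>x. f (- x) = f x"
  shows "(\<integral>\<^sup>+x. f x \<partial>lborel) \<le> 2 * (\<integral>\<^sup>+x. f x * indicator {0..} x \<partial>lborel)"
proof -
  have "(\<integral>\<^sup>+x. f x \<partial>lborel) \<le>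
      (\<integral>\<^sup>+x. f x * indicator {0..} x + f (- x) * indicator {0..} (- x) \<partial>lborel)"
    by (intro nn_integral_mono) (auto simp: even indicator_def)
  also have "... = 2 * (\<integral>\<^sup>+x. f x * indicator {0..} x \<partial>lborel)"
    using nn_integral_uminus_real[of "\<lambda>x. f x * indicator {0..} x"]
    by (subst nn_integral_add) (auto simp: mult_2)
  finally show ?thesis .
qed

text \<open>The bracket is at least half of \<open>1 + \<bar>y\<bar>\<close>, and on the half line
  that power has the explicit primitive \<open>?F\<close>, which vanishes at infinity because
  \<theta> > 1.\<close>

lemma jbracket_powr_nn_integral_finite:
  assumes \<theta>: "\<theta> > 1"
  shows "(\<integral>\<^sup>+y. ennreal (jbracket y powr (- \<theta>)) \<partial>lborel) < \<infinity>"
proof -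
  let ?F = "\<lambda>y::real. (1 + y) powr (1 - \<theta>) / (1 - \<theta>)"
  have bound: "jbracket y powr (- \<theta>) \<le> 2 powr \<theta> * (1 + \<bar>y\<bar>) powr (- \<theta>)" for y
  proof -
    have "jbracket y powr (- \<theta>) \<le> ((1 + \<bar>y\<bar>) / 2) powr (- \<theta>)"
      using jbracket_ge[of y] \<theta> by (intro powr_mono2') auto
    also have "... = 2 powr \<theta> * (1 + \<bar>y\<bar>) powr (- \<theta>)"
      by (simp add: powr_divide powr_minus field_simps)
    finally show ?thesis .
  qed
  have lim: "(?F \<longlongrightarrow> 0) at_top"
  proof -
    have "((\<lambda>y::real. (1 + y) powr (1 - \<theta>)) \<longlongrightarrow> 0) at_top"
      using \<theta> by (intro tendsto_neg_powr filterlim_tendsto_add_at_top[OF tendsto_const filterlim_ident]) auto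
    from tendsto_divide[OF this tendsto_const, of "1 - \<theta>"] \<theta> show ?thesis by simp
  qed
  have "(\<integral>\<^sup>+y. ennreal ((1 + y) powr (- \<theta>)) * indicator {0..} y \<partial>lborel) = ennreal (0 - ?F 0)"
  proof (rule nn_integral_FTC_atLeast[OF _ _ _ lim])
    fix y :: real assume "0 \<le> y"
    then show "DERIV ?F y :> (1 + y) powr (- \<theta>)"
      using \<theta> by (auto intro!: derivative_eq_intros)
  qed auto
  then have fin: "(\<integral>\<^sup>+y. ennreal ((1 + \<bar>y\<bar>) powr (- \<theta>)) * indicator {0..} y \<partial>lborel) < \<infinity>"
    by (subst nn_integral_cong[where v = "\<lambda>y. ennreal ((1 + y) powr (- \<theta>)) * indicator {0..} y"])
       (auto simp: indicator_def)
  have "(\<integral>\<^sup>+y. ennreal (jbracket y powr (- \<theta>)) \<partial>lborel)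
      \<le> (\<integral>\<^sup>+y. ennreal (2 powr \<theta>) * ennreal ((1 + \<bar>y\<bar>) powr (- \<theta>)) \<partial>lborel)"
    using bound by (intro nn_integral_mono) (auto simp flip: ennreal_mult)
  also have "... = ennreal (2 powr \<theta>) * (\<integral>\<^sup>+y. ennreal ((1 + \<bar>y\<bar>) powr (- \<theta>)) \<partial>lborel)"
    by (rule nn_integral_cmult) auto
  also have "... \<le> ennreal (2 powr \<theta>) *
      (2 * (\<integral>\<^sup>+y. ennreal ((1 + \<bar>y\<bar>) powr (- \<theta>)) * indicator {0..} y \<partial>lborel))"
    by (intro mult_left_mono nn_integral_even_real) auto
  also have "... < \<infinity>"
    using fin by (auto simp: ennreal_mult_less_top)
  finally show ?thesis .
qed

text \<open>\<open>enn2real\<close> sends an infinite integral to 0, so the value is the integral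
  only when that is finite, in particular for \<theta> > 1.\<close>

definition jbracket_mass :: "real \<Rightarrow> real" where
  "jbracket_mass \<theta> = enn2real (\<integral>\<^sup>+y. ennreal (jbracket y powr (- \<theta>)) \<partial>lborel)"

lemma jbracket_mass:
  assumes "\<theta> > 1"
  shows "(\<integral>\<^sup>+y. ennreal (jbracket y powr (- \<theta>)) \<partial>lborel) = ennreal (jbracket_mass \<theta>)"
    and "0 \<le> jbracket_mass \<theta>"
  using jbracket_powr_nn_integral_finite[OF assms] by (auto simp: jbracket_mass_def)

lemma nn_integral_affine_unit_real:
  fixes f :: "real \<Rightarrow> ennreal"
  assumes [measurable]: "f \<in> borel_measurable borel" and "\<bar>c\<bar> = 1"
  shows "(\<integral>\<^sup>+x. f (t + c * x) \<partial>lborel) = (\<integral>\<^sup>+x. f x \<partial>lborel)"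
  using nn_integral_real_affine[of f c t] assms(2) by auto

text \<open>The two arguments add up to \<open>c - a\<close>, so the larger bracket is at least half
  of \<open>jbracket (c - a)\<close>. Its factor becomes the decay on the right, and the other
  factor is integrated. Either factor may be the one that remains, hence the 2 in the
  constant.\<close>

lemma jbracket_convolution:
  assumes \<theta>: "\<theta> > 1"
  shows "(\<integral>\<^sup>+t. ennreal (jbracket (t - a) powr (- \<theta>) * jbracket (c - t) powr (- \<theta>)) \<partial>lborel)
      \<le> ennreal (2 * 2 powr \<theta> * jbracket_mass \<theta> * jbracket (c - a) powr (- \<theta>))"
proof -
  let ?w = "\<lambda>y. jbracket y powr (- \<theta>)"
  have pt: "?w p * ?w q \<le> 2 powr \<theta> * ?w (p + q) * (?w p + ?w q)" for p q
  proof -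
    have *: "?w p * ?w q \<le> 2 powr \<theta> * ?w (p + q) * ?w q" if "jbracket q \<le> jbracket p" for p q
    proof -
      have "jbracket (p + q) \<le> 2 * jbracket p" using jbracket_add[of p q] that by simp
      then have "?w p \<le> (jbracket (p + q) / 2) powr (- \<theta>)"
        using \<theta> by (intro powr_mono2') auto
      also have "... = 2 powr \<theta> * ?w (p + q)"
        by (simp add: powr_divide powr_minus field_simps)
      finally show ?thesis by (intro mult_right_mono) auto
    qed
    have nn: "0 \<le> 2 powr \<theta> * ?w (p + q) * ?w p" "0 \<le> 2 powr \<theta> * ?w (p + q) * ?w q"
      by simp_all
    show ?thesis
    proof (cases "jbracket q \<le> jbracket p")
      case True
      from *[OF True] nn show ?thesis unfolding distrib_left by linarith
    next
      case False
      then have "?w q * ?w p \<le> 2 powr \<theta> * ?w (q + p) * ?w p" by (intro *) simp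
      with nn show ?thesis unfolding distrib_left mult.commute[of "?w p" "?w q"] add.commute[of p q]
        by linarith
    qed
  qed
  have "(\<integral>\<^sup>+t. ennreal (?w (t - a) * ?w (c - t)) \<partial>lborel)
      \<le> (\<integral>\<^sup>+t. ennreal (2 powr \<theta> * ?w (c - a)) * (ennreal (?w (t - a)) + ennreal (?w (c - t))) \<partial>lborel)"
  proof (intro nn_integral_mono)
    fix t
    show "ennreal (?w (t - a) * ?w (c - t))
        \<le> ennreal (2 powr \<theta> * ?w (c - a)) * (ennreal (?w (t - a)) + ennreal (?w (c - t)))"
      using pt[of "t - a" "c - t"] by (simp flip: ennreal_plus ennreal_mult)
  qed
  also have "... = ennreal (2 powr \<theta> * ?w (c - a)) *
      ((\<integral>\<^sup>+t. ennreal (?w (t - a)) \<partial>lborel) + (\<integral>\<^sup>+t. ennreal (?w (c - t)) \<partial>lborel))"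
    by (simp add: nn_integral_cmult nn_integral_add)
  also have "(\<integral>\<^sup>+t. ennreal (?w (t - a)) \<partial>lborel) = ennreal (jbracket_mass \<theta>)"
    using nn_integral_affine_unit_real[of "\<lambda>t. ennreal (?w t)" 1 "- a"] jbracket_mass[OF \<theta>]
    by (simp add: add.commute)
  also have "(\<integral>\<^sup>+t. ennreal (?w (c - t)) \<partial>lborel) = ennreal (jbracket_mass \<theta>)"
    using nn_integral_affine_unit_real[of "\<lambda>t. ennreal (?w t)" "-1" c] jbracket_mass[OF \<theta>]
    by simp
  finally show ?thesis
    using jbracket_mass(2)[OF \<theta>]
    by (simp flip: ennreal_plus ennreal_mult add: algebra_simps)
qed

text \<open>Monotone convergence along growing compact intervals, so that a substitution need only
  be carried out on compact intervals. The extra 1 in the endpoints keeps the interval nondegenerate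
  for \<open>n = 0\<close>.\<close>

lemma nn_integral_le_of_intervals:
  fixes h :: "real \<Rightarrow> ennreal"
  assumes [measurable]: "h \<in> borel_measurable borel"
    and bound: "\<And>a b. a < b \<Longrightarrow> (\<integral>\<^sup>+x. h x * indicator {a..b} x \<partial>lborel) \<le> C"
  shows "(\<integral>\<^sup>+x. h x \<partial>lborel) \<le> C"
proof -
  have "(\<integral>\<^sup>+x. h x \<partial>lborel) = (\<integral>\<^sup>+x. (SUP n::nat. h x * indicator {- real n - 1..real n + 1} x) \<partial>lborel)"
  proof (intro nn_integral_cong)
    fix x :: real
    obtain n :: nat where n: "\<bar>x\<bar> \<le> real n" using real_arch_simple by blast
    show "h x = (SUP n::nat. h x * indicator {- real n - 1..real n + 1} x)"
    proof (rule antisym)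
      show "h x \<le> (SUP n::nat. h x * indicator {- real n - 1..real n + 1} x)"
        using n by (intro SUP_upper2[of n]) (auto simp: indicator_def)
      show "(SUP n::nat. h x * indicator {- real n - 1..real n + 1} x) \<le> h x"
        by (intro SUP_least) (auto simp: indicator_def)
    qed
  qed
  also have "... = (SUP n::nat. \<integral>\<^sup>+x. h x * indicator {- real n - 1..real n + 1} x \<partial>lborel)"
    by (intro nn_integral_monotone_convergence_SUP)
       (auto simp: incseq_def le_fun_def indicator_def)
  also have "... \<le> C"
    by (intro SUP_least bound) auto
  finally show ?thesis .
qed

text \<open>Where \<open>g\<close> is monotone, substitution turns the left side into the integral
  of \<open>f\<close> over the image of the interval, a part of the line. The decreasing case is the
  increasing one for \<open>- g\<close> and the reflected \<open>f\<close>.\<close>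

lemma nn_integral_deriv_comp_le:
  fixes f :: "real \<Rightarrow> ennreal" and g g' :: "real \<Rightarrow> real"
  assumes [measurable]: "f \<in> borel_measurable borel"
    and deriv: "\<And>x. (g has_real_derivative g' x) (at x)"
    and cont: "continuous_on UNIV g'"
    and ab: "a \<le> b"
    and sign: "(\<forall>x\<in>{a..b}. 0 \<le> g' x) \<or> (\<forall>x\<in>{a..b}. g' x \<le> 0)"
  shows "(\<integral>\<^sup>+x. f (g x) * ennreal \<bar>g' x\<bar> * indicator {a..b} x \<partial>lborel) \<le> (\<integral>\<^sup>+y. f y \<partial>lborel)"
proof (cases "a = b")
  case True
  have "AE x in lborel. x \<noteq> a" by (rule AE_lborel_singleton)
  then have "(\<integral>\<^sup>+x. f (g x) * ennreal \<bar>g' x\<bar> * indicator {a..b} x \<partial>lborel) = nn_integral lborel (\<lambda>x::real. 0)"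
    by (intro nn_integral_cong_AE) (auto simp: True)
  then show ?thesis by simp
next
  case False
  with ab have "a < b" by simp
  from sign show ?thesis
  proof
    assume s: "\<forall>x\<in>{a..b}. 0 \<le> g' x"
    have "(\<integral>\<^sup>+x. f (g x) * ennreal \<bar>g' x\<bar> * indicator {a..b} x \<partial>lborel)
        = (\<integral>\<^sup>+x. f (g x) * ennreal (g' x) * indicator {a..b} x \<partial>lborel)"
      using s by (intro nn_integral_cong) (auto simp: indicator_def)
    also have "... = (\<integral>\<^sup>+x. f x * indicator {g a..g b} x \<partial>lborel)"
      using s deriv \<open>a < b\<close> continuous_on_subset[OF cont]
      by (intro nn_integral_substitution_aux[symmetric]) auto
    also have "... \<le> (\<integral>\<^sup>+y. f y \<partial>lborel)"
      by (intro nn_integral_mono) (auto simp: indicator_def)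
    finally show ?thesis .
  next
    assume s: "\<forall>x\<in>{a..b}. g' x \<le> 0"
    have "(\<integral>\<^sup>+x. f (g x) * ennreal \<bar>g' x\<bar> * indicator {a..b} x \<partial>lborel)
        = (\<integral>\<^sup>+x. f (- (- g x)) * ennreal (- g' x) * indicator {a..b} x \<partial>lborel)"
      using s by (intro nn_integral_cong) (auto simp: indicator_def)
    also have "... = (\<integral>\<^sup>+x. f (- x) * indicator {- g a..- g b} x \<partial>lborel)"
      using s deriv \<open>a < b\<close> continuous_on_subset[OF cont]
      by (intro nn_integral_substitution_aux[symmetric, where f = "\<lambda>x. f (- x)" and g = "\<lambda>x. - g x"])
         (auto intro!: derivative_eq_intros continuous_intros)
    also have "... \<le> (\<integral>\<^sup>+y. f (- y) \<partial>lborel)"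
      by (intro nn_integral_mono) (auto simp: indicator_def)
    also have "... = (\<integral>\<^sup>+y. f y \<partial>lborel)" by (rule nn_integral_uminus_real) simp
    finally show ?thesis .
  qed
qed

text \<open>For fixed total frequency \<open>-k\<close> the resonance function is monotone on each side of the
  point \<open>- k / 2\<close>.\<close>

lemma resonance_substitution:
  fixes f :: "real \<Rightarrow> ennreal"
  assumes [measurable]: "f \<in> borel_measurable borel"
  shows "(\<integral>\<^sup>+x. f (A - x ^ 5 - (- k - x) ^ 5) * ennreal \<bar>x ^ 4 - (- k - x) ^ 4\<bar> \<partial>lborel)
      \<le> 2 * (\<integral>\<^sup>+y. f y \<partial>lborel)"
proof (rule nn_integral_le_of_intervals)
  fix a b :: real assume "a < b"
  define g where "g = (\<lambda>x. A - x ^ 5 - (- k - x) ^ 5)"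
  define g' where "g' = (\<lambda>x. - 5 * x ^ 4 + 5 * (- k - x) ^ 4)"
  define c where "c = - k / 2"
  have deriv: "(g has_real_derivative g' x) (at x)" for x
    unfolding g_def g'_def by (auto intro!: derivative_eq_intros)
  have cont: "continuous_on UNIV g'"
    unfolding g'_def by (intro continuous_intros)
  \<comment> \<open>The last factor is a sum of squares, so \<open>c\<close> is the only possible
    sign change. The endpoints \<open>min a c\<close> and \<open>max b c\<close> used below cover
    the given interval whether or not \<open>c\<close> lies in it.\<close>
  have fact: "g' x = 10 * k * (x - c) * (x\<^sup>2 + (k + x)\<^sup>2)" for x
    unfolding g'_def c_def by (simp add: power2_eq_square power4_eq_xxxx algebra_simps)
  have sg: "(\<forall>x\<in>{p..q}. 0 \<le> g' x) \<or> (\<forall>x\<in>{p..q}. g' x \<le> 0)" if "q \<le> c \<or> c \<le> p" for p q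
    unfolding fact using that
    by (cases "0 \<le> k") (auto simp: zero_le_mult_iff mult_le_0_iff)
  have [measurable]: "g \<in> borel_measurable borel" "g' \<in> borel_measurable borel"
    unfolding g_def g'_def by measurable
  have le: "ennreal \<bar>x ^ 4 - (- k - x) ^ 4\<bar> \<le> ennreal \<bar>g' x\<bar>" for x
    unfolding g'_def by (auto intro!: ennreal_leI)
  have "(\<integral>\<^sup>+x. f (A - x ^ 5 - (- k - x) ^ 5) * ennreal \<bar>x ^ 4 - (- k - x) ^ 4\<bar> * indicator {a..b} x \<partial>lborel)
      \<le> (\<integral>\<^sup>+x. f (g x) * ennreal \<bar>g' x\<bar> * indicator {min a c..c} x
            + f (g x) * ennreal \<bar>g' x\<bar> * indicator {c..max b c} x \<partial>lborel)"
  proof (intro nn_integral_mono)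
    fix x
    have "f (g x) * ennreal \<bar>x ^ 4 - (- k - x) ^ 4\<bar> \<le> f (g x) * ennreal \<bar>g' x\<bar>"
      using le by (intro mult_left_mono) auto
    then show "f (A - x ^ 5 - (- k - x) ^ 5) * ennreal \<bar>x ^ 4 - (- k - x) ^ 4\<bar> * indicator {a..b} x
        \<le> f (g x) * ennreal \<bar>g' x\<bar> * indicator {min a c..c} x
            + f (g x) * ennreal \<bar>g' x\<bar> * indicator {c..max b c} x"
      by (auto simp: g_def indicator_def intro: order_trans)
  qed
  also have "... = (\<integral>\<^sup>+x. f (g x) * ennreal \<bar>g' x\<bar> * indicator {min a c..c} x \<partial>lborel)
            + (\<integral>\<^sup>+x. f (g x) * ennreal \<bar>g' x\<bar> * indicator {c..max b c} x \<partial>lborel)"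
    by (intro nn_integral_add) auto
  also have "... \<le> (\<integral>\<^sup>+y. f y \<partial>lborel) + (\<integral>\<^sup>+y. f y \<partial>lborel)"
    by (intro add_mono nn_integral_deriv_comp_le deriv cont sg) auto
  finally show "(\<integral>\<^sup>+x. f (A - x ^ 5 - (- k - x) ^ 5) * ennreal \<bar>x ^ 4 - (- k - x) ^ 4\<bar> * indicator {a..b} x \<partial>lborel)
      \<le> 2 * (\<integral>\<^sup>+y. f y \<partial>lborel)"
    by (simp add: mult_2)
qed auto

section \<open>Kernels for Schur's test\<close>

definition modulation :: "real \<times> real \<Rightarrow> real" where
  "modulation z = fst z - snd z ^ 5"

text \<open>The first term is the derivative of the resonance function in \<open>x\<close> for fixed \<open>k = - x - y\<close>,
  up to a factor 5. The other two have integrals in \<open>x\<close> bounded uniformly in \<open>k\<close>; the last one covers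
  the neighbourhood of the critical point \<open>x = y\<close>.\<close>

definition freq_kernel :: "real \<Rightarrow> real \<Rightarrow> real \<Rightarrow> real" where
  "freq_kernel k x y = \<bar>x ^ 4 - y ^ 4\<bar> + (if \<bar>x\<bar> \<le> 8 \<and> \<bar>y\<bar> \<le> 8 then 1 else 0)
     + \<bar>k\<bar> * (if \<bar>k\<bar> * \<bar>x - y\<bar> < 1 then 1 else 0)"

definition schur_kernel :: "real \<Rightarrow> real \<times> real \<Rightarrow> real \<times> real \<Rightarrow> real \<times> real \<Rightarrow> real" where
  "schur_kernel \<theta> a b c = freq_kernel (snd a) (snd b) (snd c) *
     (jbracket (modulation b) powr (- \<theta>) * jbracket (modulation c) powr (- \<theta>))"

lemma freq_kernel_nonneg [simp]: "0 \<le> freq_kernel k x y"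
  by (simp add: freq_kernel_def)

lemma schur_kernel_nonneg [simp]: "0 \<le> schur_kernel \<theta> a b c"
  by (simp add: schur_kernel_def)

lemma modulation_measurable [measurable]: "modulation \<in> borel_measurable borel"
  unfolding modulation_def[abs_def] borel_prod[symmetric] by measurable

text \<open>One contribution for each term of the kernel: the substitution gives twice the mass; the
  box of low frequencies confines \<open>x\<close> to an interval of length 16; the neighbourhood of
  the critical point is an interval of length \<open>1 / \<bar>k\<bar>\<close>, which the factor
  \<open>\<bar>k\<bar>\<close> turns into 1.\<close>

lemma freq_kernel_integral:
  assumes \<theta>: "\<theta> > 1"
  shows "(\<integral>\<^sup>+x. ennreal (freq_kernel k x (- k - x) * jbracket (A - x ^ 5 - (- k - x) ^ 5) powr (- \<theta>)) \<partial>lborel)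
     \<le> ennreal (2 * jbracket_mass \<theta> + 17)"
proof -
  let ?w = "\<lambda>x. jbracket (A - x ^ 5 - (- k - x) ^ 5) powr (- \<theta>)"
  have w1: "?w x \<le> 1" for x
    using powr_mono[of "- \<theta>" 0 "jbracket (A - x ^ 5 - (- k - x) ^ 5)"] \<theta> jbracket_ge_1
    by (simp add: less_imp_neq[OF jbracket_pos, symmetric])
  have "(\<integral>\<^sup>+x. ennreal (freq_kernel k x (- k - x) * ?w x) \<partial>lborel)
     \<le> (\<integral>\<^sup>+x. ennreal (?w x) * ennreal \<bar>x ^ 4 - (- k - x) ^ 4\<bar> + (indicator {-8..8} x
          + ennreal \<bar>k\<bar> * indicator {x. \<bar>k\<bar> * \<bar>2 * x + k\<bar> < 1} x) \<partial>lborel)"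
  proof (intro nn_integral_mono)
    fix x
    have "freq_kernel k x (- k - x) * ?w x \<le> ?w x * \<bar>x ^ 4 - (- k - x) ^ 4\<bar>
       + (indicator {-8..8} x + \<bar>k\<bar> * indicator {x. \<bar>k\<bar> * \<bar>2 * x + k\<bar> < 1} x)"
    proof -
      have "freq_kernel k x (- k - x) \<le> \<bar>x ^ 4 - (- k - x) ^ 4\<bar>
       + (indicator {-8..8} x + \<bar>k\<bar> * indicator {x. \<bar>k\<bar> * \<bar>2 * x + k\<bar> < 1} x)"
        unfolding freq_kernel_def by (auto simp: indicator_def algebra_simps)
      from mult_right_mono[OF this, of "?w x"]
      have "freq_kernel k x (- k - x) * ?w x \<le> ?w x * \<bar>x ^ 4 - (- k - x) ^ 4\<bar>
       + ?w x * (indicator {-8..8} x + \<bar>k\<bar> * indicator {x. \<bar>k\<bar> * \<bar>2 * x + k\<bar> < 1} x)"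
        by (simp add: algebra_simps)
      also have "... \<le> ?w x * \<bar>x ^ 4 - (- k - x) ^ 4\<bar>
       + 1 * (indicator {-8..8} x + \<bar>k\<bar> * indicator {x. \<bar>k\<bar> * \<bar>2 * x + k\<bar> < 1} x)"
        using w1 by (intro add_left_mono mult_right_mono) auto
      finally show ?thesis by simp
    qed
    from ennreal_leI[OF this]
    show "ennreal (freq_kernel k x (- k - x) * ?w x) \<le>
       ennreal (?w x) * ennreal \<bar>x ^ 4 - (- k - x) ^ 4\<bar> + (indicator {-8..8} x
          + ennreal \<bar>k\<bar> * indicator {x. \<bar>k\<bar> * \<bar>2 * x + k\<bar> < 1} x)"
      by (simp add: ennreal_mult ennreal_indicator)
  qed
  also have "... = (\<integral>\<^sup>+x. ennreal (?w x) * ennreal \<bar>x ^ 4 - (- k - x) ^ 4\<bar> \<partial>lborel)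
      + ((\<integral>\<^sup>+x. indicator {-8..8::real} x \<partial>lborel)
      + (\<integral>\<^sup>+x. ennreal \<bar>k\<bar> * indicator {x. \<bar>k\<bar> * \<bar>2 * x + k\<bar> < 1} x \<partial>lborel))"
    by (subst nn_integral_add; (subst nn_integral_add)?; simp)
  also have "... \<le> ennreal (2 * jbracket_mass \<theta>) + (ennreal 16 + ennreal 1)"
  proof (intro add_mono)
    show "(\<integral>\<^sup>+x. ennreal (?w x) * ennreal \<bar>x ^ 4 - (- k - x) ^ 4\<bar> \<partial>lborel) \<le> ennreal (2 * jbracket_mass \<theta>)"
      using resonance_substitution[of "\<lambda>y. ennreal (jbracket y powr (- \<theta>))" A k] jbracket_mass[OF \<theta>]
      by (simp add: ennreal_mult)
    show "(\<integral>\<^sup>+x. indicator {-8..8::real} x \<partial>lborel) \<le> ennreal 16" by simp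
    show "(\<integral>\<^sup>+x. ennreal \<bar>k\<bar> * indicator {x. \<bar>k\<bar> * \<bar>2 * x + k\<bar> < 1} x \<partial>lborel) \<le> ennreal 1"
    proof (cases "k = 0")
      case False
      define r where "r = 1 / (2 * \<bar>k\<bar>)"
      have r: "0 < r" "\<bar>k\<bar> * (2 * r) = 1" using False by (auto simp: r_def)
      have "x \<in> {- k / 2 - r..- k / 2 + r}" if "\<bar>k\<bar> * \<bar>2 * x + k\<bar> < 1" for x
      proof -
        have "\<bar>k\<bar> * \<bar>2 * x + k\<bar> < \<bar>k\<bar> * (2 * r)" using that r by simp
        then have "\<bar>2 * x + k\<bar> < 2 * r" by (simp add: mult_less_cancel_left)
        then show ?thesis by auto
      qed
      then have "(\<integral>\<^sup>+x. ennreal \<bar>k\<bar> * indicator {x. \<bar>k\<bar> * \<bar>2 * x + k\<bar> < 1} x \<partial>lborel)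
         \<le> (\<integral>\<^sup>+x. ennreal \<bar>k\<bar> * indicator {- k / 2 - r..- k / 2 + r} x \<partial>lborel)"
        by (intro nn_integral_mono) (auto simp: indicator_def)
      also have "... = ennreal \<bar>k\<bar> * ennreal (2 * r)"
        using r(1) by (simp add: nn_integral_cmult)
      also have "... = ennreal 1" using r by (simp flip: ennreal_mult)
      finally show ?thesis .
    qed simp
  qed
  also have "... = ennreal (2 * jbracket_mass \<theta> + (16 + 1))"
    using jbracket_mass(2)[OF \<theta>] by (subst ennreal_plus, simp, simp, subst ennreal_plus) auto
  also have "... = ennreal (2 * jbracket_mass \<theta> + 17)" by simp
  finally show ?thesis .
qed

lemma schur_kernel_measurable [measurable]:
  "(\<lambda>x. schur_kernel \<theta> (f x) (g x) (h x)) \<in> borel_measurable M"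
  if [measurable]: "f \<in> measurable M borel" "g \<in> measurable M borel" "h \<in> measurable M borel"
proof -
  have [measurable]: "(snd :: real \<times> real \<Rightarrow> real) \<in> borel_measurable borel"
    unfolding borel_prod[symmetric] by measurable
  show ?thesis
    unfolding schur_kernel_def freq_kernel_def by measurable
qed

lemma nn_integral_lborel_time_first:
  fixes f :: "real \<times> real \<Rightarrow> ennreal"
  assumes "f \<in> borel_measurable borel"
  shows "(\<integral>\<^sup>+z. f z \<partial>lborel) = (\<integral>\<^sup>+x. \<integral>\<^sup>+t. f (t, x) \<partial>lborel \<partial>lborel)"
proof -
  have "f \<in> borel_measurable (lborel \<Otimes>\<^sub>M lborel)" using assms by (simp add: lborel_prod)
  from lborel_pair.nn_integral_snd[OF this] show ?thesis by (simp add: lborel_prod)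
qed

definition schur_const :: "real \<Rightarrow> real" where
  "schur_const \<theta> = 2 * 2 powr \<theta> * jbracket_mass \<theta> * (2 * jbracket_mass \<theta> + 17)"

text \<open>The frequency factor does not depend on time, so the inner integral is a convolution of
  two bracket powers and leaves the bracket at the resonance function. The constant is the product
  of those of \<open>jbracket_convolution\<close> and \<open>freq_kernel_integral\<close>.\<close>

lemma schur_kernel_integral:
  assumes \<theta>: "\<theta> > 1"
  shows "(\<integral>\<^sup>+b. ennreal (schur_kernel \<theta> a b (- a - b)) \<partial>lborel) \<le> ennreal (schur_const \<theta>)"
proof -
  obtain s k where a: "a = (s, k)" by force
  let ?K = "2 * 2 powr \<theta> * jbracket_mass \<theta>"
  have [simp]: "0 \<le> ?K" using jbracket_mass(2)[OF \<theta>] by simp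
  have "(\<integral>\<^sup>+b. ennreal (schur_kernel \<theta> a b (- a - b)) \<partial>lborel)
     = (\<integral>\<^sup>+x. \<integral>\<^sup>+t. ennreal (freq_kernel k x (- k - x)) * ennreal (jbracket (t - x ^ 5) powr (- \<theta>)
          * jbracket ((- s - (- k - x) ^ 5) - t) powr (- \<theta>)) \<partial>lborel \<partial>lborel)"
    by (subst nn_integral_lborel_time_first, measurable)
       (auto simp: a schur_kernel_def modulation_def ennreal_mult algebra_simps)
  also have "... = (\<integral>\<^sup>+x. ennreal (freq_kernel k x (- k - x)) * (\<integral>\<^sup>+t. ennreal (jbracket (t - x ^ 5) powr (- \<theta>)
          * jbracket ((- s - (- k - x) ^ 5) - t) powr (- \<theta>)) \<partial>lborel) \<partial>lborel)"
    by (intro nn_integral_cong nn_integral_cmult) auto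
  also have "... \<le> (\<integral>\<^sup>+x. ennreal (freq_kernel k x (- k - x)) *
        ennreal (?K * jbracket ((- s - (- k - x) ^ 5) - x ^ 5) powr (- \<theta>)) \<partial>lborel)"
    by (intro nn_integral_mono mult_left_mono jbracket_convolution \<theta>) auto
  also have "... = (\<integral>\<^sup>+x. ennreal ?K * ennreal (freq_kernel k x (- k - x) *
         jbracket (- s - x ^ 5 - (- k - x) ^ 5) powr (- \<theta>)) \<partial>lborel)"
    using jbracket_mass(2)[OF \<theta>]
    by (intro nn_integral_cong) (simp add: algebra_simps flip: ennreal_mult)
  also have "... = ennreal ?K * (\<integral>\<^sup>+x. ennreal (freq_kernel k x (- k - x) *
         jbracket (- s - x ^ 5 - (- k - x) ^ 5) powr (- \<theta>)) \<partial>lborel)"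
    unfolding freq_kernel_def by (rule nn_integral_cmult) measurable
  also have "... \<le> ennreal ?K * ennreal (2 * jbracket_mass \<theta> + 17)"
    by (intro mult_left_mono freq_kernel_integral \<theta>) auto
  also have "... = ennreal (schur_const \<theta>)"
    using jbracket_mass(2)[OF \<theta>] by (subst ennreal_mult[symmetric]) (auto simp: schur_const_def)
  finally show ?thesis .
qed

section \<open>The multiplier bound\<close>

text \<open>Raising the decay of a smaller modulation from \<open>1 - 2 * \<kappa>\<close> to
  \<open>1 + \<kappa>\<close> costs its power \<open>3 * \<kappa>\<close>, which the largest
  modulation dominates. It pays twice and keeps
  \<open>1 - 2 * \<kappa> - 6 * \<kappa>\<close>.\<close>

lemma modulation_dominance:
  fixes \<kappa> \<theta> :: real
  assumes "0 < \<kappa>" "\<kappa> \<le> 1/100" "\<theta> \<le> 1 + \<kappa>" "1 \<le> Lj" "1 \<le> Lh" "Lj \<le> Li" "Lh \<le> Li"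
  shows "Li powr (- (1 - 2 * \<kappa>)) * Lj powr (- (1 - 2 * \<kappa>)) * Lh powr (- (1 - 2 * \<kappa>))
     \<le> Li powr (- (1 - 8 * \<kappa>)) * (Lj powr (- \<theta>) * Lh powr (- \<theta>))"
proof -
  have *: "L powr (- (1 - 2 * \<kappa>)) \<le> Li powr (3 * \<kappa>) * L powr (- \<theta>)" if "1 \<le> L" "L \<le> Li" for L
  proof -
    have "L powr (- (1 - 2 * \<kappa>)) = L powr (3 * \<kappa>) * L powr (- (1 + \<kappa>))"
      by (simp flip: powr_add)
    also have "... \<le> Li powr (3 * \<kappa>) * L powr (- \<theta>)"
      using that assms by (intro mult_mono powr_mono2 powr_mono) auto
    finally show ?thesis .
  qed
  have "Li powr (- (1 - 2 * \<kappa>)) * Lj powr (- (1 - 2 * \<kappa>)) * Lh powr (- (1 - 2 * \<kappa>))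
     \<le> Li powr (- (1 - 2 * \<kappa>)) * (Li powr (3 * \<kappa>) * Lj powr (- \<theta>)) * (Li powr (3 * \<kappa>) * Lh powr (- \<theta>))"
    using *[of Lj] *[of Lh] assms by (intro mult_mono) auto
  also have "... = (Li powr (- (1 - 2 * \<kappa>)) * Li powr (3 * \<kappa>) * Li powr (3 * \<kappa>)) * (Lj powr (- \<theta>) * Lh powr (- \<theta>))"
    by simp
  also have "Li powr (- (1 - 2 * \<kappa>)) * Li powr (3 * \<kappa>) * Li powr (3 * \<kappa>) = Li powr (- (1 - 8 * \<kappa>))"
    by (simp flip: powr_add)
  finally show ?thesis .
qed

lemma freq_kernel_commute: "freq_kernel k x y = freq_kernel k y x"
  by (simp add: freq_kernel_def abs_minus_commute)

lemma freq_kernel_ge_diff: "\<bar>x ^ 4 - y ^ 4\<bar> \<le> freq_kernel k x y"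
  by (simp add: freq_kernel_def)

lemma freq_kernel_ge_1: "\<bar>x\<bar> \<le> 8 \<Longrightarrow> \<bar>y\<bar> \<le> 8 \<Longrightarrow> 1 \<le> freq_kernel k x y"
  by (simp add: freq_kernel_def)

lemma quartic_diff:
  fixes x y z :: real
  assumes "x + y + z = 0"
  shows "\<bar>y ^ 4 - z ^ 4\<bar> = \<bar>x\<bar> * \<bar>y - z\<bar> * (y\<^sup>2 + z\<^sup>2)"
proof -
  have x: "x = - (y + z)" using assms by linarith
  have "y ^ 4 - z ^ 4 = - x * (y - z) * (y\<^sup>2 + z\<^sup>2)"
    unfolding x by (simp add: power2_eq_square power4_eq_xxxx algebra_simps)
  then show ?thesis by (simp add: abs_mult)
qed

text \<open>Freezing the smallest frequency is harmless: \<open>y\<close> and \<open>z\<close> then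
  have opposite signs, so \<open>\<bar>y - z\<bar>\<close> is at least \<open>M\<close> and the
  critical point \<open>y = z\<close> is far away.\<close>

lemma freq_kernel_lower_min:
  fixes x y z :: real
  assumes sum: "x + y + z = 0" and "\<bar>x\<bar> \<le> \<bar>y\<bar>" "\<bar>x\<bar> \<le> \<bar>z\<bar>" and M: "M = max \<bar>y\<bar> \<bar>z\<bar>"
  shows "\<bar>x\<bar> * M ^ 3 \<le> freq_kernel x y z"
proof -
  have 1: "M \<le> \<bar>y - z\<bar>" using assms by linarith
  have "M\<^sup>2 = max (y\<^sup>2) (z\<^sup>2)" unfolding M by (auto simp: max_def abs_le_square_iff)
  then have 2: "M\<^sup>2 \<le> y\<^sup>2 + z\<^sup>2" by (simp add: max_def)
  have "\<bar>x\<bar> * M ^ 3 = \<bar>x\<bar> * M * M\<^sup>2" by (simp add: power2_eq_square power3_eq_cube)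
  also have "... \<le> \<bar>x\<bar> * \<bar>y - z\<bar> * (y\<^sup>2 + z\<^sup>2)"
    using 1 2 M by (intro mult_mono) auto
  also have "... \<le> freq_kernel x y z" using quartic_diff[OF sum] freq_kernel_ge_diff by metis
  finally show ?thesis .
qed

text \<open>Here a large frequency \<open>y\<close> is frozen and the free pair \<open>x\<close>,
  \<open>z\<close> may approach the critical point. If \<open>\<bar>x - z\<bar>\<close> is at least
  1, the derivative is of order \<open>M^3\<close>. Otherwise \<open>\<bar>x\<bar>\<close> is at
  least \<open>M / 4\<close>, so the hypothesis on \<open>g * x^2\<close> leaves only
  \<open>16 * M\<close> to be bounded. Within distance \<open>1 / \<bar>y\<bar>\<close> of the
  critical point the last term of the kernel supplies this, and beyond it the derivative is still of
  order \<open>M^2\<close>.\<close>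

lemma freq_kernel_lower_max:
  fixes x y z :: real
  assumes sum: "x + y + z = 0" and le: "\<bar>x\<bar> \<le> \<bar>y\<bar>" "\<bar>x\<bar> \<le> \<bar>z\<bar>"
    and M: "M = max \<bar>y\<bar> \<bar>z\<bar>" "8 < M"
    and g: "g \<le> 1" "g * x\<^sup>2 \<le> 1" "0 \<le> g"
  shows "g * M ^ 3 \<le> 32 * freq_kernel y x z"
proof -
  have y: "M / 2 \<le> \<bar>y\<bar>" and z: "M / 2 \<le> \<bar>z\<bar>" and yM: "\<bar>y\<bar> \<le> M" using assms by linarith+
  have z2: "(M / 2)\<^sup>2 \<le> x\<^sup>2 + z\<^sup>2"
  proof -
    have "(M / 2)\<^sup>2 \<le> \<bar>z\<bar>\<^sup>2" using z M(2) by (intro power_mono) auto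
    then show ?thesis by (simp add: add_increasing)
  qed
  have "M ^ 3 * \<bar>x - z\<bar> / 8 = (M / 2) * \<bar>x - z\<bar> * (M / 2)\<^sup>2"
    by (simp add: power2_eq_square power3_eq_cube)
  also have "... \<le> \<bar>y\<bar> * \<bar>x - z\<bar> * (x\<^sup>2 + z\<^sup>2)"
    using y z2 M(2) by (intro mult_mono) auto
  also have "... \<le> freq_kernel y x z"
    using quartic_diff[of y x z] freq_kernel_ge_diff[of x z y] sum by (simp add: add.commute add.left_commute)
  finally have diff: "M ^ 3 * \<bar>x - z\<bar> \<le> 8 * freq_kernel y x z" by simp
  show ?thesis
  proof (cases "1 \<le> \<bar>x - z\<bar>")
    case True
    have "g * M ^ 3 \<le> \<bar>x - z\<bar> * M ^ 3" using True g M(2) by (intro mult_right_mono) auto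
    also have "... = M ^ 3 * \<bar>x - z\<bar>" by (rule mult.commute)
    finally show ?thesis using diff freq_kernel_nonneg[of y x z] by linarith
  next
    case False
    then have x: "M / 4 \<le> \<bar>x\<bar>" using z M(2) by linarith
    have "(M / 4)\<^sup>2 \<le> \<bar>x\<bar>\<^sup>2" using x M(2) by (intro power_mono) auto
    then have "g * (M / 4)\<^sup>2 \<le> g * x\<^sup>2" using g by (intro mult_left_mono) auto
    then have "g * M\<^sup>2 \<le> 16" using g(2) by (simp add: power_divide)
    then have "g * M\<^sup>2 * M \<le> 16 * M" using M(2) by (intro mult_right_mono) auto
    then have gM: "g * M ^ 3 \<le> 16 * M" by (simp add: power2_eq_square power3_eq_cube mult.assoc)
    show ?thesis
    proof (cases "\<bar>y\<bar> * \<bar>x - z\<bar> < 1")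
      case True
      then have "\<bar>y\<bar> \<le> freq_kernel y x z" by (simp add: freq_kernel_def)
      then show ?thesis using gM y by linarith
    next
      case False
      then have "1 \<le> M * \<bar>x - z\<bar>" using mult_right_mono[OF yM, of "\<bar>x - z\<bar>"] by simp
      then have "M\<^sup>2 * 1 \<le> M\<^sup>2 * (M * \<bar>x - z\<bar>)" by (intro mult_left_mono) auto
      then have "M\<^sup>2 \<le> 8 * freq_kernel y x z"
        using diff by (simp add: power2_eq_square power3_eq_cube mult.assoc)
      moreover have "8 * M \<le> M\<^sup>2" using M(2) by (simp add: power2_eq_square)
      ultimately show ?thesis using gM freq_kernel_nonneg[of y x z] by linarith
    qed
  qed
qed

text \<open>The exponents are those of \<open>s = - (7/4 - 8 * \<kappa>)\<close>: the powers of \<open>M\<close> and \<open>L \<ge> c \<bar>x\<bar> M ^ 4\<close>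
  combine to exactly \<open>M ^ 3\<close>, the order of the derivative of the resonance function.\<close>

lemma resonant_weight_bound:
  fixes x y z \<kappa> L :: real
  assumes \<kappa>: "0 < \<kappa>" "\<kappa> \<le> 1/100"
    and sum: "x + y + z = 0" and le: "\<bar>x\<bar> \<le> \<bar>y\<bar>" "\<bar>x\<bar> \<le> \<bar>z\<bar>"
    and M: "M = max \<bar>y\<bar> \<bar>z\<bar>" "8 < M"
    and L: "\<bar>x * y * z\<bar> * (x\<^sup>2 + y\<^sup>2 + z\<^sup>2) \<le> 3 * L" "1 \<le> L"
  defines "A \<equiv> x\<^sup>2 * jbracket x powr (- (7/2 - 16 * \<kappa>)) * M powr (7 - 32 * \<kappa>) * L powr (- (1 - 8 * \<kappa>))"
  shows "A \<le> 192 * freq_kernel x y z" "A \<le> 192 * freq_kernel y x z" "A \<le> 192 * freq_kernel z x y"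
proof -
  \<comment> \<open>\<open>g\<close> collects the powers of \<open>x\<close> that remain when
    \<open>L\<close> is replaced by its lower bound of order \<open>\<bar>x\<bar> * M^4\<close>; the
    powers of \<open>M\<close> then combine to \<open>M ^ 3\<close>.\<close>
  define g where "g = (if x = 0 then 0 else \<bar>x\<bar> powr (1 + 8 * \<kappa>) * jbracket x powr (- (7/2 - 16 * \<kappa>)))"
  have A: "A \<le> 6 * (g * M ^ 3)"
  proof (cases "x = 0")
    case False
    have yz: "M * (M / 2) \<le> \<bar>y\<bar> * \<bar>z\<bar>"
    proof (cases "\<bar>y\<bar> \<le> \<bar>z\<bar>")
      case True
      then have "M = \<bar>z\<bar>" "M / 2 \<le> \<bar>y\<bar>" using assms by linarith+
      then have "(M / 2) * M \<le> \<bar>y\<bar> * \<bar>z\<bar>" by (intro mult_mono) auto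
      then show ?thesis by (simp add: mult.commute)
    next
      case False
      then have "M = \<bar>y\<bar>" "M / 2 \<le> \<bar>z\<bar>" using assms by linarith+
      then show ?thesis by (intro mult_mono) auto
    qed
    have "M\<^sup>2 = max (y\<^sup>2) (z\<^sup>2)" unfolding M(1) by (auto simp: max_def abs_le_square_iff)
    then have M2: "M\<^sup>2 \<le> x\<^sup>2 + y\<^sup>2 + z\<^sup>2" by (simp add: max_def add_increasing)
    have "\<bar>x\<bar> * M ^ 4 / 2 = \<bar>x\<bar> * (M * (M / 2)) * M\<^sup>2"
      by (simp add: power2_eq_square power4_eq_xxxx)
    also have "... \<le> \<bar>x\<bar> * (\<bar>y\<bar> * \<bar>z\<bar>) * (x\<^sup>2 + y\<^sup>2 + z\<^sup>2)"
      by (rule mult_mono[OF mult_left_mono[OF yz] M2]) auto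
    also have "... \<le> 3 * L" using L by (simp add: abs_mult mult.assoc)
    \<comment> \<open>The 6 is the 3 of the hypothesis on \<open>L\<close> times the 2 lost in
      bounding \<open>\<bar>y\<bar> * \<bar>z\<bar>\<close> below by half of
      \<open>M^2\<close>.\<close>
    finally have low: "\<bar>x\<bar> * M powr 4 / 6 \<le> L" using M(2) by simp
    have "L powr (- (1 - 8 * \<kappa>)) \<le> (\<bar>x\<bar> * M powr 4 / 6) powr (- (1 - 8 * \<kappa>))"
      using low False M(2) \<kappa> by (intro powr_mono2') auto
    also have "... = 6 powr (1 - 8 * \<kappa>) * (\<bar>x\<bar> powr (- (1 - 8 * \<kappa>)) * M powr (- 4 + 32 * \<kappa>))"
    proof -
      have "(6::real) powr (- (1 - 8 * \<kappa>)) = 1 / 6 powr (1 - 8 * \<kappa>)" by (rule powr_minus_divide)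
      then show ?thesis
        by (simp add: powr_divide powr_mult powr_powr algebra_simps del: powr_numeral)
    qed
    also have "... \<le> 6 powr 1 * (\<bar>x\<bar> powr (- (1 - 8 * \<kappa>)) * M powr (- 4 + 32 * \<kappa>))"
      using \<kappa> by (intro mult_right_mono powr_mono) auto
    finally have Lb: "L powr (- (1 - 8 * \<kappa>)) \<le> 6 * (\<bar>x\<bar> powr (- (1 - 8 * \<kappa>)) * M powr (- 4 + 32 * \<kappa>))"
      by simp
    have "A \<le> x\<^sup>2 * jbracket x powr (- (7/2 - 16 * \<kappa>)) * M powr (7 - 32 * \<kappa>) *
        (6 * (\<bar>x\<bar> powr (- (1 - 8 * \<kappa>)) * M powr (- 4 + 32 * \<kappa>)))"
      unfolding A_def by (intro mult_left_mono Lb) auto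
    also have "... = 6 * ((x\<^sup>2 * \<bar>x\<bar> powr (- (1 - 8 * \<kappa>))) * jbracket x powr (- (7/2 - 16 * \<kappa>)) *
        (M powr (7 - 32 * \<kappa>) * M powr (- 4 + 32 * \<kappa>)))"
      by simp
    also have "x\<^sup>2 * \<bar>x\<bar> powr (- (1 - 8 * \<kappa>)) = \<bar>x\<bar> powr (1 + 8 * \<kappa>)"
    proof -
      have "x\<^sup>2 = \<bar>x\<bar> powr 2" using False by simp
      then have "x\<^sup>2 * \<bar>x\<bar> powr (- (1 - 8 * \<kappa>)) = \<bar>x\<bar> powr (2 + - (1 - 8 * \<kappa>))"
        by (simp only: powr_add)
      then show ?thesis by simp
    qed
    also have "M powr (7 - 32 * \<kappa>) * M powr (- 4 + 32 * \<kappa>) = M ^ 3"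
      using M(2) by (simp flip: powr_add)
    also have "6 * (\<bar>x\<bar> powr (1 + 8 * \<kappa>) * jbracket x powr (- (7/2 - 16 * \<kappa>)) * M ^ 3) = 6 * (g * M ^ 3)"
      unfolding g_def using False by (simp only: if_False)
    finally show ?thesis .
  qed (simp add: A_def g_def)
  have g0: "0 \<le> g" by (simp add: g_def)
  \<comment> \<open>The first bound serves the kernel with \<open>x\<close> frozen, the other two
    serve \<open>freq_kernel_lower_max\<close>. For \<open>\<bar>x\<bar> > 1\<close> the exponent of
    \<open>\<bar>x\<bar>\<close> is \<open>- 5/2 + 24 * \<kappa>\<close>, which is at most -2 for
    this range of \<kappa>. The final constant 192 is 6 times 32.\<close>
  have small: "g \<le> \<bar>x\<bar> \<and> g \<le> 1 \<and> g * x\<^sup>2 \<le> 1"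
  proof (cases "\<bar>x\<bar> \<le> 1")
    case True
    have "jbracket x powr (- (7/2 - 16 * \<kappa>)) \<le> jbracket x powr 0"
      using \<kappa> jbracket_ge_1 by (intro powr_mono) auto
    then have j: "jbracket x powr (- (7/2 - 16 * \<kappa>)) \<le> 1"
      by (simp add: less_imp_neq[OF jbracket_pos, symmetric])
    have "g \<le> \<bar>x\<bar>"
    proof (cases "x = 0")
      case False
      have "\<bar>x\<bar> powr (1 + 8 * \<kappa>) \<le> \<bar>x\<bar> powr 1"
        using True \<kappa> by (intro powr_mono') auto
      then have "\<bar>x\<bar> powr (1 + 8 * \<kappa>) * jbracket x powr (- (7/2 - 16 * \<kappa>)) \<le> \<bar>x\<bar> * 1"
        using j by (intro mult_mono) auto
      then show ?thesis using False by (simp add: g_def)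
    qed (simp add: g_def)
    moreover have "x\<^sup>2 \<le> 1" using True by (simp add: abs_square_le_1)
    ultimately show ?thesis using True g0 mult_mono[of g 1 "x\<^sup>2" 1] by auto
  next
    case False
    have "jbracket x powr (- (7/2 - 16 * \<kappa>)) \<le> \<bar>x\<bar> powr (- (7/2 - 16 * \<kappa>))"
      using \<kappa> abs_le_jbracket[of x] False by (intro powr_mono2') auto
    then have "g \<le> \<bar>x\<bar> powr (1 + 8 * \<kappa>) * \<bar>x\<bar> powr (- (7/2 - 16 * \<kappa>))"
      unfolding g_def by (auto intro!: mult_left_mono)
    also have "... = \<bar>x\<bar> powr (- 5/2 + 24 * \<kappa>)" by (simp flip: powr_add)
    also have "... \<le> \<bar>x\<bar> powr (-2)" using False \<kappa> by (intro powr_mono) auto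
    also have "... = 1 / x\<^sup>2" using False by (simp add: powr_minus_divide)
    finally have *: "g \<le> 1 / x\<^sup>2" .
    have x1: "1 \<le> x\<^sup>2" using abs_square_less_1[of x] False by linarith
    have "1 / x\<^sup>2 \<le> 1 / 1" using x1 by (intro divide_left_mono) auto
    with * have "g \<le> 1" by simp
    moreover have "g * x\<^sup>2 \<le> 1" using mult_right_mono[OF *, of "x\<^sup>2"] False by (auto split: if_splits)
    ultimately show ?thesis using False by auto
  qed
  have "g * M ^ 3 \<le> \<bar>x\<bar> * M ^ 3" using small M(2) by (intro mult_right_mono) auto
  also have "... \<le> freq_kernel x y z" by (rule freq_kernel_lower_min[OF sum le M(1)])
  finally show "A \<le> 192 * freq_kernel x y z"
    using A freq_kernel_nonneg[of x y z] by linarith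
  show "A \<le> 192 * freq_kernel y x z"
    using A freq_kernel_lower_max[OF sum le M, of g] small g0 by linarith
  have sum': "x + z + y = 0" and M': "M = max \<bar>z\<bar> \<bar>y\<bar>"
    using sum M(1) by (simp_all add: max.commute)
  have "g * M ^ 3 \<le> 32 * freq_kernel z x y"
    using freq_kernel_lower_max[OF sum' le(2,1) M' M(2), of g] small g0 by simp
  then show "A \<le> 192 * freq_kernel z x y" using A by linarith
qed

text \<open>The frequency part of the squared multiplier at regularity \<open>s = - p / 2\<close>.
  The frequency \<open>k3\<close> belongs to the output, which carries the derivative;
  \<open>k1\<close> and \<open>k2\<close> belong to the inputs.\<close>

definition derivative_weight :: "real \<Rightarrow> real \<Rightarrow> real \<Rightarrow> real \<Rightarrow> real" where
  "derivative_weight p k1 k2 k3 =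
     k3\<^sup>2 * jbracket k3 powr (- p) * (jbracket k1 powr p * jbracket k2 powr p)"

lemma derivative_weight_nonneg [simp]: "0 \<le> derivative_weight p k1 k2 k3"
  by (simp add: derivative_weight_def)

lemma derivative_weight_commute: "derivative_weight p k1 k2 k3 = derivative_weight p k2 k1 k3"
  by (simp add: derivative_weight_def mult.commute)

lemma jbracket_powr_upper:
  assumes "\<bar>k\<bar> \<le> M" "1 \<le> M" "0 \<le> p"
  shows "jbracket k powr p \<le> (2 * M) powr p"
  using jbracket_le[of k] assms less_imp_le[OF jbracket_pos] by (intro powr_mono2) auto

text \<open>The derivative contributes at most 64, each input bracket at most 16 to the power 4, and
  the output bracket has a nonpositive exponent.\<close>

lemma derivative_weight_bounded:
  assumes p: "0 \<le> p" "p \<le> 4" and "\<bar>k1\<bar> \<le> 8" "\<bar>k2\<bar> \<le> 8" "\<bar>k3\<bar> \<le> 8"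
  shows "derivative_weight p k1 k2 k3 \<le> 64 * 16 ^ 8"
proof -
  have *: "jbracket k powr p \<le> 16 ^ 4" if "\<bar>k\<bar> \<le> 8" for k
  proof -
    have "jbracket k powr p \<le> (2 * 8) powr p" using that p by (intro jbracket_powr_upper) auto
    also have "... \<le> (2 * 8) powr 4" using p by (intro powr_mono) auto
    finally show ?thesis by simp
  qed
  have "jbracket k3 powr (- p) \<le> jbracket k3 powr 0"
    using p jbracket_ge_1 by (intro powr_mono) auto
  then have 3: "jbracket k3 powr (- p) \<le> 1"
    by (simp add: less_imp_neq[OF jbracket_pos, symmetric])
  have 2: "k3\<^sup>2 \<le> 64" using assms power_mono[of "\<bar>k3\<bar>" 8 2] by simp
  have "derivative_weight p k1 k2 k3 \<le> 64 * 1 * (16 ^ 4 * 16 ^ 4)"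
    unfolding derivative_weight_def using * assms 2 3 by (intro mult_mono) auto
  then show ?thesis by simp
qed

text \<open>Meant for a low output: only the input brackets are replaced, by \<open>2 * M\<close>,
  while the dependence on \<open>k3\<close> is kept exactly. The factor \<open>2 ^ 8\<close> bounds
  \<open>2 powr (2 * p)\<close>.\<close>

lemma derivative_weight_output_min:
  assumes p: "0 \<le> p" "p \<le> 4" and "\<bar>k1\<bar> \<le> M" "\<bar>k2\<bar> \<le> M" "1 \<le> M"
  shows "derivative_weight p k1 k2 k3 \<le> 2 ^ 8 * (k3\<^sup>2 * jbracket k3 powr (- p) * M powr (2 * p))"
proof -
  have "jbracket k1 powr p * jbracket k2 powr p \<le> (2 * M) powr p * (2 * M) powr p"
    using assms by (intro mult_mono jbracket_powr_upper) auto
  also have "... = 2 powr (2 * p) * M powr (2 * p)"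
  proof -
    have "(2 * M) powr p * (2 * M) powr p = (2 * M) powr (2 * p)"
      unfolding powr_add[symmetric] by simp
    then show ?thesis using assms by (simp add: powr_mult)
  qed
  also have "... \<le> 2 powr 8 * M powr (2 * p)"
    using p by (intro mult_right_mono powr_mono) auto
  finally have "jbracket k1 powr p * jbracket k2 powr p \<le> 2 ^ 8 * M powr (2 * p)" by simp
  then have "k3\<^sup>2 * jbracket k3 powr (- p) * (jbracket k1 powr p * jbracket k2 powr p) \<le>
      k3\<^sup>2 * jbracket k3 powr (- p) * (2 ^ 8 * M powr (2 * p))"
    by (intro mult_left_mono) auto
  then show ?thesis by (simp add: derivative_weight_def mult_ac)
qed

text \<open>Meant for a low input \<open>k1\<close>: the brackets of \<open>k2\<close> and
  \<open>k3\<close> carry opposite exponents and both are controlled by \<open>M\<close>, so they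
  cancel up to \<open>4 powr p\<close>, and the derivative costs \<open>M^2\<close>.\<close>

lemma derivative_weight_input_min:
  assumes p: "0 \<le> p" "p \<le> 4" and "\<bar>k2\<bar> \<le> M" "\<bar>k3\<bar> \<le> M" "M / 2 \<le> \<bar>k3\<bar>" "1 \<le> M"
  shows "derivative_weight p k1 k2 k3 \<le> 2 ^ 8 * (M\<^sup>2 * jbracket k1 powr p)"
proof -
  have 3: "k3\<^sup>2 \<le> M\<^sup>2" using assms abs_le_square_iff[of k3 M] by simp
  have "jbracket k3 powr (- p) \<le> (M / 2) powr (- p)"
    using assms abs_le_jbracket[of k3] by (intro powr_mono2') auto
  then have "derivative_weight p k1 k2 k3 \<le> M\<^sup>2 * (M / 2) powr (- p) * (jbracket k1 powr p * (2 * M) powr p)"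
    unfolding derivative_weight_def using 3 assms by (intro mult_mono jbracket_powr_upper) auto
  also have "... = (M / 2) powr (- p) * (2 * M) powr p * (M\<^sup>2 * jbracket k1 powr p)" by simp
  also have "(M / 2) powr (- p) * (2 * M) powr p = 4 powr p"
  proof -
    have "(2 * M) powr p = (4 * (M / 2)) powr p" by simp
    also have "... = 4 powr p * (M / 2) powr p" by (rule powr_mult)
    finally show ?thesis using assms by (simp add: powr_minus del: powr_numeral)
  qed
  also have "4 powr p * (M\<^sup>2 * jbracket k1 powr p) \<le> 4 powr 4 * (M\<^sup>2 * jbracket k1 powr p)"
    using p by (intro mult_right_mono powr_mono) auto
  finally show ?thesis by simp
qed

text \<open>Reduces a low input of size at least 1 to the weight of a low output. The quotient of
  the two weights is essentially the power \<open>2 * p - 2\<close> of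
  \<open>\<bar>x\<bar> / M\<close>, which is bounded because \<open>p\<close> is at least 1.\<close>

lemma input_min_le_output_min:
  fixes x M p :: real
  assumes p: "1 \<le> p" "p \<le> 4" and x: "1 \<le> \<bar>x\<bar>" "\<bar>x\<bar> \<le> M"
  shows "M\<^sup>2 * jbracket x powr p \<le> 2 ^ 8 * (x\<^sup>2 * jbracket x powr (- p) * M powr (2 * p))"
proof -
  have "jbracket x powr (2 * p) \<le> (2 * \<bar>x\<bar>) powr (2 * p)"
    using p x by (intro jbracket_powr_upper) auto
  also have "... = 2 powr (2 * p) * \<bar>x\<bar> powr (2 * p - 2) * x\<^sup>2"
  proof -
    have "\<bar>x\<bar> powr (2 * p) = \<bar>x\<bar> powr (2 * p - 2) * \<bar>x\<bar> powr 2"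
      unfolding powr_add[symmetric] by simp
    also have "\<bar>x\<bar> powr 2 = x\<^sup>2" using x by simp
    finally have "\<bar>x\<bar> powr (2 * p) = \<bar>x\<bar> powr (2 * p - 2) * x\<^sup>2" .
    then show ?thesis by (simp add: powr_mult)
  qed
  also have "... \<le> 2 powr 8 * M powr (2 * p - 2) * x\<^sup>2"
    using p x by (intro mult_right_mono mult_mono powr_mono powr_mono2) auto
  finally have *: "jbracket x powr (2 * p) \<le> 2 ^ 8 * M powr (2 * p - 2) * x\<^sup>2" by simp
  have "M\<^sup>2 * jbracket x powr p = (M\<^sup>2 * jbracket x powr (- p)) * jbracket x powr (2 * p)"
    by (simp flip: powr_add)
  also have "... \<le> (M\<^sup>2 * jbracket x powr (- p)) * (2 ^ 8 * M powr (2 * p - 2) * x\<^sup>2)"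
    using * by (intro mult_left_mono) auto
  also have "... = 2 ^ 8 * (x\<^sup>2 * jbracket x powr (- p) * (M\<^sup>2 * M powr (2 * p - 2)))" by simp
  also have "M\<^sup>2 * M powr (2 * p - 2) = M powr (2 * p)"
  proof -
    have "M\<^sup>2 = M powr 2" using x by simp
    then show ?thesis by (simp flip: powr_add)
  qed
  finally show ?thesis .
qed


text \<open>On low frequencies \<^const>\<open>D_norm\<close> improves the exponent \<open>2 * b < 1\<close> to some \<open>\<theta> > 1\<close>.\<close>

definition input_decay :: "real \<Rightarrow> real \<Rightarrow> real \<Rightarrow> real \<Rightarrow> real" where
  "input_decay \<theta> b k L = L powr (- (if \<bar>k\<bar> \<le> 1 then \<theta> else 2 * b))"

lemma scaled_le_trans:
  fixes a b c p q :: real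
  assumes "a \<le> p * b" "b \<le> q * c" "0 \<le> p"
  shows "a \<le> (p * q) * c"
  using order_trans[OF assms(1) mult_left_mono[OF assms(2,3)]] by (simp add: mult.assoc)

text \<open>With \<open>\<bar>k1\<bar> \<le> \<bar>k2\<bar>\<close> three configurations remain: all
  frequencies at most 8, smallest frequency in the output, smallest frequency \<open>k1\<close>. The
  resonance function settles the last two, unless \<open>\<bar>k1\<bar> < 1\<close> in the third.
  There it may vanish, and the decay \<theta> that \<open>input_decay\<close> grants to
  \<open>L1\<close> replaces the gain from the largest modulation.\<close>

lemma multiplier_bound_ordered:
  fixes k1 k2 k3 L1 L2 L3 \<kappa> \<theta> :: real
  assumes \<kappa>: "0 < \<kappa>" "\<kappa> \<le> 1/100" and \<theta>: "1 \<le> \<theta>" "\<theta> \<le> 1 + \<kappa>"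
    and sum: "k1 + k2 + k3 = 0" and L: "1 \<le> L1" "1 \<le> L2" "1 \<le> L3"
    and res: "\<bar>k1 * k2 * k3\<bar> * (k1\<^sup>2 + k2\<^sup>2 + k3\<^sup>2) \<le> L1 + L2 + L3"
    and ordered: "\<bar>k1\<bar> \<le> \<bar>k2\<bar>"
  shows "derivative_weight (7/2 - 16 * \<kappa>) k1 k2 k3 *
      (input_decay \<theta> (1/2 - \<kappa>) k1 L1 * input_decay \<theta> (1/2 - \<kappa>) k2 L2 * L3 powr (- (1 - 2 * \<kappa>)))
    \<le> 64 * 16 ^ 8 * (freq_kernel k1 k2 k3 * (L2 powr (- \<theta>) * L3 powr (- \<theta>))
        + freq_kernel k2 k1 k3 * (L1 powr (- \<theta>) * L3 powr (- \<theta>))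
        + freq_kernel k3 k1 k2 * (L1 powr (- \<theta>) * L2 powr (- \<theta>)))"
    (is "?m * ?D \<le> ?C * (?Q1 + ?Q2 + ?Q3)")
proof -
  let ?b = "\<lambda>L. L powr (- (1 - 2 * \<kappa>))"
  let ?e = "\<lambda>L. L powr (- (1 - 8 * \<kappa>))"
  let ?p = "7/2 - 16 * \<kappa>" and ?q = "7 - 32 * \<kappa>"
  let ?l = "input_decay \<theta> (1/2 - \<kappa>)"
  have Q: "0 \<le> ?Q1" "0 \<le> ?Q2" "0 \<le> ?Q3" by simp_all
  have l_le: "?l k L \<le> ?b L" "0 \<le> ?l k L" if "1 \<le> L" for k L
    using that \<kappa> \<theta> by (auto simp: input_decay_def intro!: powr_mono)
  have D: "?D \<le> ?b L1 * ?b L2 * ?b L3"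
    using l_le L by (intro mult_mono) auto
  \<comment> \<open>Only the kernel whose frozen point has the largest modulation has to dominate
    the weight; the two other terms on the right are nonnegative.\<close>
  have by_dominance: ?thesis
    if 1: "L2 \<le> L1 \<Longrightarrow> L3 \<le> L1 \<Longrightarrow> ?m * ?e L1 \<le> ?C * freq_kernel k1 k2 k3"
      and 2: "L1 \<le> L2 \<Longrightarrow> L3 \<le> L2 \<Longrightarrow> ?m * ?e L2 \<le> ?C * freq_kernel k2 k1 k3"
      and 3: "L1 \<le> L3 \<Longrightarrow> L2 \<le> L3 \<Longrightarrow> ?m * ?e L3 \<le> ?C * freq_kernel k3 k1 k2"
  proof -
    have main: "?m * ?D \<le> ?C * (R * (Lj powr (- \<theta>) * Lh powr (- \<theta>)))"
      if D': "?b L1 * ?b L2 * ?b L3 = ?b Li * ?b Lj * ?b Lh"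
        and dom: "1 \<le> Lj" "1 \<le> Lh" "Lj \<le> Li" "Lh \<le> Li"
        and bd: "?m * ?e Li \<le> ?C * R" for R Li Lj Lh
    proof -
      have "?m * ?D \<le> ?m * (?b Li * ?b Lj * ?b Lh)"
        using D D' by (intro mult_left_mono) auto
      also have "... \<le> ?m * (?e Li * (Lj powr (- \<theta>) * Lh powr (- \<theta>)))"
        using modulation_dominance[OF \<kappa> \<theta>(2) dom] by (intro mult_left_mono) auto
      also have "... \<le> ?C * R * (Lj powr (- \<theta>) * Lh powr (- \<theta>))"
        unfolding mult.assoc[symmetric, of ?m] by (intro mult_right_mono bd) auto
      finally show ?thesis by (simp add: mult.assoc)
    qed
    consider "L2 \<le> L1" "L3 \<le> L1" | "L1 \<le> L2" "L3 \<le> L2" | "L1 \<le> L3" "L2 \<le> L3" by linarith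
    then show ?thesis
    proof cases
      case 1
      have "?m * ?D \<le> ?C * ?Q1" using 1 L that(1) by (intro main[of L1]) auto
      also have "... \<le> ?C * (?Q1 + ?Q2 + ?Q3)" using Q by (intro mult_left_mono) auto
      finally show ?thesis .
    next
      case 2
      have "?m * ?D \<le> ?C * ?Q2" using 2 L that(2) by (intro main[of L2]) auto
      also have "... \<le> ?C * (?Q1 + ?Q2 + ?Q3)" using Q by (intro mult_left_mono) auto
      finally show ?thesis .
    next
      case 3
      have "?m * ?D \<le> ?C * ?Q3" using 3 L that(3) by (intro main[of L3]) auto
      also have "... \<le> ?C * (?Q1 + ?Q2 + ?Q3)" using Q by (intro mult_left_mono) auto
      finally show ?thesis .
    qed
  qed
  have p: "0 \<le> 7/2 - 16 * \<kappa>" "1 \<le> 7/2 - 16 * \<kappa>" "7/2 - 16 * \<kappa> \<le> 4" using \<kappa> by auto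
  have pp: "2 * ?p = 7 - 32 * \<kappa>" by simp
  \<comment> \<open>\<open>x\<close> stands for whichever frequency is smallest. The factor
    \<open>2 ^ 16\<close> covers both uses: a low output loses \<open>2 ^ 8\<close>, a low input
    loses \<open>2 ^ 8\<close> twice.\<close>
  have resonant: "?m * ?e L \<le> ?C * freq_kernel x y z \<and>
      ?m * ?e L \<le> ?C * freq_kernel y x z \<and>
      ?m * ?e L \<le> ?C * freq_kernel z x y"
    if xyz: "x + y + z = 0" "\<bar>x\<bar> \<le> \<bar>y\<bar>" "\<bar>x\<bar> \<le> \<bar>z\<bar>" "8 < max \<bar>y\<bar> \<bar>z\<bar>"
      and perm: "\<bar>x * y * z\<bar> * (x\<^sup>2 + y\<^sup>2 + z\<^sup>2) \<le> 3 * L" "1 \<le> L"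
      and m: "?m \<le> 2 ^ 16 * (x\<^sup>2 * jbracket x powr (- ?p) * max \<bar>y\<bar> \<bar>z\<bar> powr ?q)"
    for x y z L
  proof -
    define A where "A = x\<^sup>2 * jbracket x powr (- ?p) * max \<bar>y\<bar> \<bar>z\<bar> powr ?q * ?e L"
    have mA: "?m * ?e L \<le> 2 ^ 16 * A"
      using mult_right_mono[OF m, of "?e L"] by (simp add: A_def mult.assoc)
    have step: "a \<le> ?C * R" if "a \<le> 2 ^ 16 * A" "A \<le> 192 * R" "0 \<le> R" for a R :: real
      using that by simp
    have "A \<le> 192 * freq_kernel x y z" "A \<le> 192 * freq_kernel y x z" "A \<le> 192 * freq_kernel z x y"
      unfolding A_def using resonant_weight_bound[OF \<kappa> xyz(1-3) refl xyz(4) perm] by auto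
    then show ?thesis using step[OF mA] freq_kernel_nonneg by blast
  qed
  consider (bounded) "\<bar>k1\<bar> \<le> 8" "\<bar>k2\<bar> \<le> 8" "\<bar>k3\<bar> \<le> 8"
    | (out_min) "\<bar>k3\<bar> \<le> \<bar>k1\<bar>" "\<bar>k3\<bar> \<le> \<bar>k2\<bar>" "8 < max \<bar>k1\<bar> \<bar>k2\<bar>"
    | (in_min) "\<bar>k1\<bar> \<le> \<bar>k2\<bar>" "\<bar>k1\<bar> \<le> \<bar>k3\<bar>" "8 < max \<bar>k2\<bar> \<bar>k3\<bar>"
  proof -
    have "8 < max \<bar>k1\<bar> \<bar>k2\<bar>" if "\<bar>k3\<bar> \<le> \<bar>k1\<bar>" "\<not> (\<bar>k1\<bar> \<le> 8 \<and> \<bar>k2\<bar> \<le> 8 \<and> \<bar>k3\<bar> \<le> 8)"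
      using that by (auto simp: less_max_iff_disj)
    moreover have "8 < max \<bar>k2\<bar> \<bar>k3\<bar>" if "\<not> (\<bar>k1\<bar> \<le> 8 \<and> \<bar>k2\<bar> \<le> 8 \<and> \<bar>k3\<bar> \<le> 8)"
      using that ordered by (auto simp: less_max_iff_disj)
    ultimately show thesis using ordered that by (metis linear order_trans)
  qed
  then show ?thesis
  proof cases
    case bounded
    have m: "?m * ?e L \<le> ?C * R" if "1 \<le> L" "1 \<le> R" for L R
    proof -
      have "?e L \<le> L powr 0" using that \<kappa> by (intro powr_mono) auto
      then have "?e L \<le> R" using that by simp
      then show ?thesis using derivative_weight_bounded[OF p(1,3) bounded] by (intro mult_mono) auto
    qed
    show ?thesis
      using bounded L by (intro by_dominance m freq_kernel_ge_1) auto
  next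
    case out_min
    let ?M = "max \<bar>k1\<bar> \<bar>k2\<bar>"
    have kM: "\<bar>k1\<bar> \<le> ?M" "\<bar>k2\<bar> \<le> ?M" "1 \<le> ?M" using out_min(3) by auto
    have "?m \<le> 2 ^ 8 * (k3\<^sup>2 * jbracket k3 powr (- ?p) * ?M powr ?q)"
      unfolding pp[symmetric] by (intro derivative_weight_output_min p kM)
    also have "... \<le> 2 ^ 16 * (k3\<^sup>2 * jbracket k3 powr (- ?p) * ?M powr ?q)"
      by (intro mult_right_mono) auto
    finally have m: "?m \<le> ..." .
    have r: "\<bar>k3 * k1 * k2\<bar> * (k3\<^sup>2 + k1\<^sup>2 + k2\<^sup>2) = \<bar>k1 * k2 * k3\<bar> * (k1\<^sup>2 + k2\<^sup>2 + k3\<^sup>2)"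
      by (simp add: ac_simps)
    have *: "?m * ?e L \<le> ?C * freq_kernel k3 k1 k2 \<and>
      ?m * ?e L \<le> ?C * freq_kernel k1 k3 k2 \<and>
      ?m * ?e L \<le> ?C * freq_kernel k2 k3 k1"
      if "L1 + L2 + L3 \<le> 3 * L" "1 \<le> L" for L
      using that sum res out_min by (intro resonant m) (auto simp: r)
    show ?thesis
      using *[of L1] *[of L2] *[of L3] L
      by (intro by_dominance) (auto simp: freq_kernel_commute[of k1 k3] freq_kernel_commute[of k2 k3])
  next
    case in_min
    let ?M = "max \<bar>k2\<bar> \<bar>k3\<bar>"
    have "\<bar>k2\<bar> \<le> 2 * \<bar>k3\<bar>" "\<bar>k3\<bar> \<le> 2 * \<bar>k2\<bar>"
      using in_min(1,2) sum by linarith+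
    then have half: "?M / 2 \<le> \<bar>k3\<bar>" "?M / 2 \<le> \<bar>k2\<bar>" by (simp_all add: max_def)
    have kM: "\<bar>k2\<bar> \<le> ?M" "\<bar>k3\<bar> \<le> ?M" "1 \<le> ?M" "\<bar>k1\<bar> \<le> ?M"
      using in_min by (auto simp: le_max_iff_disj)
    have m0: "?m \<le> 2 ^ 8 * (?M\<^sup>2 * jbracket k1 powr ?p)"
      by (intro derivative_weight_input_min p kM half)
    show ?thesis
    proof (cases "1 \<le> \<bar>k1\<bar>")
      case True
      have "?M\<^sup>2 * jbracket k1 powr ?p
         \<le> 2 ^ 8 * (k1\<^sup>2 * jbracket k1 powr (- ?p) * ?M powr (2 * ?p))"
        by (intro input_min_le_output_min p kM True)
      from scaled_le_trans[OF m0 this]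
      have m: "?m \<le> 2 ^ 16 * (k1\<^sup>2 * jbracket k1 powr (- ?p) * ?M powr ?q)"
        unfolding pp by simp
      have *: "?m * ?e L \<le> ?C * freq_kernel k1 k2 k3 \<and>
        ?m * ?e L \<le> ?C * freq_kernel k2 k1 k3 \<and>
        ?m * ?e L \<le> ?C * freq_kernel k3 k1 k2"
        if "L1 + L2 + L3 \<le> 3 * L" "1 \<le> L" for L
        using that sum res in_min by (intro resonant m) auto
      show ?thesis
        using *[of L1] *[of L2] *[of L3] L by (intro by_dominance) auto
    next
      case False
      have "jbracket k1 powr ?p \<le> (2 * 1) powr ?p"
        using False p by (intro jbracket_powr_upper) auto
      also have "... \<le> (2 * 1) powr 4" using p by (intro powr_mono) auto
      finally have "?M\<^sup>2 * jbracket k1 powr ?p \<le> ?M\<^sup>2 * 16"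
        by (intro mult_left_mono) auto
      then have "?M\<^sup>2 * jbracket k1 powr ?p \<le> 16 * ?M\<^sup>2" by (simp add: mult.commute)
      from scaled_le_trans[OF m0 this] have m: "?m \<le> 2 ^ 12 * ?M\<^sup>2" by simp
      \<comment> \<open>For \<open>M > 8\<close> the fourth power of \<open>M / 2\<close> is at
        least \<open>4 * M^2\<close>, while \<open>k1 ^ 4\<close> is at most 1. The loss
        \<open>M^2\<close> is therefore absorbed by the derivative of the resonance function
        itself.\<close>
      have big: "?M\<^sup>2 \<le> \<bar>k1 ^ 4 - k ^ 4\<bar>" if k: "?M / 2 \<le> \<bar>k\<bar>" for k
      proof -
        have "(?M / 2) ^ 4 \<le> \<bar>k\<bar> ^ 4" using k by (intro power_mono) auto
        then have k4: "?M ^ 4 / 16 \<le> k ^ 4" by (simp add: power_divide)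
        have "\<bar>k1\<bar> ^ 4 \<le> 1" using False by (intro power_le_one) auto
        then have k14: "k1 ^ 4 \<le> 1" by simp
        have M64: "64 \<le> ?M\<^sup>2" using power_mono[of 8 ?M 2] in_min(3) by simp
        have "64 * ?M\<^sup>2 \<le> ?M\<^sup>2 * ?M\<^sup>2" using M64 by (intro mult_right_mono) auto
        then have "64 * ?M\<^sup>2 \<le> ?M ^ 4" by (simp flip: power_add)
        then show ?thesis using k4 k14 M64 by linarith
      qed
      \<comment> \<open>The smaller of two modulations takes over both factors: twice
        \<open>1 - 2 * \<kappa>\<close> exceeds \<open>1 + \<kappa>\<close>.\<close>
      have decay: "?b L * ?b L' \<le> L powr (- \<theta>)"
        if "1 \<le> L" "L \<le> L'" for L L'
      proof -
        have "?b L' \<le> ?b L"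
          using that \<kappa> by (intro powr_mono2') auto
        then have "?b L * ?b L'
            \<le> ?b L * ?b L"
          by (intro mult_left_mono) auto
        also have "... = L powr (- (2 - 4 * \<kappa>))" unfolding powr_add[symmetric] by simp
        also have "... \<le> L powr (- \<theta>)" using that \<kappa> \<theta> by (intro powr_mono) auto
        finally show ?thesis .
      qed
      have l1: "?l k1 L1 = L1 powr (- \<theta>)" using False by (simp add: input_decay_def)
      have conclude: "?m * ?D \<le> ?C * (R * (L1 powr (- \<theta>) * L powr (- \<theta>)))"
        if R: "?M\<^sup>2 \<le> R" and D': "?l k2 L2 * ?b L3 \<le> L powr (- \<theta>)" for R L
      proof -
        have R0: "0 \<le> R" using order_trans[OF zero_le_power2 R] .
        have DL: "?D \<le> L1 powr (- \<theta>) * L powr (- \<theta>)"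
          unfolding l1 mult.assoc by (intro mult_left_mono D') auto
        have mR: "?m \<le> 2 ^ 12 * R" using m R by simp
        have "?m * ?D \<le> (2 ^ 12 * R) * (L1 powr (- \<theta>) * L powr (- \<theta>))"
          by (rule mult_mono[OF mR DL]) (use R0 l_le(2) L in auto)
        also have "... = 2 ^ 12 * (R * (L1 powr (- \<theta>) * L powr (- \<theta>)))"
          by (rule mult.assoc)
        also have "... \<le> ?C * (R * (L1 powr (- \<theta>) * L powr (- \<theta>)))"
          by (rule mult_right_mono) (use R0 in auto)
        finally show ?thesis .
      qed
      show ?thesis
      proof (cases "L2 \<le> L3")
        case True
        have "?l k2 L2 * ?b L3 \<le> ?b L2 * ?b L3" using l_le L by (intro mult_right_mono) auto
        also have "... \<le> L2 powr (- \<theta>)" by (intro decay L True)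
        finally have "?m * ?D \<le> ?C * ?Q3"
          using big[OF half(2)] freq_kernel_ge_diff[of k1 k2 k3] by (intro conclude) auto
        also have "... \<le> ?C * (?Q1 + ?Q2 + ?Q3)" using Q by (intro mult_left_mono) auto
        finally show ?thesis .
      next
        case False
        have "?l k2 L2 * ?b L3 \<le> ?b L2 * ?b L3" using l_le L by (intro mult_right_mono) auto
        also have "... = ?b L3 * ?b L2" by (rule mult.commute)
        also have "... \<le> L3 powr (- \<theta>)" using False L by (intro decay) auto
        finally have "?m * ?D \<le> ?C * ?Q2"
          using big[OF half(1)] freq_kernel_ge_diff[of k1 k3 k2] by (intro conclude) auto
        also have "... \<le> ?C * (?Q1 + ?Q2 + ?Q3)" using Q by (intro mult_left_mono) auto
        finally show ?thesis .
      qed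
    qed
  qed
qed

theorem multiplier_bound:
  fixes k1 k2 k3 L1 L2 L3 \<kappa> \<theta> :: real
  assumes \<kappa>: "0 < \<kappa>" "\<kappa> \<le> 1/100" and \<theta>: "1 \<le> \<theta>" "\<theta> \<le> 1 + \<kappa>"
    and sum: "k1 + k2 + k3 = 0" and L: "1 \<le> L1" "1 \<le> L2" "1 \<le> L3"
    and res: "\<bar>k1 * k2 * k3\<bar> * (k1\<^sup>2 + k2\<^sup>2 + k3\<^sup>2) \<le> L1 + L2 + L3"
  shows "derivative_weight (7/2 - 16 * \<kappa>) k1 k2 k3 *
      (input_decay \<theta> (1/2 - \<kappa>) k1 L1 * input_decay \<theta> (1/2 - \<kappa>) k2 L2 * L3 powr (- (1 - 2 * \<kappa>)))
    \<le> 64 * 16 ^ 8 * (freq_kernel k1 k2 k3 * (L2 powr (- \<theta>) * L3 powr (- \<theta>))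
        + freq_kernel k2 k1 k3 * (L1 powr (- \<theta>) * L3 powr (- \<theta>))
        + freq_kernel k3 k1 k2 * (L1 powr (- \<theta>) * L2 powr (- \<theta>)))"
proof (cases "\<bar>k1\<bar> \<le> \<bar>k2\<bar>")
  case True
  with assms show ?thesis by (intro multiplier_bound_ordered)
next
  case False
  have "k2 + k1 + k3 = 0" "\<bar>k2 * k1 * k3\<bar> * (k2\<^sup>2 + k1\<^sup>2 + k3\<^sup>2) \<le> L2 + L1 + L3"
    using sum res by (simp_all add: ac_simps)
  from multiplier_bound_ordered[OF \<kappa> \<theta> this(1) L(2,1,3) this(2)] False show ?thesis
    by (simp add: derivative_weight_commute[of _ k2 k1] freq_kernel_commute[of k3 k2 k1] ac_simps)
qed

section \<open>Schwartz functions\<close>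

definition rapidly_decreasing :: "(real \<times> real \<Rightarrow> complex) \<Rightarrow> bool" where
  "rapidly_decreasing f \<longleftrightarrow> (\<forall>k. \<exists>C. \<forall>z. norm z ^ k * norm (f z) \<le> C)"

text \<open>The condition that \<open>schwartz\<close> imposes on each single iterated
  derivative.\<close>

definition tame :: "(real \<times> real \<Rightarrow> complex) \<Rightarrow> bool" where
  "tame f \<longleftrightarrow> (\<forall>z. f differentiable (at z)) \<and> rapidly_decreasing f"

definition tame_t :: "(real \<times> real \<Rightarrow> complex) \<Rightarrow> bool" where
  "tame_t f \<longleftrightarrow> (\<forall>i. tame ((partial_t ^^ i) f))"

lemma schwartz_iff_tame: "schwartz f \<longleftrightarrow> (\<forall>i j. tame ((partial_t ^^ i) ((partial_x ^^ j) f)))"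
  by (simp add: schwartz_def tame_def rapidly_decreasing_def)

lemma schwartz_imp_tame_t: "schwartz f \<Longrightarrow> tame_t f"
  unfolding schwartz_iff_tame tame_t_def by (metis funpow_0)

lemma tame_t_imp_tame: "tame_t f \<Longrightarrow> tame f"
  unfolding tame_t_def by (metis funpow_0)

lemma schwartz_imp_tame: "schwartz f \<Longrightarrow> tame f"
  by (intro tame_t_imp_tame schwartz_imp_tame_t)

lemma tame_t_partial_t: "tame_t f \<Longrightarrow> tame_t (partial_t f)"
  unfolding tame_t_def by (metis comp_apply funpow_Suc_right)

lemma schwartz_partial_x: "schwartz f \<Longrightarrow> schwartz (partial_x f)"
  unfolding schwartz_iff_tame by (metis comp_apply funpow_Suc_right)

lemma schwartz_funpow_partial_x: "schwartz f \<Longrightarrow> schwartz ((partial_x ^^ j) f)"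
  by (induction j) (auto intro: schwartz_partial_x)

text \<open>In \<open>schwartz\<close> the space derivatives are innermost. So \<open>Q\<close>
  follows the space derivatives, \<open>R\<close> takes over for the time derivatives, and mixed
  derivatives never have to be interchanged.\<close>

lemma schwartz_coinduct:
  assumes "Q f"
    and "\<And>f. Q f \<Longrightarrow> R f" "\<And>f. Q f \<Longrightarrow> Q (partial_x f)"
    and "\<And>f. R f \<Longrightarrow> R (partial_t f)" "\<And>f. R f \<Longrightarrow> tame f"
  shows "schwartz f"
proof -
  have "Q ((partial_x ^^ j) f)" for j by (induction j) (auto intro: assms)
  then have "R ((partial_t ^^ i) ((partial_x ^^ j) f))" for i j
    by (induction i) (auto intro: assms)
  then show ?thesis unfolding schwartz_iff_tame using assms(5) by blast
qed

lemma has_vector_derivative_partial_t: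
  assumes "f differentiable (at (t, x))"
  shows "((\<lambda>r. f (r, x)) has_vector_derivative partial_t f (t, x)) (at t)"
proof -
  have "(\<lambda>r. (r, x)) differentiable (at t)"
    by (intro differentiable_Pair differentiable_ident differentiable_const)
  then have "(f \<circ> (\<lambda>r. (r, x))) differentiable (at t)"
    using assms by (intro differentiable_chain_at) auto
  then show ?thesis
    by (simp add: vector_derivative_works partial_t_def comp_def)
qed

lemma has_vector_derivative_partial_x:
  assumes "f differentiable (at (t, x))"
  shows "((\<lambda>r. f (t, r)) has_vector_derivative partial_x f (t, x)) (at x)"
proof -
  have "(\<lambda>r. (t, r)) differentiable (at x)"
    by (intro differentiable_Pair differentiable_ident differentiable_const)
  then have "(f \<circ> (\<lambda>r. (t, r))) differentiable (at x)"
    using assms by (intro differentiable_chain_at) auto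
  then show ?thesis
    by (simp add: vector_derivative_works partial_x_def comp_def)
qed

lemma partial_t_eqI:
  assumes "\<And>t x. ((\<lambda>r. f (r, x)) has_vector_derivative g (t, x)) (at t)"
  shows "partial_t f = g"
  using vector_derivative_at[OF assms] by (auto simp: partial_t_def)

lemma partial_x_eqI:
  assumes "\<And>t x. ((\<lambda>r. f (t, r)) has_vector_derivative g (t, x)) (at x)"
  shows "partial_x f = g"
  using vector_derivative_at[OF assms] by (auto simp: partial_x_def)

lemma tame_differentiable: "tame f \<Longrightarrow> f differentiable (at z)"
  unfolding tame_def by blast

lemma partial_add:
  assumes "tame f" "tame g"
  shows "partial_t (\<lambda>z. f z + g z) = (\<lambda>z. partial_t f z + partial_t g z)"
    and "partial_x (\<lambda>z. f z + g z) = (\<lambda>z. partial_x f z + partial_x g z)"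
  using assms
  by (auto intro!: partial_t_eqI partial_x_eqI derivative_eq_intros has_vector_derivative_partial_t
      has_vector_derivative_partial_x tame_differentiable)

lemma partial_diff:
  assumes "tame f" "tame g"
  shows "partial_t (\<lambda>z. f z - g z) = (\<lambda>z. partial_t f z - partial_t g z)"
    and "partial_x (\<lambda>z. f z - g z) = (\<lambda>z. partial_x f z - partial_x g z)"
  using assms
  by (auto intro!: partial_t_eqI partial_x_eqI derivative_eq_intros has_vector_derivative_partial_t
      has_vector_derivative_partial_x tame_differentiable)

lemma partial_mult:
  assumes "tame f" "tame g"
  shows "partial_t (\<lambda>z. f z * g z) = (\<lambda>z. f z * partial_t g z + partial_t f z * g z)"
    and "partial_x (\<lambda>z. f z * g z) = (\<lambda>z. f z * partial_x g z + partial_x f z * g z)"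
  using assms
  by (auto intro!: partial_t_eqI partial_x_eqI has_vector_derivative_mult has_vector_derivative_partial_t
      has_vector_derivative_partial_x tame_differentiable)

lemma tame_add: "tame (\<lambda>z. f z + g z)" if "tame f" "tame g"
proof -
  have "\<exists>C. \<forall>z. norm z ^ k * norm (f z + g z) \<le> C" for k
  proof -
    obtain C D where C: "\<And>z. norm z ^ k * norm (f z) \<le> C" and D: "\<And>z. norm z ^ k * norm (g z) \<le> D"
      using \<open>tame f\<close> \<open>tame g\<close> unfolding tame_def rapidly_decreasing_def by meson
    have "norm z ^ k * norm (f z + g z) \<le> C + D" for z
    proof -
      have "norm z ^ k * norm (f z + g z) \<le> norm z ^ k * (norm (f z) + norm (g z))"
        by (intro mult_left_mono norm_triangle_ineq) auto
      then show ?thesis using C[of z] D[of z] by (simp add: distrib_left)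
    qed
    then show ?thesis by blast
  qed
  then show ?thesis using that by (auto simp: tame_def rapidly_decreasing_def)
qed

lemma tame_mult: "tame (\<lambda>z. f z * g z)" if "tame f" "tame g"
proof -
  have "\<exists>C. \<forall>z. norm z ^ k * norm (f z * g z) \<le> C" for k
  proof -
    obtain C D where C: "\<And>z. norm z ^ k * norm (f z) \<le> C" and D: "\<And>z. norm z ^ 0 * norm (g z) \<le> D"
      using \<open>tame f\<close> \<open>tame g\<close> unfolding tame_def rapidly_decreasing_def by meson
    have "norm z ^ k * norm (f z * g z) \<le> C * D" for z
      using mult_mono[OF C[of z] D[of z]] order_trans[OF _ C[of z]] by (simp add: norm_mult mult.assoc)
    then show ?thesis by blast
  qed
  then show ?thesis using that by (auto simp: tame_def rapidly_decreasing_def)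
qed

lemma tame_minus: "tame (\<lambda>z. - f z)" if "tame f"
  using that by (auto simp: tame_def rapidly_decreasing_def)

lemma tame_diff: "tame (\<lambda>z. f z - g z)" if "tame f" "tame g"
  using tame_add[OF that(1) tame_minus[OF that(2)]] by simp

lemma schwartz_diff:
  assumes "schwartz f" "schwartz g"
  shows "schwartz (\<lambda>z. f z - g z)"
proof (rule schwartz_coinduct)
  let ?Q = "\<lambda>P h. \<exists>F G. P F \<and> P G \<and> h = (\<lambda>z. F z - G z :: complex)"
  show "?Q schwartz (\<lambda>z. f z - g z)" using assms by auto
  show "?Q tame_t h" if "?Q schwartz h" for h using that schwartz_imp_tame_t by blast
  show "tame h" if "?Q tame_t h" for h using that tame_t_imp_tame tame_diff by blast
  show "?Q tame_t (partial_t h)" if h: "?Q tame_t h" for h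
  proof -
    obtain F G where FG: "tame_t F" "tame_t G" "h = (\<lambda>z. F z - G z)" using h by auto
    have "partial_t h = (\<lambda>z. partial_t F z - partial_t G z)"
      unfolding FG(3) using FG by (intro partial_diff tame_t_imp_tame)
    then show ?thesis using tame_t_partial_t[OF FG(1)] tame_t_partial_t[OF FG(2)] by auto
  qed
  show "?Q schwartz (partial_x h)" if h: "?Q schwartz h" for h
  proof -
    obtain F G where FG: "schwartz F" "schwartz G" "h = (\<lambda>z. F z - G z)" using h by auto
    have "partial_x h = (\<lambda>z. partial_x F z - partial_x G z)"
      unfolding FG(3) using FG by (intro partial_diff schwartz_imp_tame)
    then show ?thesis using schwartz_partial_x[OF FG(1)] schwartz_partial_x[OF FG(2)] by auto
  qed
qed

text \<open>The product rule leads from products to sums of products, and these are closed under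
  both derivatives. This is the invariant for \<open>schwartz_mult\<close>.\<close>

inductive sum_of_products ::
  "((real \<times> real \<Rightarrow> complex) \<Rightarrow> bool) \<Rightarrow> (real \<times> real \<Rightarrow> complex) \<Rightarrow> bool" for P where
  product: "P f \<Longrightarrow> P g \<Longrightarrow> sum_of_products P (\<lambda>z. f z * g z)"
| sum: "sum_of_products P f \<Longrightarrow> sum_of_products P g \<Longrightarrow> sum_of_products P (\<lambda>z. f z + g z)"

lemma sum_of_products_mono:
  assumes "sum_of_products P f" "\<And>f. P f \<Longrightarrow> R f"
  shows "sum_of_products R f"
  using assms(1) by induction (auto intro: sum_of_products.intros assms(2))

lemma tame_sum_of_products:
  assumes "sum_of_products P f" "\<And>f. P f \<Longrightarrow> tame f"
  shows "tame f"
  using assms(1) by induction (auto intro: tame_add tame_mult assms(2))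

lemma schwartz_mult:
  assumes "schwartz f" "schwartz g"
  shows "schwartz (\<lambda>z. f z * g z)"
proof (rule schwartz_coinduct)
  show "sum_of_products schwartz (\<lambda>z. f z * g z)" using assms by (rule product)
  show "sum_of_products tame_t h" if "sum_of_products schwartz h" for h
    using that schwartz_imp_tame_t by (rule sum_of_products_mono)
  show "tame h" if "sum_of_products tame_t h" for h
    using that tame_t_imp_tame by (rule tame_sum_of_products)
  show "sum_of_products tame_t (partial_t h)" if "sum_of_products tame_t h" for h
    using that
  proof induction
    case (product f g)
    then show ?case
      using partial_mult(1)[of f g] tame_t_imp_tame tame_t_partial_t
      by (auto intro!: sum_of_products.intros)
  next
    case (sum f g)
    then show ?case
      using partial_add(1)[of f g] tame_sum_of_products[OF _ tame_t_imp_tame]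
      by (auto intro!: sum_of_products.sum)
  qed
  show "sum_of_products schwartz (partial_x h)" if "sum_of_products schwartz h" for h
    using that
  proof induction
    case (product f g)
    then show ?case
      using partial_mult(2)[of f g] schwartz_imp_tame schwartz_partial_x
      by (auto intro!: sum_of_products.intros)
  next
    case (sum f g)
    then show ?case
      using partial_add(2)[of f g] tame_sum_of_products[OF _ schwartz_imp_tame]
      by (auto intro!: sum_of_products.sum)
  qed
qed

section \<open>Integrable majorants\<close>

definition cauchy_weight :: "real \<Rightarrow> real" where
  "cauchy_weight y = 1 / (1 + y\<^sup>2)"

lemma one_plus_square_pos [simp]: "0 < 1 + (y::real)\<^sup>2"
  by (simp add: add_pos_nonneg)

lemma cauchy_weight_pos [simp]: "0 < cauchy_weight y"
  by (simp add: cauchy_weight_def)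

lemma cauchy_weight_measurable [measurable]: "cauchy_weight \<in> borel_measurable borel"
  unfolding cauchy_weight_def[abs_def] by measurable

lemma jbracket_square: "(jbracket y)\<^sup>2 = 1 + y\<^sup>2"
  by (simp add: jbracket_def)

lemma cauchy_weight_nn_integral:
  "(\<integral>\<^sup>+y. ennreal (cauchy_weight y) \<partial>lborel) < \<infinity>"
proof -
  have "jbracket y powr (- 2) = cauchy_weight y" for y
  proof -
    have "jbracket y powr 2 = 1 + y\<^sup>2"
      using jbracket_pos[of y] powr_realpow[of "jbracket y" 2] by (simp add: jbracket_square)
    then show ?thesis by (simp add: powr_minus_divide cauchy_weight_def)
  qed
  then show ?thesis using jbracket_powr_nn_integral_finite[of 2] by simp
qed

lemma integrable_cauchy_weight: "integrable lborel cauchy_weight"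
  using cauchy_weight_nn_integral by (intro integrableI_bounded) (auto simp: less_imp_le)

lemma integrable_cauchy_weight2: "integrable lborel (\<lambda>z. cauchy_weight (fst z) * cauchy_weight (snd z))"
proof (rule integrableI_bounded)
  show [measurable]: "(\<lambda>z. cauchy_weight (fst z) * cauchy_weight (snd z)) \<in> borel_measurable lborel"
    unfolding lborel_prod[symmetric] by measurable
  have "(\<integral>\<^sup>+z. ennreal (norm (cauchy_weight (fst z) * cauchy_weight (snd z))) \<partial>lborel)
    = (\<integral>\<^sup>+x. \<integral>\<^sup>+t. ennreal (cauchy_weight x) * ennreal (cauchy_weight t) \<partial>lborel \<partial>lborel)"
    by (subst nn_integral_lborel_time_first, measurable)
       (simp add: abs_mult ennreal_mult mult.commute less_imp_le)
  also have "... = (\<integral>\<^sup>+x. ennreal (cauchy_weight x) \<partial>lborel) * (\<integral>\<^sup>+t. ennreal (cauchy_weight t) \<partial>lborel)"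
    by (simp add: nn_integral_cmult nn_integral_multc)
  also have "... < \<infinity>" using cauchy_weight_nn_integral by (simp add: ennreal_mult_less_top)
  finally show "(\<integral>\<^sup>+z. ennreal (norm (cauchy_weight (fst z) * cauchy_weight (snd z))) \<partial>lborel) < \<infinity>" .
qed

lemma tame_continuous: "tame f \<Longrightarrow> continuous_on UNIV f"
  unfolding tame_def
  by (auto intro!: differentiable_imp_continuous_on simp: differentiable_on_def)

lemma tame_measurable [measurable_dest]: "tame f \<Longrightarrow> f \<in> borel_measurable borel"
  by (intro borel_measurable_continuous_onI tame_continuous)

text \<open>The product \<open>(1 + t^2) * (1 + x^2)\<close> is at most the square of
  \<open>1 + n^2\<close> with \<open>n\<close> the norm of the point, so the moments of order 0, 2
  and 4 suffice.\<close>

lemma tame_decay: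
  assumes "tame f"
  obtains C where "0 \<le> C" "\<And>t x. norm (f (t, x)) \<le> C * (cauchy_weight t * cauchy_weight x)"
proof -
  obtain C0 C2 C4 where C: "\<And>z. norm z ^ 0 * norm (f z) \<le> C0" "\<And>z. norm z ^ 2 * norm (f z) \<le> C2"
     "\<And>z. norm z ^ 4 * norm (f z) \<le> C4"
    using assms unfolding tame_def rapidly_decreasing_def by meson
  have "norm (f (t, x)) \<le> (C0 + 2 * C2 + C4) * (cauchy_weight t * cauchy_weight x)" for t x
  proof -
    let ?n = "norm (t, x)"
    have n2: "?n ^ 2 = t\<^sup>2 + x\<^sup>2" by (simp add: norm_Pair)
    have "(1 + t\<^sup>2) * (1 + x\<^sup>2) \<le> (1 + ?n ^ 2)\<^sup>2"
    proof -
      have "(1 + (t\<^sup>2 + x\<^sup>2))\<^sup>2 - (1 + t\<^sup>2) * (1 + x\<^sup>2) = t\<^sup>2 + x\<^sup>2 + (t\<^sup>2 * t\<^sup>2 + t\<^sup>2 * x\<^sup>2 + x\<^sup>2 * x\<^sup>2)"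
        by (simp add: power2_eq_square algebra_simps)
      moreover have "0 \<le> ..." by (intro add_nonneg_nonneg mult_nonneg_nonneg) auto
      ultimately show ?thesis unfolding n2 by linarith
    qed
    also have "... = ?n ^ 0 + 2 * ?n ^ 2 + ?n ^ 4"
      by (simp add: power2_eq_square power4_eq_xxxx algebra_simps)
    finally have "(1 + t\<^sup>2) * (1 + x\<^sup>2) * norm (f (t, x)) \<le> (?n ^ 0 + 2 * ?n ^ 2 + ?n ^ 4) * norm (f (t, x))"
      by (intro mult_right_mono) auto
    also have "... \<le> C0 + 2 * C2 + C4"
      using C[of "(t, x)"] by (simp add: distrib_right)
    finally have "(1 + t\<^sup>2) * (1 + x\<^sup>2) * norm (f (t, x)) \<le> C0 + 2 * C2 + C4" .
    moreover have "0 < (1 + t\<^sup>2) * (1 + x\<^sup>2)" by (intro mult_pos_pos) simp_all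
    ultimately have "norm (f (t, x)) \<le> (C0 + 2 * C2 + C4) / ((1 + t\<^sup>2) * (1 + x\<^sup>2))"
      by (simp add: pos_le_divide_eq mult.commute)
    then show ?thesis by (simp add: cauchy_weight_def)
  qed
  moreover have "0 \<le> C0 + 2 * C2 + C4"
    using order_trans[OF _ C(1)[of 0]] order_trans[OF _ C(2)[of 0]] order_trans[OF _ C(3)[of 0]] by simp
  ultimately show ?thesis by (rule that[rotated])
qed

lemma integrable_tame:
  assumes "tame f"
  shows "integrable lborel f"
proof -
  obtain C where C: "0 \<le> C" "\<And>t x. norm (f (t, x)) \<le> C * (cauchy_weight t * cauchy_weight x)"
    using tame_decay[OF assms] by blast
  show ?thesis
    by (rule Bochner_Integration.integrable_bound[OF integrable_mult_right[OF integrable_cauchy_weight2, of C]])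
       (use C tame_measurable[OF assms] in \<open>auto simp: abs_mult less_imp_le\<close>)
qed

section \<open>The Fourier transform\<close>

text \<open>The fundamental theorem of calculus on the whole line; the decay of \<open>h\<close>
  removes both boundary terms. This is the integration by parts behind
  \<open>fourier_partial_x\<close>.\<close>

lemma deriv_decay_integral_zero:
  fixes h h' :: "real \<Rightarrow> complex"
  assumes deriv: "\<And>r. (h has_vector_derivative h' r) (at r)"
    and cont: "continuous_on UNIV h'"
    and h: "\<And>r. norm (h r) \<le> C * cauchy_weight r"
    and h': "\<And>r. norm (h' r) \<le> C * cauchy_weight r"
  shows "(\<integral>r. h' r \<partial>lborel) = 0"
proof -
  have int: "integrable lborel h'"
    by (rule Bochner_Integration.integrable_bound[OF integrable_mult_right[OF integrable_cauchy_weight, of C]])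
       (use h' borel_measurable_continuous_onI[OF cont] in \<open>auto intro: order_trans[OF _ abs_ge_self]\<close>)
  have w_lim: "(cauchy_weight \<longlongrightarrow> 0) at_top" "(cauchy_weight \<longlongrightarrow> 0) at_bot"
    unfolding cauchy_weight_def[abs_def] by real_asymp+
  have lim: "(h \<longlongrightarrow> 0) F" if "(cauchy_weight \<longlongrightarrow> 0) F" for F
    by (rule Lim_null_comparison[OF always_eventually[OF allI[OF h]]])
       (use tendsto_mult_right_zero[OF that, of C] in simp)
  have "(LBINT r=-\<infinity>..\<infinity>. h' r) = 0 - 0"
  proof (rule interval_integral_FTC_integrable)
    show "((h \<circ> real_of_ereal) \<longlongrightarrow> 0) (at_right (- \<infinity>))"
      unfolding ereal_tendsto_simps using lim[OF w_lim(2)] .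
    show "((h \<circ> real_of_ereal) \<longlongrightarrow> 0) (at_left \<infinity>)"
      unfolding ereal_tendsto_simps using lim[OF w_lim(1)] .
  qed (use deriv cont int in \<open>auto simp: continuous_on_eq_continuous_at set_integrable_def\<close>)
  then show ?thesis
    by (simp add: interval_lebesgue_integral_def set_lebesgue_integral_def)
qed

definition char2 :: "real \<times> real \<Rightarrow> real \<times> real \<Rightarrow> complex" where
  "char2 z \<zeta> = exp (- \<i> * of_real (snd z * snd \<zeta>)) * exp (- \<i> * of_real (fst z * fst \<zeta>))"

lemma norm_char2 [simp]: "norm (char2 z \<zeta>) = 1"
  by (simp add: char2_def norm_mult)

lemma fourier_char2: "fourier f \<zeta> = (\<integral>z. char2 z \<zeta> * f z \<partial>lborel)"
  by (cases \<zeta>) (simp add: fourier_def char2_def case_prod_unfold)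

lemma fst_borel_measurable [measurable]: "(fst :: real \<times> real \<Rightarrow> real) \<in> borel_measurable borel"
  and snd_borel_measurable [measurable]: "(snd :: real \<times> real \<Rightarrow> real) \<in> borel_measurable borel"
  unfolding borel_prod[symmetric] by measurable

lemma char2_measurable [measurable]:
  assumes [measurable]: "f \<in> measurable M borel" "g \<in> measurable M borel"
  shows "(\<lambda>x. char2 (f x) (g x)) \<in> borel_measurable M"
  unfolding char2_def by measurable

lemma char2_add_left: "char2 (z + z') \<zeta> = char2 z \<zeta> * char2 z' \<zeta>"
  by (simp add: char2_def algebra_simps flip: exp_add)

lemma char2_commute: "char2 z \<zeta> = char2 \<zeta> z"
  by (simp add: char2_def mult.commute)

lemma char2_add_right: "char2 z (\<zeta> + \<zeta>') = char2 z \<zeta> * char2 z \<zeta>'"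
  by (simp add: char2_commute[of z] char2_add_left)

lemma char2_minus: "char2 (- z) \<zeta> = char2 z (- \<zeta>)"
  by (simp add: char2_def)

lemma integrable_char2_mult:
  assumes "integrable lborel f"
  shows "integrable lborel (\<lambda>z. char2 z \<zeta> * f z)"
  by (rule Bochner_Integration.integrable_bound[OF assms])
     (use borel_measurable_integrable[OF assms] in \<open>auto simp: norm_mult\<close>)

lemma fourier_diff:
  assumes "integrable lborel f" "integrable lborel g"
  shows "fourier (\<lambda>z. f z - g z) \<zeta> = fourier f \<zeta> - fourier g \<zeta>"
  unfolding fourier_char2 right_diff_distrib
  by (intro Bochner_Integration.integral_diff integrable_char2_mult assms)

lemma fourier_measurable [measurable]:
  assumes [measurable]: "f \<in> borel_measurable borel"
  shows "fourier f \<in> borel_measurable borel"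
proof -
  have "(\<lambda>\<zeta>. \<integral>z. char2 z \<zeta> * f z \<partial>lborel) \<in> borel_measurable borel" by measurable
  also have "(\<lambda>\<zeta>. \<integral>z. char2 z \<zeta> * f z \<partial>lborel) = fourier f"
    by (rule ext) (rule fourier_char2[symmetric])
  finally show ?thesis .
qed

lemma norm_fourier_le:
  assumes "tame f"
  shows "norm (fourier f \<zeta>) \<le> (\<integral>z. norm (f z) \<partial>lborel)"
proof -
  have "norm (fourier f \<zeta>) \<le> (\<integral>z. norm (char2 z \<zeta> * f z) \<partial>lborel)"
    unfolding fourier_char2 by (rule integral_norm_bound)
  then show ?thesis by (simp add: norm_mult)
qed

text \<open>The auxiliary \<open>d\<close> is the space derivative of the character times
  \<open>f\<close>, so its integral over every line of fixed time vanishes. By Fubini its integral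
  over the plane vanishes too, which is the claim.\<close>

lemma fourier_partial_x:
  assumes f: "tame f" and fx: "tame (partial_x f)"
  shows "fourier (partial_x f) \<zeta> = \<i> * of_real (snd \<zeta>) * fourier f \<zeta>"
proof -
  obtain \<tau> \<xi> where \<zeta>: "\<zeta> = (\<tau>, \<xi>)" by force
  define d where "d z = char2 z \<zeta> * (partial_x f z - \<i> * of_real \<xi> * f z)" for z
  note [measurable] = tame_measurable[OF f] tame_measurable[OF fx]
  have cf: "continuous_on UNIV f" "continuous_on UNIV (partial_x f)"
    using f fx tame_continuous by blast+
  have int_d: "integrable lborel d"
    unfolding d_def
    by (intro integrable_char2_mult Bochner_Integration.integrable_diff integrable_mult_right
        integrable_tame f fx)
  obtain A B where A: "0 \<le> A" "\<And>t x. norm (f (t, x)) \<le> A * (cauchy_weight t * cauchy_weight x)"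
    and B: "0 \<le> B" "\<And>t x. norm (partial_x f (t, x)) \<le> B * (cauchy_weight t * cauchy_weight x)"
    using tame_decay[OF f] tame_decay[OF fx] by metis
  have zero: "(\<integral>x. d (t, x) \<partial>lborel) = 0" for t
  proof (rule deriv_decay_integral_zero)
    let ?e = "\<lambda>x. exp (- \<i> * of_real (x * \<xi>)) * exp (- \<i> * of_real (t * \<tau>))"
    let ?C = "(A + (B + \<bar>\<xi>\<bar> * A)) * cauchy_weight t"
    show "((\<lambda>x. char2 (t, x) \<zeta> * f (t, x)) has_vector_derivative d (t, x)) (at x)" for x
    proof -
      have e: "((\<lambda>x. ?e x) has_vector_derivative (- \<i> * of_real \<xi>) * ?e x) (at x)"
      proof -
        have "((\<lambda>y. exp (- \<i> * (y * of_real \<xi>)) * exp (- \<i> * of_real (t * \<tau>))) has_field_derivative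
          (- \<i> * of_real \<xi>) * (exp (- \<i> * (of_real x * of_real \<xi>)) * exp (- \<i> * of_real (t * \<tau>)))) (at (of_real x))"
          by (auto intro!: derivative_eq_intros)
        from has_field_derivative_at_within[OF this] has_vector_derivative_real_field[OF this]
        show ?thesis by simp
      qed
      have fd: "((\<lambda>r. f (t, r)) has_vector_derivative partial_x f (t, x)) (at x)"
        by (intro has_vector_derivative_partial_x tame_differentiable f)
      have "((\<lambda>x. ?e x * f (t, x)) has_vector_derivative
          ?e x * partial_x f (t, x) + (- \<i> * of_real \<xi>) * ?e x * f (t, x)) (at x)"
        by (rule has_vector_derivative_mult[OF e fd])
      then show ?thesis
        by (simp add: d_def char2_def \<zeta> algebra_simps)
    qed
    show "continuous_on UNIV (\<lambda>x. d (t, x))"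
      unfolding d_def char2_def \<zeta>
      by (auto intro!: continuous_intros continuous_on_compose2[OF cf(1)] continuous_on_compose2[OF cf(2)])
    fix x
    have w: "0 \<le> cauchy_weight t * cauchy_weight x" by (simp add: less_imp_le)
    have "norm (char2 (t, x) \<zeta> * f (t, x)) \<le> A * (cauchy_weight t * cauchy_weight x)"
      using A(2) by (simp add: norm_mult)
    also have "... \<le> (A + (B + \<bar>\<xi>\<bar> * A)) * (cauchy_weight t * cauchy_weight x)"
      using A B w by (intro mult_right_mono) auto
    finally show "norm (char2 (t, x) \<zeta> * f (t, x)) \<le> ?C * cauchy_weight x" by (simp add: mult.assoc)
    have "norm (d (t, x)) \<le> norm (partial_x f (t, x)) + \<bar>\<xi>\<bar> * norm (f (t, x))"
      unfolding d_def norm_mult norm_char2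
      by (rule order_trans[OF eq_refl norm_triangle_ineq4[THEN order_trans]]) (auto simp: norm_mult)
    also have "... \<le> B * (cauchy_weight t * cauchy_weight x) + \<bar>\<xi>\<bar> * (A * (cauchy_weight t * cauchy_weight x))"
      using A B by (intro add_mono mult_left_mono) auto
    also have "... = (B + \<bar>\<xi>\<bar> * A) * (cauchy_weight t * cauchy_weight x)" by (simp add: algebra_simps)
    also have "... \<le> (A + (B + \<bar>\<xi>\<bar> * A)) * (cauchy_weight t * cauchy_weight x)"
      using A B w by (intro mult_right_mono) auto
    finally show "norm (d (t, x)) \<le> ?C * cauchy_weight x" by (simp add: mult.assoc)
  qed
  have "(\<integral>z. d z \<partial>lborel) = (\<integral>t. \<integral>x. d (t, x) \<partial>lborel \<partial>lborel)"
    using lborel_pair.integral_fst'[of d] int_d by (simp add: lborel_prod)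
  also have "... = 0" by (simp add: zero)
  finally have "(\<integral>z. char2 z \<zeta> * partial_x f z - \<i> * of_real \<xi> * (char2 z \<zeta> * f z) \<partial>lborel) = 0"
    by (simp add: d_def algebra_simps)
  then show ?thesis
    using integrable_char2_mult[OF integrable_tame[OF f], of \<zeta>] integrable_char2_mult[OF integrable_tame[OF fx], of \<zeta>]
    by (simp add: fourier_char2 \<zeta>)
qed

text \<open>The time derivative reduces to the space derivative by exchanging the variables.\<close>

lemma partial_t_swap: "partial_t f = (\<lambda>z. partial_x (\<lambda>z. f (prod.swap z)) (prod.swap z))"
  by (auto simp: partial_t_def partial_x_def)

lemma integral_swap:
  fixes f :: "real \<times> real \<Rightarrow> complex"
  assumes [measurable]: "f \<in> borel_measurable borel"
  shows "(\<integral>z. f (prod.swap z) \<partial>lborel) = (\<integral>z. f z \<partial>lborel)"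
proof -
  have "(\<integral>z. f z \<partial>(lborel \<Otimes>\<^sub>M lborel)) = (\<integral>z. f z \<partial>distr (lborel \<Otimes>\<^sub>M lborel) (lborel \<Otimes>\<^sub>M lborel) (\<lambda>(x, y). (y, x)))"
    using lborel_pair.distr_pair_swap by metis
  also have "... = (\<integral>z. f (prod.swap z) \<partial>(lborel \<Otimes>\<^sub>M lborel))"
    by (subst integral_distr) (auto simp: prod.swap_def case_prod_beta lborel_prod)
  finally show ?thesis by (simp add: lborel_prod)
qed

lemma fourier_swap:
  assumes [measurable]: "f \<in> borel_measurable borel"
  shows "fourier (\<lambda>z. f (prod.swap z)) \<zeta> = fourier f (prod.swap \<zeta>)"
  using integral_swap[of "\<lambda>z. char2 z (prod.swap \<zeta>) * f z"]
  by (simp add: fourier_char2 char2_def mult.commute)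

lemma tame_swap:
  assumes "tame f"
  shows "tame (\<lambda>z. f (prod.swap z))"
proof -
  have "(\<lambda>z::real\<times>real. f (snd z, fst z)) differentiable (at z)" for z
  proof -
    have "(f \<circ> (\<lambda>z. (snd z, fst z))) differentiable (at z)"
      by (intro differentiable_chain_at differentiable_Pair)
         (auto intro: bounded_linear_imp_differentiable bounded_linear_fst bounded_linear_snd tame_differentiable assms)
    then show ?thesis by (simp add: comp_def)
  qed
  moreover have "norm (prod.swap z) = norm z" for z :: "real \<times> real"
    by (cases z) (simp add: norm_Pair add.commute)
  ultimately show ?thesis
    using assms unfolding tame_def rapidly_decreasing_def prod.swap_def by (metis swap_swap prod.swap_def)
qed

lemma fourier_partial_t:
  assumes f: "tame f" and ft: "tame (partial_t f)"
  shows "fourier (partial_t f) \<zeta> = \<i> * of_real (fst \<zeta>) * fourier f \<zeta>"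
proof -
  let ?g = "\<lambda>z. f (prod.swap z)"
  have pt: "partial_x ?g = (\<lambda>z. partial_t f (prod.swap z))"
    by (simp add: partial_t_swap[of f])
  have [measurable]: "f \<in> borel_measurable borel" "partial_t f \<in> borel_measurable borel"
    using f ft by (auto intro: tame_measurable)
  have "fourier (partial_x ?g) (prod.swap \<zeta>) = \<i> * of_real (snd (prod.swap \<zeta>)) * fourier ?g (prod.swap \<zeta>)"
    unfolding pt using fourier_partial_x[OF tame_swap[OF f]] tame_swap[OF ft] pt by simp
  then show ?thesis
    unfolding pt by (simp add: fourier_swap)
qed

lemma fourier_partials:
  assumes "schwartz f"
  shows "fourier ((partial_t ^^ i) ((partial_x ^^ j) f)) \<zeta>
     = (\<i> * of_real (fst \<zeta>)) ^ i * (\<i> * of_real (snd \<zeta>)) ^ j * fourier f \<zeta>"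
proof -
  have x: "fourier ((partial_x ^^ j) f) \<zeta> = (\<i> * of_real (snd \<zeta>)) ^ j * fourier f \<zeta>"
  proof (induction j)
    case (Suc j)
    have "tame ((partial_x ^^ j) f)" "tame (partial_x ((partial_x ^^ j) f))"
      using schwartz_funpow_partial_x[OF assms] schwartz_imp_tame schwartz_partial_x by blast+
    from fourier_partial_x[OF this] Suc show ?case by simp
  qed simp
  show ?thesis
  proof (induction i)
    case (Suc i)
    have "tame ((partial_t ^^ i) ((partial_x ^^ j) f))" "tame ((partial_t ^^ (Suc i)) ((partial_x ^^ j) f))"
      using assms unfolding schwartz_iff_tame by blast+
    then show ?case using fourier_partial_t[of "(partial_t ^^ i) ((partial_x ^^ j) f)"] Suc by simp
  qed (simp add: x)
qed

text \<open>Monomials times the transform are bounded by L1 norms of derivatives. As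
  \<open>(1 + y^2) ^ n\<close> is at most \<open>2 ^ n * (1 + \<bar>y\<bar> ^ (2 * n))\<close>, only
  the powers 0 and \<open>2 * n\<close> in each variable are used; the factor \<open>4 ^ n\<close>
  comes from the two variables.\<close>

lemma fourier_decay:
  assumes "schwartz f"
  obtains C where "0 \<le> C"
    "\<And>\<tau> \<xi>. norm (fourier f (\<tau>, \<xi>)) \<le> C * (cauchy_weight \<tau> ^ n * cauchy_weight \<xi> ^ n)"
proof -
  define S where "S i j = (\<integral>z. norm ((partial_t ^^ i) ((partial_x ^^ j) f) z) \<partial>lborel)" for i j
  have S0: "0 \<le> S i j" for i j unfolding S_def by simp
  have S: "\<bar>\<tau>\<bar> ^ i * \<bar>\<xi>\<bar> ^ j * norm (fourier f (\<tau>, \<xi>)) \<le> S i j" for i j \<tau> \<xi>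
  proof -
    have "tame ((partial_t ^^ i) ((partial_x ^^ j) f))" using assms unfolding schwartz_iff_tame by blast
    from norm_fourier_le[OF this, of "(\<tau>, \<xi>)"] show ?thesis
      unfolding fourier_partials[OF assms] S_def by (simp add: norm_mult norm_power)
  qed
  have pw: "(1 + y\<^sup>2) ^ n \<le> 2 ^ n * (1 + \<bar>y\<bar> ^ (2 * n))" for y :: real
  proof -
    have "1 + y\<^sup>2 \<le> 2 * max 1 (y\<^sup>2)" by (simp add: max_def)
    then have "(1 + y\<^sup>2) ^ n \<le> (2 * max 1 (y\<^sup>2)) ^ n" by (intro power_mono) auto
    also have "... \<le> 2 ^ n * (1 + \<bar>y\<bar> ^ (2 * n))"
      by (auto simp: max_def power_mult_distrib power_mult)
    finally show ?thesis .
  qed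
  define C where "C = 4 ^ n * (S 0 0 + S 0 (2 * n) + S (2 * n) 0 + S (2 * n) (2 * n))"
  have "norm (fourier f (\<tau>, \<xi>)) \<le> C * (cauchy_weight \<tau> ^ n * cauchy_weight \<xi> ^ n)" for \<tau> \<xi>
  proof -
    let ?F = "norm (fourier f (\<tau>, \<xi>))"
    have "(1 + \<tau>\<^sup>2) ^ n * (1 + \<xi>\<^sup>2) ^ n * ?F \<le>
        (2 ^ n * (1 + \<bar>\<tau>\<bar> ^ (2 * n))) * (2 ^ n * (1 + \<bar>\<xi>\<bar> ^ (2 * n))) * ?F"
      by (intro mult_right_mono mult_mono pw) auto
    also have "... = 4 ^ n * (\<bar>\<tau>\<bar> ^ 0 * \<bar>\<xi>\<bar> ^ 0 * ?F + \<bar>\<tau>\<bar> ^ 0 * \<bar>\<xi>\<bar> ^ (2 * n) * ?F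
        + \<bar>\<tau>\<bar> ^ (2 * n) * \<bar>\<xi>\<bar> ^ 0 * ?F + \<bar>\<tau>\<bar> ^ (2 * n) * \<bar>\<xi>\<bar> ^ (2 * n) * ?F)"
    proof -
      have "(4::real) ^ n = 2 ^ n * 2 ^ n" by (simp flip: power_mult_distrib)
      then show ?thesis by (simp add: algebra_simps)
    qed
    also have "... \<le> C"
      unfolding C_def by (intro mult_left_mono add_mono S) auto
    finally have "(1 + \<tau>\<^sup>2) ^ n * (1 + \<xi>\<^sup>2) ^ n * ?F \<le> C" .
    moreover have "0 < (1 + \<tau>\<^sup>2) ^ n * (1 + \<xi>\<^sup>2) ^ n" by (intro mult_pos_pos zero_less_power) simp_all
    ultimately have "?F \<le> C / ((1 + \<tau>\<^sup>2) ^ n * (1 + \<xi>\<^sup>2) ^ n)"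
      by (simp add: pos_le_divide_eq mult.commute)
    then show ?thesis by (simp add: cauchy_weight_def power_divide)
  qed
  moreover have "0 \<le> C" unfolding C_def using S0 by (intro mult_nonneg_nonneg add_nonneg_nonneg) auto
  ultimately show ?thesis by (rule that[rotated])
qed

lemma integrable_fourier:
  assumes "schwartz f"
  shows "integrable lborel (fourier f)"
proof -
  obtain C where C: "0 \<le> C" "\<And>\<tau> \<xi>. norm (fourier f (\<tau>, \<xi>)) \<le> C * (cauchy_weight \<tau> ^ 1 * cauchy_weight \<xi> ^ 1)"
    using fourier_decay[OF assms, of 1] by blast
  have "fourier f \<in> borel_measurable borel"
    by (intro fourier_measurable tame_measurable schwartz_imp_tame assms)
  then show ?thesis
    by (intro Bochner_Integration.integrable_bound[OF integrable_mult_right[OF integrable_cauchy_weight2, of C]])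
       (use C in \<open>auto simp: abs_mult less_imp_le\<close>)
qed

section \<open>Fourier inversion\<close>

lemma integrable_pair_mult:
  fixes f :: "'a::euclidean_space \<Rightarrow> complex" and g :: "'b::euclidean_space \<Rightarrow> complex"
  assumes f: "integrable lborel f" and g: "integrable lborel g"
  shows "integrable (lborel \<Otimes>\<^sub>M lborel) (\<lambda>(x, y). f x * g y)"
proof -
  have [measurable]: "f \<in> borel_measurable borel" "g \<in> borel_measurable borel"
    using borel_measurable_integrable[OF f] borel_measurable_integrable[OF g] by simp_all
  show ?thesis
  proof (rule lborel_pair.Fubini_integrable)
    show "integrable lborel (\<lambda>x. \<integral>y. norm (case (x, y) of (x, y) \<Rightarrow> f x * g y) \<partial>lborel)"
      using f g by (simp add: norm_mult integrable_norm)
    show "AE x in lborel. integrable lborel (\<lambda>y. case (x, y) of (x, y) \<Rightarrow> f x * g y)"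
      using g by simp
  qed measurable
qed

lemma integral_pair_mult:
  fixes f g :: "real \<Rightarrow> complex"
  assumes f: "integrable lborel f" and g: "integrable lborel g"
  shows "integrable lborel (\<lambda>z. f (fst z) * g (snd z))"
    and "(\<integral>z. f (fst z) * g (snd z) \<partial>lborel) = (\<integral>x. f x \<partial>lborel) * (\<integral>y. g y \<partial>lborel)"
proof -
  have *: "integrable (lborel \<Otimes>\<^sub>M lborel) (\<lambda>z. f (fst z) * g (snd z))"
    using integrable_pair_mult[OF f g] by (simp add: case_prod_unfold)
  then show "integrable lborel (\<lambda>z. f (fst z) * g (snd z))" by (simp add: lborel_prod)
  show "(\<integral>z. f (fst z) * g (snd z) \<partial>lborel) = (\<integral>x. f x \<partial>lborel) * (\<integral>y. g y \<partial>lborel)"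
    using lborel_pair.integral_fst'[OF *] by (simp add: lborel_prod)
qed

lemma lborel_integral_affine_plane:
  fixes f :: "real \<times> real \<Rightarrow> complex"
  assumes [measurable]: "f \<in> borel_measurable borel" and "c \<noteq> 0"
  shows "(\<integral>z. f z \<partial>lborel) = of_real (c\<^sup>2) * (\<integral>z. f (t + c *\<^sub>R z) \<partial>lborel)"
  by (subst lborel_affine[OF \<open>c \<noteq> 0\<close>, of t])
     (simp add: integral_density integral_distr scaleR_conv_of_real power2_eq_square)

section \<open>Gaussian regularisation\<close>

definition gauss2 :: "real \<times> real \<Rightarrow> real" where
  "gauss2 z = std_normal_density (fst z) * std_normal_density (snd z)"

lemma std_normal_density_le_1: "std_normal_density x \<le> 1"
proof -
  have "1 \<le> sqrt (2 * pi)" using pi_gt3 by (intro real_le_rsqrt) auto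
  then have "1 / sqrt (2 * pi) \<le> 1" by (intro divide_le_eq_1_pos[THEN iffD2]) auto
  then have "1 / sqrt (2 * pi) * exp (- x\<^sup>2 / 2) \<le> 1 * 1" by (intro mult_mono) auto
  then show ?thesis by (simp only: std_normal_density_def mult_1)
qed

lemma std_normal_density_nonneg': "0 \<le> std_normal_density x"
  by (simp add: std_normal_density_def)

lemma gauss2_nonneg: "0 \<le> gauss2 z"
  by (simp add: gauss2_def std_normal_density_nonneg')

lemma gauss2_le_1: "gauss2 z \<le> 1"
  unfolding gauss2_def using std_normal_density_le_1 std_normal_density_nonneg'
  by (intro mult_le_one) auto

lemma gauss2_0: "gauss2 0 = 1 / (2 * pi)"
  by (simp add: gauss2_def std_normal_density_def)

lemma continuous_gauss2: "continuous_on UNIV gauss2"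
  unfolding gauss2_def[abs_def] std_normal_density_def by (intro continuous_intros) auto

lemma gauss2_measurable [measurable]: "gauss2 \<in> borel_measurable borel"
  by (rule borel_measurable_continuous_onI[OF continuous_gauss2])

text \<open>This is the characteristic function of the standard normal distribution, taken at
  \<open>- s\<close> because \<open>char\<close> uses the opposite sign in the exponent.\<close>

lemma gauss_fourier:
  "(\<integral>x. exp (- \<i> * of_real (x * s)) * of_real (std_normal_density x) \<partial>lborel)
     = of_real (sqrt (2 * pi) * std_normal_density s)"
proof -
  have "complex_of_real (exp (- (s\<^sup>2) / 2)) = char std_normal_distribution (- s)"
    by (simp add: char_std_normal_distribution)
  also have "... = (\<integral>x. of_real (std_normal_density x) * iexp (- s * x) \<partial>lborel)"
    unfolding char_def
    by (subst integral_density) (auto simp: scaleR_conv_of_real std_normal_density_nonneg')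
  also have "... = (\<integral>x. exp (- \<i> * of_real (x * s)) * of_real (std_normal_density x) \<partial>lborel)"
    by (simp add: mult.commute)
  finally show ?thesis by (simp add: std_normal_density_def)
qed

lemma integrable_gauss: "integrable lborel (\<lambda>x. complex_of_real (std_normal_density x))"
  by (rule integrable_of_real) simp

lemma integrable_gauss2: "integrable lborel (\<lambda>z. complex_of_real (gauss2 z))"
  using integral_pair_mult(1)[OF integrable_gauss integrable_gauss] by (simp add: gauss2_def)

lemma integral_gauss2: "(\<integral>z. complex_of_real (gauss2 z) \<partial>lborel) = 1"
  using integral_pair_mult(2)[OF integrable_gauss integrable_gauss]
  by (simp add: gauss2_def integral_normal_density)

lemma gauss2_fourier:
  "(\<integral>z. char2 z \<zeta> * of_real (gauss2 z) \<partial>lborel) = of_real (2 * pi * gauss2 \<zeta>)"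
proof -
  let ?g = "\<lambda>s x. exp (- \<i> * of_real (x * s)) * complex_of_real (std_normal_density x)"
  have int: "integrable lborel (?g s)" for s
    by (rule Bochner_Integration.integrable_bound[OF integrable_gauss]) (auto simp: norm_mult)
  have "(\<integral>z. char2 z \<zeta> * of_real (gauss2 z) \<partial>lborel) = (\<integral>z. ?g (fst \<zeta>) (fst z) * ?g (snd \<zeta>) (snd z) \<partial>lborel)"
    by (simp add: char2_def gauss2_def mult_ac)
  also have "... = of_real (sqrt (2 * pi) * std_normal_density (fst \<zeta>)) * of_real (sqrt (2 * pi) * std_normal_density (snd \<zeta>))"
    unfolding integral_pair_mult(2)[OF int int] gauss_fourier ..
  also have "... = of_real ((sqrt (2 * pi) * sqrt (2 * pi)) * gauss2 \<zeta>)"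
    unfolding gauss2_def by (simp only: of_real_mult mult_ac)
  finally show ?thesis by simp
qed

lemma gauss2_fourier_scaled:
  assumes "0 < \<epsilon>"
  shows "(\<integral>\<eta>. char2 p \<eta> * of_real (gauss2 (\<epsilon> *\<^sub>R \<eta>)) \<partial>lborel) = of_real (2 * pi / \<epsilon>\<^sup>2 * gauss2 (p /\<^sub>R \<epsilon>))"
proof -
  have c: "char2 p (\<eta> /\<^sub>R \<epsilon>) = char2 \<eta> (p /\<^sub>R \<epsilon>)" for \<eta>
    by (simp add: char2_def mult_ac)
  have "(\<integral>\<eta>. char2 p \<eta> * of_real (gauss2 (\<epsilon> *\<^sub>R \<eta>)) \<partial>lborel)
      = of_real ((1 / \<epsilon>)\<^sup>2) * (\<integral>\<eta>. char2 p (0 + (1 / \<epsilon>) *\<^sub>R \<eta>) * of_real (gauss2 (\<epsilon> *\<^sub>R (0 + (1 / \<epsilon>) *\<^sub>R \<eta>))) \<partial>lborel)"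
    using assms by (intro lborel_integral_affine_plane) auto
  also have "... = of_real ((1 / \<epsilon>)\<^sup>2) * (\<integral>\<eta>. char2 \<eta> (p /\<^sub>R \<epsilon>) * of_real (gauss2 \<eta>) \<partial>lborel)"
    using assms c by (simp add: divide_inverse_commute)
  finally show ?thesis by (simp add: gauss2_fourier power_divide)
qed

lemma integrable_scaled_gauss2:
  assumes "0 < \<epsilon>"
  shows "integrable lborel (\<lambda>\<eta>. complex_of_real (gauss2 (\<epsilon> *\<^sub>R \<eta>)))"
proof -
  have "integrable (distr lborel borel ((*\<^sub>R) \<epsilon> :: real \<times> real \<Rightarrow> _)) (\<lambda>z. complex_of_real (gauss2 z))"
  proof -
    have "integrable (density (distr lborel borel (\<lambda>x. 0 + \<epsilon> *\<^sub>R x)) (\<lambda>_. ennreal (\<bar>\<epsilon>\<bar> ^ DIM(real \<times> real))))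
      (\<lambda>z. complex_of_real (gauss2 z))"
      using integrable_gauss2 lborel_affine[of \<epsilon> "0 :: real \<times> real"] assms by simp
    then have "integrable (distr lborel borel (\<lambda>x::real \<times> real. 0 + \<epsilon> *\<^sub>R x)) (\<lambda>z. (\<bar>\<epsilon>\<bar> ^ DIM(real \<times> real)) *\<^sub>R complex_of_real (gauss2 z))"
      by (subst (asm) integrable_density) auto
    from integrable_scaleR_right[OF this, of "1 / (\<bar>\<epsilon>\<bar> ^ DIM(real \<times> real))"] assms
    show ?thesis by simp
  qed
  then show ?thesis by (subst (asm) integrable_distr_eq) auto
qed

text \<open>The Gaussian makes the double integral absolutely convergent, so the order may be
  exchanged. The integral over \<eta> is then a Gaussian concentrated at \<open>z\<close> on the
  scale \<epsilon>, and rescaling moves \<epsilon> into the argument of \<open>f\<close>.\<close>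

lemma gauss_regularised_inversion:
  assumes f: "tame f" and \<epsilon>: "0 < \<epsilon>"
  shows "(\<integral>\<eta>. fourier f \<eta> * char2 (- z) \<eta> * of_real (gauss2 (\<epsilon> *\<^sub>R \<eta>)) \<partial>lborel)
     = of_real (2 * pi) * (\<integral>w. f (z + \<epsilon> *\<^sub>R w) * of_real (gauss2 w) \<partial>lborel)"
proof -
  note [measurable] = tame_measurable[OF f]
  let ?h = "\<lambda>y \<eta>. char2 (y - z) \<eta> * (f y * complex_of_real (gauss2 (\<epsilon> *\<^sub>R \<eta>)))"
  have split: "char2 y \<eta> * char2 (- z) \<eta> = char2 (y - z) \<eta>" for y \<eta>
    by (simp add: char2_add_left[symmetric])
  have int: "integrable (lborel \<Otimes>\<^sub>M lborel) (\<lambda>(y, \<eta>). ?h y \<eta>)"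
    by (rule Bochner_Integration.integrable_bound[OF integrable_pair_mult[OF integrable_tame[OF f] integrable_scaled_gauss2[OF \<epsilon>]]])
       (auto simp: norm_mult)
  have "(\<integral>\<eta>. fourier f \<eta> * char2 (- z) \<eta> * of_real (gauss2 (\<epsilon> *\<^sub>R \<eta>)) \<partial>lborel)
     = (\<integral>\<eta>. \<integral>y. ?h y \<eta> \<partial>lborel \<partial>lborel)"
    unfolding fourier_char2
    by (subst integral_mult_left_zero[symmetric], subst integral_mult_left_zero[symmetric])
       (simp add: mult_ac flip: split)
  also have "... = (\<integral>y. \<integral>\<eta>. ?h y \<eta> \<partial>lborel \<partial>lborel)"
    using lborel_pair.Fubini_integral[OF int] .
  also have "... = (\<integral>y. f y * of_real (2 * pi / \<epsilon>\<^sup>2 * gauss2 ((y - z) /\<^sub>R \<epsilon>)) \<partial>lborel)"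
  proof (intro Bochner_Integration.integral_cong refl)
    fix y
    have "(\<integral>\<eta>. ?h y \<eta> \<partial>lborel) = (\<integral>\<eta>. f y * (char2 (y - z) \<eta> * complex_of_real (gauss2 (\<epsilon> *\<^sub>R \<eta>))) \<partial>lborel)"
      by (simp add: mult_ac)
    then show "(\<integral>\<eta>. ?h y \<eta> \<partial>lborel) = f y * of_real (2 * pi / \<epsilon>\<^sup>2 * gauss2 ((y - z) /\<^sub>R \<epsilon>))"
      using gauss2_fourier_scaled[OF \<epsilon>, of "y - z"] by simp
  qed
  also have "... = of_real (\<epsilon>\<^sup>2) * (\<integral>w. f (z + \<epsilon> *\<^sub>R w) * of_real (2 * pi / \<epsilon>\<^sup>2 * gauss2 ((z + \<epsilon> *\<^sub>R w - z) /\<^sub>R \<epsilon>)) \<partial>lborel)"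
    using \<epsilon> by (intro lborel_integral_affine_plane) auto
  also have "... = of_real (\<epsilon>\<^sup>2) * (\<integral>w. of_real (2 * pi / \<epsilon>\<^sup>2) * (f (z + \<epsilon> *\<^sub>R w) * of_real (gauss2 w)) \<partial>lborel)"
    using \<epsilon> by (simp add: mult_ac)
  also have "... = of_real (2 * pi) * (\<integral>w. f (z + \<epsilon> *\<^sub>R w) * of_real (gauss2 w) \<partial>lborel)"
  proof -
    have "complex_of_real (\<epsilon>\<^sup>2) * of_real (2 * pi / \<epsilon>\<^sup>2) = of_real (2 * pi)"
      unfolding of_real_mult[symmetric] using \<epsilon> by simp
    then show ?thesis by (subst integral_mult_right_zero) (simp only: mult.assoc[symmetric])
  qed
  finally show ?thesis .
qed

text \<open>Let \<epsilon> tend to 0 in the regularised identity. The left side is dominated by the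
  integrable transform, the right side by a multiple of the Gaussian. One factor
  \<open>2 * pi\<close> stands in that identity, the other comes from the value of
  \<open>gauss2\<close> at 0.\<close>

theorem fourier_inversion:
  assumes f: "schwartz f"
  shows "(\<integral>\<eta>. fourier f \<eta> * char2 (- z) \<eta> \<partial>lborel) = of_real (4 * pi\<^sup>2) * f z"
proof -
  note tame = schwartz_imp_tame[OF f]
  note [measurable] = tame_measurable[OF tame]
  define \<epsilon> where "\<epsilon> n = 1 / real (Suc n)" for n
  have \<epsilon>: "0 < \<epsilon> n" for n by (simp add: \<epsilon>_def)
  have \<epsilon>0: "\<epsilon> \<longlonglongrightarrow> 0"
    unfolding \<epsilon>_def[abs_def] using LIMSEQ_inverse_real_of_nat by (simp add: inverse_eq_divide)
  obtain C where C: "0 \<le> C" "\<And>t x. norm (f (t, x)) \<le> C * (cauchy_weight t * cauchy_weight x)"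
    using tame_decay[OF tame] by blast
  have bound: "norm (f y) \<le> C" for y
  proof -
    obtain t x where y: "y = (t, x)" by force
    have "cauchy_weight t * cauchy_weight x \<le> 1"
      by (intro mult_le_one) (auto simp: cauchy_weight_def less_imp_le)
    then show ?thesis using C(2)[of t x] mult_left_mono[OF _ C(1), of "cauchy_weight t * cauchy_weight x" 1] y by simp
  qed
  have cf: "isCont f y" for y
    using tame_continuous[OF tame] continuous_on_eq_continuous_at[OF open_UNIV] by blast
  have cg: "isCont gauss2 y" for y
    using continuous_gauss2 continuous_on_eq_continuous_at[OF open_UNIV] by blast
  have "(\<lambda>n. \<integral>\<eta>. fourier f \<eta> * char2 (- z) \<eta> * of_real (gauss2 (\<epsilon> n *\<^sub>R \<eta>)) \<partial>lborel)
    \<longlonglongrightarrow> (\<integral>\<eta>. fourier f \<eta> * char2 (- z) \<eta> * of_real (gauss2 0) \<partial>lborel)"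
  proof (rule integral_dominated_convergence[where w = "\<lambda>\<eta>. norm (fourier f \<eta>)"])
    show "AE \<eta> in lborel. (\<lambda>n. fourier f \<eta> * char2 (- z) \<eta> * complex_of_real (gauss2 (\<epsilon> n *\<^sub>R \<eta>)))
        \<longlonglongrightarrow> fourier f \<eta> * char2 (- z) \<eta> * complex_of_real (gauss2 0)"
    proof (intro AE_I2 tendsto_intros)
      fix \<eta>
      show "(\<lambda>n. gauss2 (\<epsilon> n *\<^sub>R \<eta>)) \<longlonglongrightarrow> gauss2 0"
        by (rule isCont_tendsto_compose[OF cg]) (use tendsto_scaleR[OF \<epsilon>0 tendsto_const, of \<eta>] in simp)
    qed
    show "AE \<eta> in lborel. norm (fourier f \<eta> * char2 (- z) \<eta> * complex_of_real (gauss2 (\<epsilon> n *\<^sub>R \<eta>))) \<le> norm (fourier f \<eta>)" for n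
      using gauss2_nonneg gauss2_le_1 by (auto simp: norm_mult mult_left_le)
    show "integrable lborel (\<lambda>\<eta>. norm (fourier f \<eta>))" by (intro integrable_norm integrable_fourier f)
  qed measurable
  moreover have "(\<lambda>n. \<integral>w. f (z + \<epsilon> n *\<^sub>R w) * of_real (gauss2 w) \<partial>lborel)
    \<longlonglongrightarrow> (\<integral>w. f z * of_real (gauss2 w) \<partial>lborel)"
  proof (rule integral_dominated_convergence[where w = "\<lambda>w. C * gauss2 w"])
    show "AE w in lborel. (\<lambda>n. f (z + \<epsilon> n *\<^sub>R w) * complex_of_real (gauss2 w)) \<longlonglongrightarrow> f z * complex_of_real (gauss2 w)"
    proof (intro AE_I2 tendsto_intros)
      fix w
      have "(\<lambda>n. z + \<epsilon> n *\<^sub>R w) \<longlonglongrightarrow> z + 0 *\<^sub>R w" by (intro tendsto_intros \<epsilon>0)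
      then show "(\<lambda>n. f (z + \<epsilon> n *\<^sub>R w)) \<longlonglongrightarrow> f z"
        by (intro isCont_tendsto_compose[OF cf]) simp
    qed
    show "AE w in lborel. norm (f (z + \<epsilon> n *\<^sub>R w) * complex_of_real (gauss2 w)) \<le> C * gauss2 w" for n
      by (intro AE_I2) (simp add: norm_mult gauss2_nonneg mult_right_mono bound)
    have "integrable lborel (\<lambda>z. norm (complex_of_real (gauss2 z)))" by (intro integrable_norm integrable_gauss2)
    then show "integrable lborel (\<lambda>w. C * gauss2 w)"
      using gauss2_nonneg by simp
  qed measurable
  then have "(\<lambda>n. of_real (2 * pi) * (\<integral>w. f (z + \<epsilon> n *\<^sub>R w) * of_real (gauss2 w) \<partial>lborel))
    \<longlonglongrightarrow> of_real (2 * pi) * (\<integral>w. f z * of_real (gauss2 w) \<partial>lborel)"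
    by (intro tendsto_intros)
  ultimately have "(\<integral>\<eta>. fourier f \<eta> * char2 (- z) \<eta> * of_real (gauss2 0) \<partial>lborel)
      = of_real (2 * pi) * (\<integral>w. f z * of_real (gauss2 w) \<partial>lborel)"
    unfolding gauss_regularised_inversion[OF tame \<epsilon>] by (rule LIMSEQ_unique)
  then have "(\<integral>\<eta>. fourier f \<eta> * char2 (- z) \<eta> \<partial>lborel) * of_real (1 / (2 * pi)) = of_real (2 * pi) * f z"
    by (simp add: gauss2_0 integral_gauss2[simplified] del: of_real_divide)
  then show ?thesis by (simp add: field_simps power2_eq_square)
qed

text \<open>Inserting the inversion formula for \<open>v\<close> under the transform of the product
  gives a double integral, absolutely convergent because \<open>u\<close> and the transform of
  \<open>v\<close> are integrable; exchanging the order produces the convolution.\<close>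

theorem fourier_mult:
  assumes u: "schwartz u" and v: "schwartz v"
  shows "of_real (4 * pi\<^sup>2) * fourier (\<lambda>z. u z * v z) \<zeta> = (\<integral>\<eta>. fourier v \<eta> * fourier u (\<zeta> - \<eta>) \<partial>lborel)"
proof -
  note tu = schwartz_imp_tame[OF u] and tv = schwartz_imp_tame[OF v]
  note [measurable] = tame_measurable[OF tu] tame_measurable[OF tv]
  let ?h = "\<lambda>z \<eta>. char2 z (\<zeta> - \<eta>) * (u z * fourier v \<eta>)"
  have split: "char2 z \<zeta> * char2 (- z) \<eta> = char2 z (\<zeta> - \<eta>)" for z \<eta>
    by (simp add: char2_minus char2_add_right[symmetric])
  have int: "integrable (lborel \<Otimes>\<^sub>M lborel) (\<lambda>(z, \<eta>). ?h z \<eta>)"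
    by (rule Bochner_Integration.integrable_bound[OF integrable_pair_mult[OF integrable_tame[OF tu] integrable_fourier[OF v]]])
       (auto simp: norm_mult)
  have "of_real (4 * pi\<^sup>2) * fourier (\<lambda>z. u z * v z) \<zeta> = (\<integral>z. char2 z \<zeta> * u z * (of_real (4 * pi\<^sup>2) * v z) \<partial>lborel)"
    unfolding fourier_char2 by (subst integral_mult_right_zero[symmetric]) (simp add: mult_ac)
  also have "... = (\<integral>z. \<integral>\<eta>. ?h z \<eta> \<partial>lborel \<partial>lborel)"
    unfolding fourier_inversion[OF v, symmetric]
    by (subst integral_mult_right_zero[symmetric]) (simp add: mult_ac flip: split)
  also have "... = (\<integral>\<eta>. \<integral>z. ?h z \<eta> \<partial>lborel \<partial>lborel)"
    using lborel_pair.Fubini_integral[OF int] by simp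
  also have "... = (\<integral>\<eta>. fourier v \<eta> * fourier u (\<zeta> - \<eta>) \<partial>lborel)"
    unfolding fourier_char2[of u] by (subst integral_mult_right_zero[symmetric]) (simp add: mult_ac)
  finally show ?thesis .
qed

text \<open>The factor \<open>4 * pi^2\<close> of the convolution formula is at least 1 and is
  dropped. Extended nonnegative values allow later integrals to be handled without integrability
  conditions.\<close>

lemma norm_fourier_dx_mult:
  assumes u: "schwartz u" and v: "schwartz v"
  shows "ennreal (norm (fourier (partial_x (\<lambda>z. u z * v z)) \<zeta>))
     \<le> ennreal \<bar>snd \<zeta>\<bar> * (\<integral>\<^sup>+\<eta>. ennreal (norm (fourier v \<eta>)) * ennreal (norm (fourier u (\<zeta> - \<eta>))) \<partial>lborel)"
proof -
  have uv: "schwartz (\<lambda>z. u z * v z)" by (rule schwartz_mult[OF u v])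
  have "norm (fourier (partial_x (\<lambda>z. u z * v z)) \<zeta>) = \<bar>snd \<zeta>\<bar> * norm (fourier (\<lambda>z. u z * v z) \<zeta>)"
    using uv by (simp add: fourier_partial_x schwartz_imp_tame schwartz_partial_x norm_mult)
  also have "ennreal ... = ennreal \<bar>snd \<zeta>\<bar> * ennreal (norm (fourier (\<lambda>z. u z * v z) \<zeta>))"
    by (simp add: ennreal_mult)
  also have "ennreal (norm (fourier (\<lambda>z. u z * v z) \<zeta>)) \<le> ennreal (4 * pi\<^sup>2 * norm (fourier (\<lambda>z. u z * v z) \<zeta>))"
  proof -
    have "1 \<le> 4 * pi\<^sup>2" using pi_gt3 power_mono[of 3 pi 2] by simp
    from mult_right_mono[OF this, of "norm (fourier (\<lambda>z. u z * v z) \<zeta>)"] show ?thesis by (intro ennreal_leI) simp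
  qed
  also have "4 * pi\<^sup>2 * norm (fourier (\<lambda>z. u z * v z) \<zeta>) = norm (\<integral>\<eta>. fourier v \<eta> * fourier u (\<zeta> - \<eta>) \<partial>lborel)"
    unfolding fourier_mult[OF u v, symmetric] norm_mult norm_of_real by simp
  also have "ennreal ... \<le> (\<integral>\<^sup>+\<eta>. ennreal (norm (fourier v \<eta>)) * ennreal (norm (fourier u (\<zeta> - \<eta>))) \<partial>lborel)"
  \<comment> \<open>Without integrability the Bochner integral is 0 by convention, and the bound is
    trivial.\<close>
  proof (cases "integrable lborel (\<lambda>\<eta>. fourier v \<eta> * fourier u (\<zeta> - \<eta>))")
    case True
    from integral_norm_bound_ennreal[OF True] show ?thesis by (simp add: norm_mult ennreal_mult)
  qed (simp add: not_integrable_integral_eq)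
  finally show ?thesis by (simp add: mult_left_mono)
qed

section \<open>Completions\<close>

text \<open>The laws are phrased through differences, the form in which a norm enters the Cauchy
  condition and the relation between sequences. The bound on \<open>N f\<close> compares a value
  with a distance and yields convergence of the norms.\<close>

definition schwartz_seminorm :: "((real \<times> real \<Rightarrow> complex) \<Rightarrow> real) \<Rightarrow> bool" where
  "schwartz_seminorm N \<longleftrightarrow>
     (\<forall>f. schwartz f \<longrightarrow> 0 \<le> N f \<and> N (\<lambda>z. f z - f z) = 0) \<and>
     (\<forall>f g. schwartz f \<longrightarrow> schwartz g \<longrightarrow>
        N (\<lambda>z. f z - g z) = N (\<lambda>z. g z - f z) \<and> N f \<le> N (\<lambda>z. f z - g z) + N g) \<and>
     (\<forall>f g h. schwartz f \<longrightarrow> schwartz g \<longrightarrow> schwartz h \<longrightarrow>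
        N (\<lambda>z. f z - h z) \<le> N (\<lambda>z. f z - g z) + N (\<lambda>z. g z - h z))"

context
  fixes N :: "(real \<times> real \<Rightarrow> complex) \<Rightarrow> real"
  assumes N: "schwartz_seminorm N"
begin

lemma schwartz_seminorm_nonneg: "schwartz f \<Longrightarrow> 0 \<le> N f"
  and schwartz_seminorm_zero: "schwartz f \<Longrightarrow> N (\<lambda>z. f z - f z) = 0"
  and schwartz_seminorm_commute:
    "schwartz f \<Longrightarrow> schwartz g \<Longrightarrow> N (\<lambda>z. f z - g z) = N (\<lambda>z. g z - f z)"
  and schwartz_seminorm_triangle:
    "schwartz f \<Longrightarrow> schwartz g \<Longrightarrow> schwartz h \<Longrightarrow>
      N (\<lambda>z. f z - h z) \<le> N (\<lambda>z. f z - g z) + N (\<lambda>z. g z - h z)"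
  using N unfolding schwartz_seminorm_def by blast+

lemma schwartz_seminorm_abs_diff:
  assumes "schwartz f" "schwartz g"
  shows "\<bar>N f - N g\<bar> \<le> N (\<lambda>z. f z - g z)"
proof -
  have "N f \<le> N (\<lambda>z. f z - g z) + N g" "N g \<le> N (\<lambda>z. g z - f z) + N f"
    using N assms unfolding schwartz_seminorm_def by blast+
  then show ?thesis using schwartz_seminorm_commute[OF assms] by linarith
qed

lemma schwartz_Cauchy_convergent:
  assumes u: "schwartz_Cauchy N u"
  shows "convergent (\<lambda>n. N (u n))"
proof -
  have "Cauchy (\<lambda>n. N (u n))"
  proof (rule CauchyI)
    fix e :: real assume "0 < e"
    then obtain M where M: "\<And>m n. M \<le> m \<Longrightarrow> M \<le> n \<Longrightarrow> N (\<lambda>z. u m z - u n z) < e"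
      using u unfolding schwartz_Cauchy_def by blast
    have "norm (N (u m) - N (u n)) < e" if "M \<le> m" "M \<le> n" for m n
      using schwartz_seminorm_abs_diff[of "u m" "u n"] M[OF that] u
      unfolding schwartz_Cauchy_def by force
    then show "\<exists>M. \<forall>m\<ge>M. \<forall>n\<ge>M. norm (N (u m) - N (u n)) < e" by blast
  qed
  then show ?thesis by (rule real_Cauchy_convergent)
qed

lemma schwartz_completion_memD:
  assumes "U \<in> schwartz_completion N" "u \<in> U"
  shows "schwartz_Cauchy N u"
  using assms unfolding schwartz_completion_def quotient_def by auto

text \<open>A class is the image of one Cauchy sequence \<open>x\<close> under the relation, so two
  members are compared through \<open>x\<close> by the triangle inequality.\<close>

lemma schwartz_completion_diff:
  assumes U: "U \<in> schwartz_completion N" and u: "u \<in> U" and v: "v \<in> U"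
  shows "(\<lambda>n. N (\<lambda>z. u n z - v n z)) \<longlonglongrightarrow> 0"
proof -
  obtain x where x: "schwartz_Cauchy N x" "\<And>y. y \<in> U \<Longrightarrow> (\<lambda>n. N (\<lambda>z. x n z - y n z)) \<longlonglongrightarrow> 0"
    using U unfolding schwartz_completion_def quotient_def by auto
  have S: "schwartz (x n)" "schwartz (u n)" "schwartz (v n)" for n
    using x(1) schwartz_completion_memD[OF U u] schwartz_completion_memD[OF U v]
    unfolding schwartz_Cauchy_def by blast+
  show ?thesis
  proof (rule tendsto_sandwich[OF _ _ tendsto_const])
    show "(\<lambda>n. N (\<lambda>z. x n z - u n z) + N (\<lambda>z. x n z - v n z)) \<longlonglongrightarrow> 0"
      using tendsto_add[OF x(2)[OF u] x(2)[OF v]] by simp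
    show "\<forall>\<^sub>F n in sequentially. N (\<lambda>z. u n z - v n z) \<le> N (\<lambda>z. x n z - u n z) + N (\<lambda>z. x n z - v n z)"
    proof (rule always_eventually, rule allI)
      fix n
      show "N (\<lambda>z. u n z - v n z) \<le> N (\<lambda>z. x n z - u n z) + N (\<lambda>z. x n z - v n z)"
        using schwartz_seminorm_triangle[OF S(2,1,3), of n n n] schwartz_seminorm_commute[OF S(2,1), of n n] by simp
    qed
    show "\<forall>\<^sub>F n in sequentially. 0 \<le> N (\<lambda>z. u n z - v n z)"
    proof (rule always_eventually, rule allI)
      fix n
      show "0 \<le> N (\<lambda>z. u n z - v n z)"
        using schwartz_seminorm_abs_diff[OF S(2,3), of n n] by linarith
    qed
  qed
qed

text \<open>The norms along a representative converge, and the limit is the same for all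
  representatives of a class. Hence the description in \<open>completion_norm\<close> denotes
  it.\<close>

lemma completion_norm_tendsto:
  assumes U: "U \<in> schwartz_completion N" and u: "u \<in> U"
  shows "(\<lambda>n. N (u n)) \<longlonglongrightarrow> completion_norm N U"
proof -
  obtain l where l: "(\<lambda>n. N (u n)) \<longlonglongrightarrow> l"
    using schwartz_Cauchy_convergent[OF schwartz_completion_memD[OF U u]] by (auto simp: convergent_def)
  have lim: "(\<lambda>n. N (w n)) \<longlonglongrightarrow> l" if w: "w \<in> U" for w
  proof -
    have S: "schwartz (w n)" "schwartz (u n)" for n
      using schwartz_completion_memD[OF U u] schwartz_completion_memD[OF U w]
      unfolding schwartz_Cauchy_def by blast+
    have "(\<lambda>n. N (w n) - N (u n)) \<longlonglongrightarrow> 0"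
      by (rule Lim_null_comparison[OF _ schwartz_completion_diff[OF U w u]])
         (use schwartz_seminorm_abs_diff[OF S] in simp)
    from tendsto_add[OF this l] show ?thesis by simp
  qed
  have "completion_norm N U = l"
    unfolding completion_norm_def
    using lim u l by (intro the_equality) (auto intro: LIMSEQ_unique)
  with l show ?thesis by simp
qed

lemma schwartz_completion_class:
  assumes "schwartz_Cauchy N u"
  obtains U where "U \<in> schwartz_completion N"
    "\<And>v. v \<in> U \<longleftrightarrow> schwartz_Cauchy N v \<and> (\<lambda>n. N (\<lambda>z. u n z - v n z)) \<longlonglongrightarrow> 0"
proof
  let ?r = "{(u, v). schwartz_Cauchy N u \<and> schwartz_Cauchy N v \<and> (\<lambda>n. N (\<lambda>z. u n z - v n z)) \<longlonglongrightarrow> 0}"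
  show "?r `` {u} \<in> schwartz_completion N"
    unfolding schwartz_completion_def using assms by (intro quotientI) simp
  show "v \<in> ?r `` {u} \<longleftrightarrow> schwartz_Cauchy N v \<and> (\<lambda>n. N (\<lambda>z. u n z - v n z)) \<longlonglongrightarrow> 0" for v
    using assms by simp
qed

lemma schwartz_completion_nonempty:
  assumes "U \<in> schwartz_completion N"
  obtains u where "u \<in> U"
proof -
  obtain x where x: "schwartz_Cauchy N x"
    "U = {(u, v). schwartz_Cauchy N u \<and> schwartz_Cauchy N v \<and> (\<lambda>n. N (\<lambda>z. u n z - v n z)) \<longlonglongrightarrow> 0} `` {x}"
    using assms unfolding schwartz_completion_def quotient_def by auto
  have "N (\<lambda>z. x n z - x n z) = 0" for n
    using x(1) unfolding schwartz_Cauchy_def by (intro schwartz_seminorm_zero) blast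
  then have "x \<in> U"
    unfolding x(2) Image_singleton_iff mem_Collect_eq case_prod_conv using x(1) by (simp only: tendsto_const simp_thms)
  then show ?thesis by (rule that)
qed

end

text \<open>Everything rests on splitting \<open>B f g - B f' g'\<close> into
  \<open>B (f - f') g\<close> and \<open>B f' (g - g')\<close>. Together with boundedness of Cauchy
  sequences this shows that images are Cauchy and that their class is independent of the
  representatives. \<open>W\<close> is generated by one chosen pair, and the norm bound passes to
  the limit.\<close>

lemma schwartz_bilinear_extension:
  fixes B :: "(real \<times> real \<Rightarrow> complex) \<Rightarrow> (real \<times> real \<Rightarrow> complex) \<Rightarrow> (real \<times> real \<Rightarrow> complex)"
  assumes N: "schwartz_seminorm N" and N': "schwartz_seminorm N'"
    and diff: "\<And>f g. schwartz f \<Longrightarrow> schwartz g \<Longrightarrow> schwartz (\<lambda>z. f z - g z)"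
    and B: "\<And>f g. schwartz f \<Longrightarrow> schwartz g \<Longrightarrow> schwartz (B f g)"
    and Bl: "\<And>f g h. schwartz f \<Longrightarrow> schwartz g \<Longrightarrow> schwartz h \<Longrightarrow>
        B (\<lambda>z. f z - g z) h = (\<lambda>z. B f h z - B g h z)"
    and Br: "\<And>f g h. schwartz f \<Longrightarrow> schwartz g \<Longrightarrow> schwartz h \<Longrightarrow>
        B h (\<lambda>z. f z - g z) = (\<lambda>z. B h f z - B h g z)"
    and c: "0 < c" and bound: "\<And>f g. schwartz f \<Longrightarrow> schwartz g \<Longrightarrow> N' (B f g) \<le> c * N f * N g"
    and U: "U \<in> schwartz_completion N" and V: "V \<in> schwartz_completion N"
  shows "\<exists>W\<in>schwartz_completion N'. (\<forall>u\<in>U. \<forall>v\<in>V. (\<lambda>n. B (u n) (v n)) \<in> W) \<and>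
     completion_norm N' W \<le> c * completion_norm N U * completion_norm N V"
proof -
  have est: "N' (\<lambda>z. B f g z - B f' g' z) \<le> c * N (\<lambda>z. f z - f' z) * N g + c * N f' * N (\<lambda>z. g z - g' z)"
    if S: "schwartz f" "schwartz g" "schwartz f'" "schwartz g'" for f g f' g'
  proof -
    have "N' (\<lambda>z. B f g z - B f' g' z) \<le>
        N' (\<lambda>z. B f g z - B f' g z) + N' (\<lambda>z. B f' g z - B f' g' z)"
      using S by (intro schwartz_seminorm_triangle[OF N'] B)
    also have "... = N' (B (\<lambda>z. f z - f' z) g) + N' (B f' (\<lambda>z. g z - g' z))"
      using S by (simp add: Bl Br)
    also have "... \<le> c * N (\<lambda>z. f z - f' z) * N g + c * N f' * N (\<lambda>z. g z - g' z)"
      using S by (intro add_mono bound diff)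
    finally show ?thesis .
  qed
  have Cauchy_B: "schwartz_Cauchy N' (\<lambda>n. B (u n) (v n))"
    if u: "schwartz_Cauchy N u" and v: "schwartz_Cauchy N v" for u v
  proof -
    have S: "schwartz (u n)" "schwartz (v n)" for n
      using u v unfolding schwartz_Cauchy_def by blast+
    obtain K1 where K1: "\<And>n. norm (N (u n)) \<le> K1"
      using convergent_imp_Bseq[OF schwartz_Cauchy_convergent[OF N u]] by (auto simp: Bseq_def)
    obtain K2 where K2: "\<And>n. norm (N (v n)) \<le> K2"
      using convergent_imp_Bseq[OF schwartz_Cauchy_convergent[OF N v]] by (auto simp: Bseq_def)
    \<comment> \<open>The summand 1 makes \<open>K\<close> positive, so that it can be divided
      by.\<close>
    define K where "K = \<bar>K1\<bar> + \<bar>K2\<bar> + 1"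
    have K: "0 < K" "N (u n) \<le> K" "N (v n) \<le> K" for n
      using K1[of n] K2[of n] by (auto simp: K_def)
    show ?thesis
      unfolding schwartz_Cauchy_def
    proof (intro conjI allI impI B S)
      fix e :: real assume "0 < e"
      \<comment> \<open>Each of the two terms of \<open>est\<close> is below
        \<open>c * K * d\<close>, and together these make \<open>e\<close>.\<close>
      define d where "d = e / (2 * c * K)"
      have d: "0 < d" using \<open>0 < e\<close> c K(1) by (simp add: d_def)
      obtain M1 where M1: "\<And>m n. M1 \<le> m \<Longrightarrow> M1 \<le> n \<Longrightarrow> N (\<lambda>z. u m z - u n z) < d"
        using u d unfolding schwartz_Cauchy_def by blast
      obtain M2 where M2: "\<And>m n. M2 \<le> m \<Longrightarrow> M2 \<le> n \<Longrightarrow> N (\<lambda>z. v m z - v n z) < d"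
        using v d unfolding schwartz_Cauchy_def by blast
      have "N' (\<lambda>z. B (u m) (v m) z - B (u n) (v n) z) < e" if mn: "max M1 M2 \<le> m" "max M1 M2 \<le> n" for m n
      proof -
        have nn: "0 \<le> N (\<lambda>z. u m z - u n z)" "0 \<le> N (\<lambda>z. v m z - v n z)"
          using S by (auto intro!: schwartz_seminorm_nonneg[OF N] diff)
        have "N' (\<lambda>z. B (u m) (v m) z - B (u n) (v n) z) \<le>
            c * N (\<lambda>z. u m z - u n z) * N (v m) + c * N (u n) * N (\<lambda>z. v m z - v n z)"
          by (rule est) (rule S)+
        also have "... \<le> c * N (\<lambda>z. u m z - u n z) * K + c * K * N (\<lambda>z. v m z - v n z)"
          using c K nn by (intro add_mono mult_left_mono mult_right_mono) auto
        also have "... = c * K * (N (\<lambda>z. u m z - u n z) + N (\<lambda>z. v m z - v n z))"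
          by (simp add: algebra_simps)
        also have "... < c * K * (d + d)"
          using c K(1) M1[of m n] M2[of m n] mn by (intro mult_strict_left_mono add_strict_mono) auto
        also have "... = e" using c K(1) by (simp add: d_def field_simps)
        finally show ?thesis .
      qed
      then show "\<exists>M. \<forall>m\<ge>M. \<forall>n\<ge>M. N' (\<lambda>z. B (u m) (v m) z - B (u n) (v n) z) < e" by blast
    qed
  qed
  obtain u0 where u0: "u0 \<in> U" using schwartz_completion_nonempty[OF N U] .
  obtain v0 where v0: "v0 \<in> V" using schwartz_completion_nonempty[OF N V] .
  note C0 = schwartz_completion_memD[OF N U u0] schwartz_completion_memD[OF N V v0]
  obtain W where W: "W \<in> schwartz_completion N'"
    "\<And>w. w \<in> W \<longleftrightarrow> schwartz_Cauchy N' w \<and> (\<lambda>n. N' (\<lambda>z. B (u0 n) (v0 n) z - w n z)) \<longlonglongrightarrow> 0"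
    using schwartz_completion_class[OF N' Cauchy_B[OF C0]] by blast
  have mem: "(\<lambda>n. B (u n) (v n)) \<in> W" if u: "u \<in> U" and v: "v \<in> V" for u v
  proof -
    note C = schwartz_completion_memD[OF N U u] schwartz_completion_memD[OF N V v]
    have S: "schwartz (u n)" "schwartz (v n)" "schwartz (u0 n)" "schwartz (v0 n)" for n
      using C C0 unfolding schwartz_Cauchy_def by blast+
    have "(\<lambda>n. c * N (\<lambda>z. u0 n z - u n z) * N (v0 n) + c * N (u n) * N (\<lambda>z. v0 n z - v n z))
        \<longlonglongrightarrow> c * 0 * completion_norm N V + c * completion_norm N U * 0"
      by (intro tendsto_intros schwartz_completion_diff[OF N U u0 u] schwartz_completion_diff[OF N V v0 v]
          completion_norm_tendsto[OF N V v0] completion_norm_tendsto[OF N U u])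
    then have lim: "(\<lambda>n. c * N (\<lambda>z. u0 n z - u n z) * N (v0 n) + c * N (u n) * N (\<lambda>z. v0 n z - v n z)) \<longlonglongrightarrow> 0"
      by simp
    have "(\<lambda>n. N' (\<lambda>z. B (u0 n) (v0 n) z - B (u n) (v n) z)) \<longlonglongrightarrow> 0"
    proof (rule tendsto_sandwich[OF _ _ tendsto_const lim])
      show "\<forall>\<^sub>F n in sequentially. 0 \<le> N' (\<lambda>z. B (u0 n) (v0 n) z - B (u n) (v n) z)"
        using S by (intro always_eventually allI schwartz_seminorm_nonneg[OF N'] diff B)
      show "\<forall>\<^sub>F n in sequentially. N' (\<lambda>z. B (u0 n) (v0 n) z - B (u n) (v n) z) \<le>
          c * N (\<lambda>z. u0 n z - u n z) * N (v0 n) + c * N (u n) * N (\<lambda>z. v0 n z - v n z)"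
        using S by (intro always_eventually allI est)
    qed
    then show ?thesis using W(2) Cauchy_B[OF C] by blast
  qed
  have "completion_norm N' W \<le> c * completion_norm N U * completion_norm N V"
  proof (rule tendsto_le[OF sequentially_bot])
    show "(\<lambda>n. c * N (u0 n) * N (v0 n)) \<longlonglongrightarrow> c * completion_norm N U * completion_norm N V"
      by (intro tendsto_intros completion_norm_tendsto[OF N U u0] completion_norm_tendsto[OF N V v0])
    show "(\<lambda>n. N' (B (u0 n) (v0 n))) \<longlonglongrightarrow> completion_norm N' W"
      by (rule completion_norm_tendsto[OF N' W(1) mem[OF u0 v0]])
    show "\<forall>\<^sub>F n in sequentially. N' (B (u0 n) (v0 n)) \<le> c * N (u0 n) * N (v0 n)"
      using C0 unfolding schwartz_Cauchy_def by (intro always_eventually allI bound) blast+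
  qed
  with W(1) mem show ?thesis by blast
qed

section \<open>Weighted norms\<close>

text \<open>Minkowski's inequality from a pointwise Young inequality: the square of
  \<open>p + q\<close> is at most \<open>(1 + b / a) * p^2 + (1 + a / b) * q^2\<close>. Choosing
  \<open>a\<close> and \<open>b\<close> close to the two norms makes the integrated right side close
  to the square of their sum.\<close>

lemma weighted_L2_triangle:
  fixes F G :: "'a \<Rightarrow> complex" and w :: "'a \<Rightarrow> real"
  assumes w: "\<And>x. 0 \<le> w x"
    and F: "integrable M (\<lambda>x. w x * (norm (F x))\<^sup>2)"
    and G: "integrable M (\<lambda>x. w x * (norm (G x))\<^sup>2)"
    and FG: "(\<lambda>x. w x * (norm (F x + G x))\<^sup>2) \<in> borel_measurable M"
  shows "sqrt (\<integral>x. w x * (norm (F x + G x))\<^sup>2 \<partial>M)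
     \<le> sqrt (\<integral>x. w x * (norm (F x))\<^sup>2 \<partial>M) + sqrt (\<integral>x. w x * (norm (G x))\<^sup>2 \<partial>M)"
proof (rule field_le_epsilon)
  fix e :: real assume e: "0 < e"
  define A where "A = sqrt (\<integral>x. w x * (norm (F x))\<^sup>2 \<partial>M)"
  define B where "B = sqrt (\<integral>x. w x * (norm (G x))\<^sup>2 \<partial>M)"
  have IA: "(\<integral>x. w x * (norm (F x))\<^sup>2 \<partial>M) = A\<^sup>2" and IB: "(\<integral>x. w x * (norm (G x))\<^sup>2 \<partial>M) = B\<^sup>2"
    unfolding A_def B_def using w by (simp_all add: integral_nonneg_AE)
  have AB0: "0 \<le> A" "0 \<le> B" unfolding A_def B_def using w by (simp_all add: integral_nonneg_AE)
  \<comment> \<open>Half of \<open>e\<close> is added so that both are positive even when a norm is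
    0.\<close>
  define a b where "a = A + e / 2" and "b = B + e / 2"
  have ab: "0 < a" "0 < b" "A \<le> a" "B \<le> b" using AB0 e by (auto simp: a_def b_def)
  have pt: "w x * (norm (F x + G x))\<^sup>2 \<le> (1 + b / a) * (w x * (norm (F x))\<^sup>2) + (1 + a / b) * (w x * (norm (G x))\<^sup>2)" for x
  proof -
    let ?p = "norm (F x)" and ?q = "norm (G x)"
    have "(norm (F x + G x))\<^sup>2 \<le> (?p + ?q)\<^sup>2" by (intro power_mono norm_triangle_ineq) auto
    also have "... \<le> (1 + b / a) * ?p\<^sup>2 + (1 + a / b) * ?q\<^sup>2"
    proof -
      have "(1 + b / a) * ?p\<^sup>2 + (1 + a / b) * ?q\<^sup>2 - (?p + ?q)\<^sup>2 = (b * ?p - a * ?q)\<^sup>2 / (a * b)"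
        using ab by (simp add: field_simps power2_eq_square)
      moreover have "0 \<le> (b * ?p - a * ?q)\<^sup>2 / (a * b)" using ab by simp
      ultimately show ?thesis by linarith
    qed
    finally have "w x * (norm (F x + G x))\<^sup>2 \<le> w x * ((1 + b / a) * ?p\<^sup>2 + (1 + a / b) * ?q\<^sup>2)"
      using w by (intro mult_left_mono)
    then show ?thesis by (simp add: algebra_simps)
  qed
  have int: "integrable M (\<lambda>x. (1 + b / a) * (w x * (norm (F x))\<^sup>2) + (1 + a / b) * (w x * (norm (G x))\<^sup>2))"
    by (intro Bochner_Integration.integrable_add integrable_mult_right F G)
  have "(\<integral>x. w x * (norm (F x + G x))\<^sup>2 \<partial>M) \<le>
      (\<integral>x. (1 + b / a) * (w x * (norm (F x))\<^sup>2) + (1 + a / b) * (w x * (norm (G x))\<^sup>2) \<partial>M)"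
  proof (rule integral_mono[OF _ int pt])
    show "integrable M (\<lambda>x. w x * (norm (F x + G x))\<^sup>2)"
      by (rule Bochner_Integration.integrable_bound[OF int FG])
         (use w in \<open>auto simp: abs_mult intro: order_trans[OF pt abs_ge_self]\<close>)
  qed
  also have "... = (1 + b / a) * A\<^sup>2 + (1 + a / b) * B\<^sup>2"
    using F G by (simp add: IA[symmetric] IB[symmetric])
  also have "... \<le> (1 + b / a) * a\<^sup>2 + (1 + a / b) * b\<^sup>2"
    using ab AB0 by (intro add_mono mult_left_mono power_mono) auto
  also have "... = (a + b)\<^sup>2" using ab by (simp add: field_simps power2_eq_square)
  finally have "sqrt (\<integral>x. w x * (norm (F x + G x))\<^sup>2 \<partial>M) \<le> a + b"
    using ab by (intro real_le_lsqrt) auto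
  then show "sqrt (\<integral>x. w x * (norm (F x + G x))\<^sup>2 \<partial>M) \<le>
      sqrt (\<integral>x. w x * (norm (F x))\<^sup>2 \<partial>M) + sqrt (\<integral>x. w x * (norm (G x))\<^sup>2 \<partial>M) + e"
    by (simp add: a_def b_def A_def B_def)
qed

text \<open>Polynomial growth is measured against powers of \<open>cauchy_weight\<close>, the scale
  in which \<open>fourier_decay\<close> states the decay of transforms.\<close>

definition moderate_weight :: "(real \<times> real \<Rightarrow> real) \<Rightarrow> bool" where
  "moderate_weight w \<longleftrightarrow> w \<in> borel_measurable borel \<and> (\<forall>\<zeta>. 0 \<le> w \<zeta>) \<and>
     (\<exists>C n. \<forall>\<tau> \<xi>. w (\<tau>, \<xi>) * (cauchy_weight \<tau> * cauchy_weight \<xi>) ^ n \<le> C)"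

definition weighted_norm :: "(real \<times> real \<Rightarrow> real) \<Rightarrow> (real \<times> real \<Rightarrow> complex) \<Rightarrow> real" where
  "weighted_norm w f = sqrt (\<integral>\<zeta>. w \<zeta> * (norm (fourier f \<zeta>))\<^sup>2 \<partial>lborel)"

lemma cauchy_weight_le_1: "cauchy_weight y \<le> 1"
  by (simp add: cauchy_weight_def)

text \<open>The transform decays like the power \<open>n + 1\<close> of the Cauchy weights, its
  square like \<open>2 * n + 2\<close>. Of these, \<open>n\<close> absorb the weight and one of the
  others provides integrability.\<close>

lemma integrable_weighted:
  assumes w: "moderate_weight w" and f: "schwartz f"
  shows "integrable lborel (\<lambda>\<zeta>. w \<zeta> * (norm (fourier f \<zeta>))\<^sup>2)"
proof -
  from w obtain C n where C: "\<And>\<tau> \<xi>. w (\<tau>, \<xi>) * (cauchy_weight \<tau> * cauchy_weight \<xi>) ^ n \<le> C"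
    and w0: "\<And>\<zeta>. 0 \<le> w \<zeta>" and [measurable]: "w \<in> borel_measurable borel"
    unfolding moderate_weight_def by blast
  have [measurable]: "fourier f \<in> borel_measurable borel"
    by (intro fourier_measurable tame_measurable schwartz_imp_tame f)
  obtain D where D: "0 \<le> D" "\<And>\<tau> \<xi>. norm (fourier f (\<tau>, \<xi>)) \<le> D * (cauchy_weight \<tau> ^ (n + 1) * cauchy_weight \<xi> ^ (n + 1))"
    using fourier_decay[OF f, of "n + 1"] by blast
  have bd: "w (\<tau>, \<xi>) * (norm (fourier f (\<tau>, \<xi>)))\<^sup>2 \<le> C * D\<^sup>2 * (cauchy_weight \<tau> * cauchy_weight \<xi>)" for \<tau> \<xi>
  proof -
    let ?c = "cauchy_weight \<tau> * cauchy_weight \<xi>"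
    have c: "0 \<le> ?c" "?c \<le> 1" by (auto simp: less_imp_le intro!: mult_le_one cauchy_weight_le_1)
    have C0: "0 \<le> C" using order_trans[OF mult_nonneg_nonneg[OF w0 zero_le_power[OF c(1)]] C] .
    have "norm (fourier f (\<tau>, \<xi>)) \<le> D * ?c ^ (n + 1)" using D(2) by (simp add: power_mult_distrib mult_ac)
    then have "(norm (fourier f (\<tau>, \<xi>)))\<^sup>2 \<le> (D * ?c ^ (n + 1))\<^sup>2" by (intro power_mono) auto
    also have "... = ?c ^ n * (D\<^sup>2 * ?c ^ (n + 2))"
      by (simp add: power2_eq_square power_add mult_ac)
    finally have "w (\<tau>, \<xi>) * (norm (fourier f (\<tau>, \<xi>)))\<^sup>2 \<le> w (\<tau>, \<xi>) * (?c ^ n * (D\<^sup>2 * ?c ^ (n + 2)))"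
      using w0 by (intro mult_left_mono)
    also have "... = (w (\<tau>, \<xi>) * ?c ^ n) * (D\<^sup>2 * ?c ^ (n + 2))" by simp
    also have "... \<le> C * (D\<^sup>2 * ?c ^ 1)"
    proof (intro mult_mono C mult_left_mono C0)
      show "?c ^ (n + 2) \<le> ?c ^ 1" using c by (intro power_decreasing) auto
    qed (use c in auto)
    finally show ?thesis by (simp add: mult.assoc)
  qed
  show ?thesis
  proof (rule Bochner_Integration.integrable_bound[OF integrable_mult_right[OF integrable_cauchy_weight2, of "C * D\<^sup>2"]])
    show "AE \<zeta> in lborel. norm (w \<zeta> * (norm (fourier f \<zeta>))\<^sup>2)
        \<le> norm (C * D\<^sup>2 * (cauchy_weight (fst \<zeta>) * cauchy_weight (snd \<zeta>)))"
    proof (rule AE_I2)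
      fix \<zeta>
      have "norm (w \<zeta> * (norm (fourier f \<zeta>))\<^sup>2) = w \<zeta> * (norm (fourier f \<zeta>))\<^sup>2"
        using w0[of \<zeta>] by simp
      also have "... \<le> C * D\<^sup>2 * (cauchy_weight (fst \<zeta>) * cauchy_weight (snd \<zeta>))"
        using bd[of "fst \<zeta>" "snd \<zeta>"] by simp
      finally show "norm (w \<zeta> * (norm (fourier f \<zeta>))\<^sup>2)
        \<le> norm (C * D\<^sup>2 * (cauchy_weight (fst \<zeta>) * cauchy_weight (snd \<zeta>)))"
        by (rule order_trans) simp
    qed
  qed measurable
qed

text \<open>Stated through the transforms, so that it applies alike to
  \<open>f = (f - g) + g\<close> and to the telescoping of differences.\<close>

lemma weighted_norm_triangle:
  assumes w: "moderate_weight w" and S: "schwartz f" "schwartz g" "schwartz h"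
    and eq: "\<And>\<zeta>. fourier h \<zeta> = fourier f \<zeta> + fourier g \<zeta>"
  shows "weighted_norm w h \<le> weighted_norm w f + weighted_norm w g"
proof -
  have m: "(\<lambda>\<zeta>. w \<zeta> * (norm (fourier h \<zeta>))\<^sup>2) \<in> borel_measurable lborel"
    using integrable_weighted[OF w S(3)] by (rule borel_measurable_integrable)
  show ?thesis
    using weighted_L2_triangle[OF _ integrable_weighted[OF w S(1)] integrable_weighted[OF w S(2)]] m w
    unfolding weighted_norm_def eq moderate_weight_def by blast
qed

lemma schwartz_seminorm_weighted:
  assumes w: "moderate_weight w"
  shows "schwartz_seminorm (weighted_norm w)"
  unfolding schwartz_seminorm_def
proof (intro conjI allI impI)
  have F: "fourier (\<lambda>z. f z - g z) \<zeta> = fourier f \<zeta> - fourier g \<zeta>" if "schwartz f" "schwartz g" for f g \<zeta>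
    using that by (intro fourier_diff integrable_tame schwartz_imp_tame)
  have w0: "0 \<le> w \<zeta>" for \<zeta> using w unfolding moderate_weight_def by blast
  fix f assume f: "schwartz f"
  show "0 \<le> weighted_norm w f" unfolding weighted_norm_def using w0 by (simp add: integral_nonneg_AE)
  show "weighted_norm w (\<lambda>z. f z - f z) = 0" unfolding weighted_norm_def F[OF f f] by simp
  fix g assume g: "schwartz g"
  show "weighted_norm w (\<lambda>z. f z - g z) = weighted_norm w (\<lambda>z. g z - f z)"
    unfolding weighted_norm_def F[OF f g] F[OF g f] by (simp add: norm_minus_commute)
  show "weighted_norm w f \<le> weighted_norm w (\<lambda>z. f z - g z) + weighted_norm w g"
    by (rule weighted_norm_triangle[OF w schwartz_diff[OF f g] g f]) (simp add: F[OF f g])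
  fix h assume h: "schwartz h"
  show "weighted_norm w (\<lambda>z. f z - h z) \<le> weighted_norm w (\<lambda>z. f z - g z) + weighted_norm w (\<lambda>z. g z - h z)"
    by (rule weighted_norm_triangle[OF w schwartz_diff[OF f g] schwartz_diff[OF g h] schwartz_diff[OF f h]])
       (simp add: F[OF f g] F[OF g h] F[OF f h])
qed

lemma schwartz_seminorm_add:
  assumes "schwartz_seminorm N" "schwartz_seminorm N'"
  shows "schwartz_seminorm (\<lambda>f. N f + N' f)"
  using assms unfolding schwartz_seminorm_def by (auto intro: add_mono simp: add.assoc) (smt (verit, best))+

definition X_weight :: "real \<Rightarrow> real \<Rightarrow> real \<times> real \<Rightarrow> real" where
  "X_weight s b \<zeta> = jbracket (snd \<zeta>) powr (2 * s) * jbracket (modulation \<zeta>) powr (2 * b)"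

definition D_weight :: "real \<Rightarrow> real \<times> real \<Rightarrow> real" where
  "D_weight \<alpha> \<zeta> = jbracket (fst \<zeta>) powr (2 * \<alpha>) * indicator {y. \<bar>y\<bar> \<le> 1} (snd \<zeta>)"

lemma X_norm_weighted: "X_norm s b = weighted_norm (X_weight s b)"
  by (auto simp: X_norm_def weighted_norm_def X_weight_def modulation_def case_prod_unfold)

lemma D_norm_weighted: "D_norm \<alpha> = weighted_norm (D_weight \<alpha>)"
  by (auto simp: D_norm_def weighted_norm_def D_weight_def case_prod_unfold)

lemma X_weight_nonneg [simp]: "0 \<le> X_weight s b \<zeta>"
  and D_weight_nonneg [simp]: "0 \<le> D_weight \<alpha> \<zeta>"
  by (simp_all add: X_weight_def D_weight_def)

lemma X_weight_measurable [measurable]: "X_weight s b \<in> borel_measurable borel"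
  unfolding X_weight_def[abs_def] by measurable

lemma D_weight_measurable [measurable]: "D_weight \<alpha> \<in> borel_measurable borel"
  unfolding D_weight_def[abs_def] by measurable

lemma jbracket_powr_cauchy_weight:
  assumes "p \<le> 2 * real n"
  shows "jbracket y powr p * cauchy_weight y ^ n \<le> 1"
proof -
  have "jbracket y powr p \<le> jbracket y powr (real (2 * n))"
    using assms jbracket_ge_1 by (intro powr_mono) auto
  also have "... = jbracket y ^ (2 * n)" by (rule powr_realpow) simp
  also have "... = (1 + y\<^sup>2) ^ n" by (simp add: power_mult jbracket_square)
  finally have "jbracket y powr p * cauchy_weight y ^ n \<le> (1 + y\<^sup>2) ^ n * cauchy_weight y ^ n"
    by (intro mult_right_mono) (auto simp: less_imp_le)
  also have "... = 1"
    by (simp add: cauchy_weight_def flip: power_mult_distrib) (simp add: less_imp_neq[OF one_plus_square_pos, symmetric])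
  finally show ?thesis .
qed

text \<open>The modulation bracket is at most
  \<open>3 * (jbracket \<tau> * jbracket \<xi> ^ 5)\<close>; its power \<open>2 * n\<close> gives
  \<open>9 ^ n\<close> and the exponent \<open>10 * n\<close> on the frequency bracket. The Sobolev
  weight adds \<open>2 * n\<close>, and the total \<open>12 * n\<close> is what the power
  \<open>6 * n\<close> of the Cauchy weight cancels.\<close>

lemma moderate_X_weight: "moderate_weight (X_weight s b)"
  unfolding moderate_weight_def
proof (intro conjI)
  obtain n :: nat where n: "\<bar>s\<bar> \<le> real n" "\<bar>b\<bar> \<le> real n"
    using real_arch_simple[of "max \<bar>s\<bar> \<bar>b\<bar>"] by auto
  have "X_weight s b (\<tau>, \<xi>) * (cauchy_weight \<tau> * cauchy_weight \<xi>) ^ (6 * n) \<le> 9 ^ n" for \<tau> \<xi>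
  proof -
    have "jbracket (\<tau> - \<xi> ^ 5) \<le> 1 + (\<bar>\<tau>\<bar> + \<bar>\<xi>\<bar> ^ 5)"
      using jbracket_le[of "\<tau> - \<xi> ^ 5"] abs_triangle_ineq4[of \<tau> "\<xi> ^ 5"] by (simp add: power_abs)
    also have "... \<le> 3 * (jbracket \<tau> * jbracket \<xi> ^ 5)"
    proof -
      have a: "1 \<le> jbracket \<tau>" "\<bar>\<tau>\<bar> \<le> jbracket \<tau>" by (rule jbracket_ge_1 abs_le_jbracket)+
      have c: "1 \<le> jbracket \<xi> ^ 5" "\<bar>\<xi>\<bar> ^ 5 \<le> jbracket \<xi> ^ 5"
        using jbracket_ge_1 by (auto intro: power_mono abs_le_jbracket)
      have "jbracket \<tau> * 1 \<le> jbracket \<tau> * jbracket \<xi> ^ 5" "1 * jbracket \<xi> ^ 5 \<le> jbracket \<tau> * jbracket \<xi> ^ 5"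
        using a c by (intro mult_left_mono mult_right_mono; simp add: less_imp_le)+
      then show ?thesis using a c by linarith
    qed
    finally have m: "jbracket (\<tau> - \<xi> ^ 5) \<le> 3 * (jbracket \<tau> * jbracket \<xi> ^ 5)" .
    have "jbracket (\<tau> - \<xi> ^ 5) powr (2 * b) \<le> jbracket (\<tau> - \<xi> ^ 5) powr (real (2 * n))"
      using n jbracket_ge_1 by (intro powr_mono) auto
    also have "... = jbracket (\<tau> - \<xi> ^ 5) ^ (2 * n)" by (rule powr_realpow) simp
    also have "... \<le> (3 * (jbracket \<tau> * jbracket \<xi> ^ 5)) ^ (2 * n)"
      using m by (intro power_mono) (auto simp: less_imp_le)
    also have "... = 9 ^ n * (jbracket \<tau> powr (2 * real n) * jbracket \<xi> powr (10 * real n))"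
    proof -
      have "jbracket \<tau> powr (2 * real n) = jbracket \<tau> ^ (2 * n)"
        using powr_realpow[of "jbracket \<tau>" "2 * n"] by simp
      moreover have "jbracket \<xi> powr (10 * real n) = jbracket \<xi> ^ (5 * (2 * n))"
        using powr_realpow[of "jbracket \<xi>" "5 * (2 * n)"] by simp
      moreover have "(3::real) ^ (2 * n) = 9 ^ n" by (simp add: power_mult)
      ultimately show ?thesis by (simp add: power_mult_distrib power_mult)
    qed
    finally have m2: "jbracket (\<tau> - \<xi> ^ 5) powr (2 * b) \<le> 9 ^ n * (jbracket \<tau> powr (2 * real n) * jbracket \<xi> powr (10 * real n))" .
    have "jbracket \<xi> powr (2 * s) \<le> jbracket \<xi> powr (2 * real n)"
      using n jbracket_ge_1 by (intro powr_mono) auto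
    then have "X_weight s b (\<tau>, \<xi>) \<le> jbracket \<xi> powr (2 * real n) * (9 ^ n * (jbracket \<tau> powr (2 * real n) * jbracket \<xi> powr (10 * real n)))"
      unfolding X_weight_def modulation_def using m2 by (auto intro!: mult_mono)
    also have "... = 9 ^ n * (jbracket \<tau> powr (2 * real n) * jbracket \<xi> powr (12 * real n))"
      by (simp add: powr_add[symmetric] mult_ac)
    finally have "X_weight s b (\<tau>, \<xi>) * (cauchy_weight \<tau> * cauchy_weight \<xi>) ^ (6 * n) \<le>
        9 ^ n * (jbracket \<tau> powr (2 * real n) * jbracket \<xi> powr (12 * real n)) * (cauchy_weight \<tau> * cauchy_weight \<xi>) ^ (6 * n)"
      by (intro mult_right_mono) (auto simp: less_imp_le)
    also have "... = 9 ^ n * ((jbracket \<tau> powr (2 * real n) * cauchy_weight \<tau> ^ (6 * n)) * (jbracket \<xi> powr (12 * real n) * cauchy_weight \<xi> ^ (6 * n)))"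
      by (simp add: power_mult_distrib mult_ac)
    also have "... \<le> 9 ^ n * 1"
      by (intro mult_left_mono mult_le_one jbracket_powr_cauchy_weight) (auto simp: less_imp_le)
    finally show ?thesis by simp
  qed
  then show "\<exists>C n. \<forall>\<tau> \<xi>. X_weight s b (\<tau>, \<xi>) * (cauchy_weight \<tau> * cauchy_weight \<xi>) ^ n \<le> C" by blast
qed auto

lemma moderate_D_weight: "moderate_weight (D_weight \<alpha>)"
  unfolding moderate_weight_def
proof (intro conjI)
  obtain n :: nat where n: "\<bar>\<alpha>\<bar> \<le> real n" using real_arch_simple by blast
  have "D_weight \<alpha> (\<tau>, \<xi>) * (cauchy_weight \<tau> * cauchy_weight \<xi>) ^ n \<le> 1" for \<tau> \<xi>
  proof -
    have "D_weight \<alpha> (\<tau>, \<xi>) * (cauchy_weight \<tau> * cauchy_weight \<xi>) ^ n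
      \<le> (jbracket \<tau> powr (2 * \<alpha>) * 1) * (cauchy_weight \<tau> ^ n * 1)"
      unfolding D_weight_def power_mult_distrib
      by (intro mult_mono mult_left_mono power_le_one cauchy_weight_le_1) (auto simp: less_imp_le indicator_def)
    also have "... \<le> 1" using n jbracket_powr_cauchy_weight[of "2 * \<alpha>" n \<tau>] by simp
    finally show ?thesis .
  qed
  then show "\<exists>C n. \<forall>\<tau> \<xi>. D_weight \<alpha> (\<tau>, \<xi>) * (cauchy_weight \<tau> * cauchy_weight \<xi>) ^ n \<le> C" by blast
qed auto

section \<open>Trilinear forms\<close>

lemma nn_integral_lborel_reflect:
  fixes f :: "real \<times> real \<Rightarrow> ennreal"
  assumes [measurable]: "f \<in> borel_measurable borel"
  shows "(\<integral>\<^sup>+z. f (t - z) \<partial>lborel) = (\<integral>\<^sup>+z. f z \<partial>lborel)"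
proof -
  have "(\<integral>\<^sup>+z. f z \<partial>lborel) =
      (\<integral>\<^sup>+z. f z \<partial>density (distr lborel borel (\<lambda>x. t + (-1) *\<^sub>R x)) (\<lambda>_. ennreal (\<bar>-1\<bar> ^ DIM(real \<times> real))))"
    using lborel_affine[of "-1" t] by simp
  also have "... = (\<integral>\<^sup>+z. f (t - z) \<partial>lborel)"
    by (simp add: density_1 nn_integral_distr)
  finally show ?thesis ..
qed

text \<open>Cauchy-Schwarz is used twice: in \<open>y\<close> for frozen \<open>x\<close>, where the
  kernel contributes \<open>C\<close>, and then in \<open>x\<close>. The remaining double integral
  of the squares of \<open>G\<close> and \<open>H\<close> factors because the measure is invariant
  under translation and reflection.\<close>

lemma trilinear_schur:
  fixes \<kappa> :: "real \<times> real \<Rightarrow> real \<times> real \<Rightarrow> ennreal" and F G H :: "real \<times> real \<Rightarrow> ennreal"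
  assumes [measurable]: "(\<lambda>(x, y). \<kappa> x y) \<in> borel_measurable (borel \<Otimes>\<^sub>M borel)"
      "F \<in> borel_measurable borel" "G \<in> borel_measurable borel" "H \<in> borel_measurable borel"
    and C: "\<And>x. (\<integral>\<^sup>+y. (\<kappa> x y)\<^sup>2 \<partial>lborel) \<le> C"
  shows "(\<integral>\<^sup>+x. \<integral>\<^sup>+y. \<kappa> x y * (F x * G y * H (- x - y)) \<partial>lborel \<partial>lborel)\<^sup>2
    \<le> C * ((\<integral>\<^sup>+x. (F x)\<^sup>2 \<partial>lborel) * (\<integral>\<^sup>+x. (G x)\<^sup>2 \<partial>lborel) * (\<integral>\<^sup>+x. (H x)\<^sup>2 \<partial>lborel))"
proof -
  let ?F = "\<integral>\<^sup>+x. (F x)\<^sup>2 \<partial>lborel" and ?G = "\<integral>\<^sup>+x. (G x)\<^sup>2 \<partial>lborel"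
    and ?H = "\<integral>\<^sup>+x. (H x)\<^sup>2 \<partial>lborel"
  define I where "I x = (\<integral>\<^sup>+y. \<kappa> x y * (G y * H (- x - y)) \<partial>lborel)" for x
  have [measurable]: "I \<in> borel_measurable borel" unfolding I_def by measurable
  have I2: "(I x)\<^sup>2 \<le> C * (\<integral>\<^sup>+y. (G y)\<^sup>2 * (H (- x - y))\<^sup>2 \<partial>lborel)" for x
  proof -
    have "(I x)\<^sup>2 \<le> (\<integral>\<^sup>+y. (\<kappa> x y)\<^sup>2 \<partial>lborel) * (\<integral>\<^sup>+y. (G y * H (- x - y))\<^sup>2 \<partial>lborel)"
      unfolding I_def by (rule Cauchy_Schwarz_nn_integral) measurable
    also have "... \<le> C * (\<integral>\<^sup>+y. (G y * H (- x - y))\<^sup>2 \<partial>lborel)"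
      by (intro mult_right_mono C) auto
    finally show ?thesis by (simp add: power_mult_distrib)
  qed
  have FI: "(\<integral>\<^sup>+x. \<integral>\<^sup>+y. \<kappa> x y * (F x * G y * H (- x - y)) \<partial>lborel \<partial>lborel) = (\<integral>\<^sup>+x. F x * I x \<partial>lborel)"
    unfolding I_def by (subst nn_integral_cmult[symmetric]) (auto simp: mult_ac)
  have "(\<integral>\<^sup>+x. (I x)\<^sup>2 \<partial>lborel) \<le> (\<integral>\<^sup>+x. C * (\<integral>\<^sup>+y. (G y)\<^sup>2 * (H (- x - y))\<^sup>2 \<partial>lborel) \<partial>lborel)"
    by (intro nn_integral_mono I2)
  also have "... = C * (\<integral>\<^sup>+x. \<integral>\<^sup>+y. (G y)\<^sup>2 * (H (- x - y))\<^sup>2 \<partial>lborel \<partial>lborel)"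
    by (rule nn_integral_cmult) measurable
  also have "(\<integral>\<^sup>+x. \<integral>\<^sup>+y. (G y)\<^sup>2 * (H (- x - y))\<^sup>2 \<partial>lborel \<partial>lborel)
      = (\<integral>\<^sup>+y. \<integral>\<^sup>+x. (G y)\<^sup>2 * (H (- x - y))\<^sup>2 \<partial>lborel \<partial>lborel)"
    by (intro lborel_pair.Fubini'[symmetric]) measurable
  also have "... = (\<integral>\<^sup>+y. (G y)\<^sup>2 * (\<integral>\<^sup>+x. (H (- y - x))\<^sup>2 \<partial>lborel) \<partial>lborel)"
  proof (intro nn_integral_cong)
    fix y :: "real \<times> real"
    have e: "- x - y = - y - x" for x by (rule minus_diff_commute)
    show "(\<integral>\<^sup>+x. (G y)\<^sup>2 * (H (- x - y))\<^sup>2 \<partial>lborel) = (G y)\<^sup>2 * (\<integral>\<^sup>+x. (H (- y - x))\<^sup>2 \<partial>lborel)"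
      unfolding e by (rule nn_integral_cmult) measurable
  qed
  also have "... = (\<integral>\<^sup>+y. (G y)\<^sup>2 * ?H \<partial>lborel)"
    using nn_integral_lborel_reflect[of "\<lambda>x. (H x)\<^sup>2"] by simp
  also have "... = ?G * ?H"
    by (rule nn_integral_multc) measurable
  finally have I: "(\<integral>\<^sup>+x. (I x)\<^sup>2 \<partial>lborel) \<le> C * (?G * ?H)" .
  have "(\<integral>\<^sup>+x. F x * I x \<partial>lborel)\<^sup>2 \<le> ?F * (\<integral>\<^sup>+x. (I x)\<^sup>2 \<partial>lborel)"
    by (rule Cauchy_Schwarz_nn_integral) auto
  also have "... \<le> ?F * (C * (?G * ?H))"
    by (intro mult_left_mono I) auto
  finally show ?thesis unfolding FI by (simp only: mult_ac)
qed

lemma trilinear_swap: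
  fixes f :: "real \<times> real \<Rightarrow> real \<times> real \<Rightarrow> ennreal"
  assumes [measurable]: "(\<lambda>(x, y). f x y) \<in> borel_measurable (borel \<Otimes>\<^sub>M borel)"
  shows "(\<integral>\<^sup>+x. \<integral>\<^sup>+y. f x y \<partial>lborel \<partial>lborel) = (\<integral>\<^sup>+y. \<integral>\<^sup>+x. f x y \<partial>lborel \<partial>lborel)"
  by (intro lborel_pair.Fubini'[symmetric]) measurable

lemma trilinear_rotate:
  fixes f :: "real \<times> real \<Rightarrow> real \<times> real \<Rightarrow> ennreal"
  assumes [measurable]: "(\<lambda>(x, y). f x y) \<in> borel_measurable (borel \<Otimes>\<^sub>M borel)"
  shows "(\<integral>\<^sup>+x. \<integral>\<^sup>+y. f x y \<partial>lborel \<partial>lborel) = (\<integral>\<^sup>+z. \<integral>\<^sup>+x. f x (- z - x) \<partial>lborel \<partial>lborel)"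
proof -
  have "(\<integral>\<^sup>+x. \<integral>\<^sup>+y. f x y \<partial>lborel \<partial>lborel) = (\<integral>\<^sup>+x. \<integral>\<^sup>+z. f x (- x - z) \<partial>lborel \<partial>lborel)"
    by (intro nn_integral_cong nn_integral_lborel_reflect[symmetric]) measurable
  also have "... = (\<integral>\<^sup>+z. \<integral>\<^sup>+x. f x (- x - z) \<partial>lborel \<partial>lborel)"
    by (rule trilinear_swap) measurable
  also have "... = (\<integral>\<^sup>+z. \<integral>\<^sup>+x. f x (- z - x) \<partial>lborel \<partial>lborel)"
    by (intro nn_integral_cong) (simp only: minus_diff_commute)
  finally show ?thesis .
qed

lemma ennreal_square_mono: "x \<le> y \<Longrightarrow> x\<^sup>2 \<le> (y::ennreal)\<^sup>2"
  by (intro power_mono) auto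

text \<open>Comparing with three times the maximum needs no subtraction and so also works for
  infinite values.\<close>

lemma ennreal_square_sum3: "(a + b + c :: ennreal)\<^sup>2 \<le> 9 * (a\<^sup>2 + b\<^sup>2 + c\<^sup>2)"
proof -
  have "a + b + c \<le> 3 * max a (max b c)"
  proof -
    have "a + b + c \<le> max a (max b c) + max a (max b c) + max a (max b c)" by (intro add_mono) (auto simp: le_max_iff_disj)
    also have "... = (1 + 1 + 1) * max a (max b c)" by (simp only: distrib_right mult_1)
    also have "1 + 1 + 1 = (3 :: ennreal)" by simp
    finally show ?thesis .
  qed
  then have "(a + b + c)\<^sup>2 \<le> (3 * max a (max b c))\<^sup>2" by (rule ennreal_square_mono)
  also have "... = 9 * (max a (max b c))\<^sup>2" by (simp add: power_mult_distrib)
  also have "(max a (max b c))\<^sup>2 \<le> a\<^sup>2 + b\<^sup>2 + c\<^sup>2"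
    by (auto simp: max_def intro: add_increasing add_increasing2)
  finally show ?thesis by (simp add: mult_left_mono)
qed

text \<open>The square root of a sum is at most the sum of the square roots, so \<open>K\<close>
  splits into three kernels. After renaming variables each is an instance of
  \<open>trilinear_schur\<close> with a different frozen point. The 27 is 9 from squaring a sum of
  three terms, times the 3 equal bounds.\<close>

lemma trilinear_schur_kernel:
  fixes F G H :: "real \<times> real \<Rightarrow> ennreal" and K :: "real \<times> real \<Rightarrow> real \<times> real \<Rightarrow> real"
  assumes \<theta>: "1 < \<theta>" and A: "0 \<le> A"
    and [measurable]: "F \<in> borel_measurable borel" "G \<in> borel_measurable borel" "H \<in> borel_measurable borel"
    and K: "\<And>x y. 0 \<le> K x y"
      "\<And>x y. (K x y)\<^sup>2 \<le> A * (schur_kernel \<theta> x y (- x - y) + schur_kernel \<theta> y x (- x - y)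
         + schur_kernel \<theta> (- x - y) x y)"
  shows "(\<integral>\<^sup>+x. \<integral>\<^sup>+y. ennreal (K x y) * (F x * G y * H (- x - y)) \<partial>lborel \<partial>lborel)\<^sup>2
    \<le> 27 * ennreal (A * schur_const \<theta>) *
       ((\<integral>\<^sup>+x. (F x)\<^sup>2 \<partial>lborel) * (\<integral>\<^sup>+x. (G x)\<^sup>2 \<partial>lborel) * (\<integral>\<^sup>+x. (H x)\<^sup>2 \<partial>lborel))"
proof -
  let ?F = "\<integral>\<^sup>+x. (F x)\<^sup>2 \<partial>lborel" and ?G = "\<integral>\<^sup>+x. (G x)\<^sup>2 \<partial>lborel"
    and ?H = "\<integral>\<^sup>+x. (H x)\<^sup>2 \<partial>lborel"
  let ?J = "\<integral>\<^sup>+x. \<integral>\<^sup>+y. ennreal (K x y) * (F x * G y * H (- x - y)) \<partial>lborel \<partial>lborel"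
  let ?N = "?F * ?G * ?H"
  define k where "k a b c = ennreal (sqrt (A * schur_kernel \<theta> a b c))" for a b c
  define C where "C = ennreal (A * schur_const \<theta>)"
  have [measurable]: "(\<lambda>x. k (f x) (g x) (h x)) \<in> borel_measurable M"
    if [measurable]: "f \<in> measurable M borel" "g \<in> measurable M borel" "h \<in> measurable M borel"
    for f g h and M :: "'z measure"
    unfolding k_def by measurable
  have sc: "schur_kernel \<theta> a b c = schur_kernel \<theta> a c b" for a b c
    by (simp add: schur_kernel_def freq_kernel_commute[of _ "snd b"] mult.commute)
  have kc: "k a b c = k a c b" for a b c by (simp add: k_def sc[of a b c])
  let ?I1 = "\<integral>\<^sup>+x. \<integral>\<^sup>+y. k x y (- x - y) * (F x * G y * H (- x - y)) \<partial>lborel \<partial>lborel"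
  let ?I2 = "\<integral>\<^sup>+x. \<integral>\<^sup>+y. k y x (- x - y) * (F x * G y * H (- x - y)) \<partial>lborel \<partial>lborel"
  let ?I3 = "\<integral>\<^sup>+x. \<integral>\<^sup>+y. k (- x - y) x y * (F x * G y * H (- x - y)) \<partial>lborel \<partial>lborel"
  have k2: "(\<integral>\<^sup>+y. (k x y (- x - y))\<^sup>2 \<partial>lborel) \<le> C" for x
  proof -
    have "(\<integral>\<^sup>+y. (k x y (- x - y))\<^sup>2 \<partial>lborel) = (\<integral>\<^sup>+y. ennreal A * ennreal (schur_kernel \<theta> x y (- x - y)) \<partial>lborel)"
      unfolding k_def using A by (simp add: ennreal_power ennreal_mult)
    also have "... = ennreal A * (\<integral>\<^sup>+y. ennreal (schur_kernel \<theta> x y (- x - y)) \<partial>lborel)"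
      by (rule nn_integral_cmult) measurable
    also have "... \<le> ennreal A * ennreal (schur_const \<theta>)"
      by (intro mult_left_mono schur_kernel_integral \<theta>) auto
    also have "... = C" unfolding C_def using A by (simp add: ennreal_mult')
    finally show ?thesis .
  qed
  have T1: "?I1\<^sup>2 \<le> C * ?N"
    by (rule trilinear_schur[OF _ _ _ _ k2]) measurable
  have T2: "?I2\<^sup>2 \<le> C * ?N"
  proof -
    have "?I2
      = (\<integral>\<^sup>+y. \<integral>\<^sup>+x. k y x (- x - y) * (F x * G y * H (- x - y)) \<partial>lborel \<partial>lborel)"
      by (rule trilinear_swap) measurable
    also have "... = (\<integral>\<^sup>+y. \<integral>\<^sup>+x. k y x (- y - x) * (G y * F x * H (- y - x)) \<partial>lborel \<partial>lborel)"
    proof (intro nn_integral_cong)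
      fix x y :: "real \<times> real"
      have "- x - y = - y - x" by (rule minus_diff_commute)
      then show "k y x (- x - y) * (F x * G y * H (- x - y)) = k y x (- y - x) * (G y * F x * H (- y - x))"
        by (simp only: mult.commute[of "F x" "G y"])
    qed
    also have "...\<^sup>2 \<le> C * (?G * ?F * ?H)"
      by (rule trilinear_schur[OF _ _ _ _ k2]) measurable
    finally show ?thesis by (simp only: mult_ac)
  qed
  have T3: "?I3\<^sup>2 \<le> C * ?N"
  proof -
    have "?I3
      = (\<integral>\<^sup>+z. \<integral>\<^sup>+x. k (- x - (- z - x)) x (- z - x) * (F x * G (- z - x) * H (- x - (- z - x))) \<partial>lborel \<partial>lborel)"
      by (rule trilinear_rotate) measurable
    also have "... = (\<integral>\<^sup>+z. \<integral>\<^sup>+x. k z x (- z - x) * (H z * F x * G (- z - x)) \<partial>lborel \<partial>lborel)"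
      by (simp add: mult_ac)
    also have "...\<^sup>2 \<le> C * (?H * ?F * ?G)"
      by (rule trilinear_schur[OF _ _ _ _ k2]) measurable
    finally show ?thesis by (simp only: mult_ac)
  qed
  have Kk: "ennreal (K x y) \<le> k x y (- x - y) + k y x (- x - y) + k (- x - y) x y" for x y
  proof -
    let ?a = "A * schur_kernel \<theta> x y (- x - y)" and ?b = "A * schur_kernel \<theta> y x (- x - y)"
      and ?c = "A * schur_kernel \<theta> (- x - y) x y"
    have nn: "0 \<le> ?a" "0 \<le> ?b" "0 \<le> ?c" using A by auto
    have "K x y \<le> sqrt (?a + ?b + ?c)"
      using K(2)[of x y] by (intro real_le_rsqrt) (simp add: distrib_left)
    also have "... \<le> sqrt ?a + sqrt ?b + sqrt ?c"
      using nn by (intro order_trans[OF sqrt_add_le_add_sqrt] add_mono) auto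
    finally have "ennreal (K x y) \<le> ennreal (sqrt ?a + sqrt ?b + sqrt ?c)" by (rule ennreal_leI)
    also have "... = k x y (- x - y) + k y x (- x - y) + k (- x - y) x y"
      unfolding k_def using nn by simp
    finally show ?thesis .
  qed
  have "?J
     \<le> (\<integral>\<^sup>+x. \<integral>\<^sup>+y. (k x y (- x - y) + k y x (- x - y) + k (- x - y) x y) * (F x * G y * H (- x - y)) \<partial>lborel \<partial>lborel)"
    by (intro nn_integral_mono mult_right_mono Kk) auto
  also have "... = ?I1
     + ?I2
     + ?I3"
    by (simp add: distrib_right nn_integral_add)
  finally have "?J\<^sup>2
     \<le> (?I1
     + ?I2
     + ?I3)\<^sup>2"
    by (rule ennreal_square_mono)
  also have "... \<le> 9 * (?I1\<^sup>2
     + ?I2\<^sup>2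
     + ?I3\<^sup>2)"
    by (rule ennreal_square_sum3)
  also have "... \<le> 9 * (C * ?N + C * ?N + C * ?N)"
    by (intro mult_left_mono add_mono T1 T2 T3) auto
  also have "... = 27 * C * ?N"
  proof -
    have "X + X + X = 3 * X" for X :: ennreal
      using distrib_right[of 1 2 X] by (simp add: mult_2 add.assoc)
    then have "9 * (C * ?N + C * ?N + C * ?N) = (9 * 3) * (C * ?N)" by (simp only: mult.assoc)
    then show ?thesis by (simp add: mult.assoc)
  qed
  finally show ?thesis unfolding C_def .
qed

text \<open>Testing against truncations of \<open>T\<close> itself.\<close>

lemma nn_integral_duality:
  fixes T :: "'a::euclidean_space \<Rightarrow> ennreal"
  assumes [measurable]: "T \<in> borel_measurable borel"
    and bound: "\<And>H. H \<in> borel_measurable borel \<Longrightarrow>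
      (\<integral>\<^sup>+x. H x * T x \<partial>lborel)\<^sup>2 \<le> C * (\<integral>\<^sup>+x. (H x)\<^sup>2 \<partial>lborel)"
  shows "(\<integral>\<^sup>+x. (T x)\<^sup>2 \<partial>lborel) \<le> C"
proof -
  \<comment> \<open>Cutting off both the value and the support makes the integral of the square
    finite, so that it can be cancelled from both sides of the tested inequality.\<close>
  define h where "h n x = min (T x) (of_nat n) * indicator (cball 0 (real n)) x" for n :: nat and x
  have [measurable]: "cball (0::'a) r \<in> sets borel" for r by simp
  have [measurable]: "h n \<in> borel_measurable borel" for n
    unfolding h_def by measurable
  have le: "(\<integral>\<^sup>+x. (h n x)\<^sup>2 \<partial>lborel) \<le> C" for n
  proof -
    let ?x = "\<integral>\<^sup>+x. (h n x)\<^sup>2 \<partial>lborel"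
    have "?x \<le> (\<integral>\<^sup>+x. (of_nat n)\<^sup>2 * indicator (cball 0 (real n)) x \<partial>(lborel :: 'a measure))"
      by (intro nn_integral_mono) (auto simp: h_def indicator_def intro!: ennreal_square_mono)
    also have "... = (of_nat n)\<^sup>2 * emeasure lborel (cball (0::'a) (real n))"
      by (rule nn_integral_cmult_indicator) simp
    also have "... < \<top>"
      using emeasure_bounded_finite[of "cball (0::'a) (real n)"]
      by (auto simp: ennreal_mult_less_top power2_eq_square of_nat_less_top)
    finally have fin: "?x < \<top>" .
    have "?x \<le> (\<integral>\<^sup>+x. h n x * T x \<partial>lborel)"
      unfolding power2_eq_square by (intro nn_integral_mono mult_left_mono) (auto simp: h_def indicator_def)
    then have "?x\<^sup>2 \<le> (\<integral>\<^sup>+x. h n x * T x \<partial>lborel)\<^sup>2" by (rule ennreal_square_mono)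
    also have "... \<le> C * ?x" by (rule bound) simp
    finally have sq: "?x * ?x \<le> C * ?x" by (simp add: power2_eq_square)
    show ?thesis
    proof (cases "?x = 0")
      case False
      with sq fin show ?thesis
        using ennreal_mult_le_mult_iff[of ?x ?x C] by (auto simp: mult.commute)
    qed simp
  qed
  have "(\<integral>\<^sup>+x. (T x)\<^sup>2 \<partial>lborel) = (\<integral>\<^sup>+x. (SUP n. (h n x)\<^sup>2) \<partial>lborel)"
  proof (intro nn_integral_cong)
    fix x :: 'a
    obtain m :: nat where m: "norm x \<le> real m" using real_arch_simple by blast
    show "(T x)\<^sup>2 = (SUP n. (h n x)\<^sup>2)"
    proof (rule antisym)
      show "(SUP n. (h n x)\<^sup>2) \<le> (T x)\<^sup>2"
        by (intro SUP_least ennreal_square_mono) (auto simp: h_def indicator_def)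
      show "(T x)\<^sup>2 \<le> (SUP n. (h n x)\<^sup>2)"
      proof (cases "T x = \<top>")
        case True
        have "\<top> = (SUP k. of_nat k :: ennreal)" by (rule ennreal_SUP_of_nat_eq_top[symmetric])
        also have "... \<le> (SUP n. (h n x)\<^sup>2)"
        proof (rule SUP_mono)
          fix k :: nat
          \<comment> \<open>Where \<open>T\<close> is infinite, the truncation at a level at least
            \<open>m\<close> equals that level, and the square of a level at least \<open>k\<close>
            is at least \<open>k\<close>.\<close>
          have "k \<le> max k m * max k m" using le_square[of "max k m"] by (rule order_trans[rotated]) simp
          then have "real k \<le> (real (max k m))\<^sup>2"
            unfolding power2_eq_square of_nat_mult[symmetric] of_nat_le_iff .
          then have "ennreal (real k) \<le> ennreal ((real (max k m))\<^sup>2)" by (rule ennreal_leI)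
          also have "... = (ennreal (real (max k m)))\<^sup>2" by (rule ennreal_power[symmetric]) simp
          finally have "of_nat k \<le> (of_nat (max k m) :: ennreal)\<^sup>2"
            unfolding ennreal_of_nat_eq_real_of_nat .
          also have "of_nat (max k m) = h (max k m) x" using m True by (auto simp: h_def indicator_def)
          finally show "\<exists>n\<in>UNIV. of_nat k \<le> (h n x)\<^sup>2" by blast
        qed
        finally show ?thesis by (rule order_trans[OF top_greatest])
      next
        case False
        then obtain l :: nat where "T x < of_nat l" using ennreal_Ex_less_of_nat by (auto simp: less_top)
        then have "T x \<le> of_nat (max l m)" by (auto simp: max_def intro: order_trans less_imp_le)
        then have "h (max l m) x = T x" using m by (auto simp: h_def indicator_def min_def)
        then show ?thesis by (intro SUP_upper2[of "max l m"]) auto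
      qed
    qed
  qed
  also have "... = (SUP n. \<integral>\<^sup>+x. (h n x)\<^sup>2 \<partial>lborel)"
    by (intro nn_integral_monotone_convergence_SUP)
       (auto simp: incseq_def le_fun_def h_def indicator_def intro!: ennreal_square_mono mult_mono min.mono)
  also have "... \<le> C" by (intro SUP_least le)
  finally show ?thesis .
qed

section \<open>The bilinear estimate\<close>

lemma modulation_minus: "modulation (- z) = - modulation z"
  by (simp add: modulation_def)

lemma X_weight_minus: "X_weight s b (- z) = X_weight s b z"
  by (simp add: X_weight_def modulation_minus)

lemma X_weight_pos: "0 < X_weight s b z"
  by (simp add: X_weight_def less_imp_neq[OF jbracket_pos, symmetric])

lemma resonance_identity:
  fixes a b c :: real
  assumes "a + b + c = 0"
  shows "2 * (a ^ 5 + b ^ 5 + c ^ 5) = 5 * (a * b * c * (a\<^sup>2 + b\<^sup>2 + c\<^sup>2))"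
proof -
  have c: "c = - (a + b)" using assms by linarith
  show ?thesis unfolding c by (simp add: power2_eq_square eval_nat_numeral algebra_simps)
qed

text \<open>The time frequencies cancel in the sum of the modulations; the factor 5/2 of the
  resonance identity exceeds 1 and is dropped.\<close>

lemma resonance_le_modulations:
  assumes "x + y + z = 0"
  shows "\<bar>snd x * snd y * snd z\<bar> * ((snd x)\<^sup>2 + (snd y)\<^sup>2 + (snd z)\<^sup>2)
     \<le> jbracket (modulation x) + jbracket (modulation y) + jbracket (modulation z)"
proof -
  have sum: "fst x + fst y + fst z = 0" "snd x + snd y + snd z = 0"
    using arg_cong[OF assms, of fst] arg_cong[OF assms, of snd] by simp_all
  let ?R = "snd x * snd y * snd z * ((snd x)\<^sup>2 + (snd y)\<^sup>2 + (snd z)\<^sup>2)"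
  have "modulation x + modulation y + modulation z = - (snd x ^ 5 + snd y ^ 5 + snd z ^ 5)"
    unfolding modulation_def using sum(1) by linarith
  moreover have "\<bar>R\<bar> \<le> \<bar>a\<bar> + \<bar>b\<bar> + \<bar>c\<bar>"
    if "2 * S = 5 * R" "a + b + c = - S" for a b c R S :: real
    using that by linarith
  ultimately have "\<bar>?R\<bar> \<le> \<bar>modulation x\<bar> + \<bar>modulation y\<bar> + \<bar>modulation z\<bar>"
    using resonance_identity[OF sum(2)] by blast
  also have "... \<le> jbracket (modulation x) + jbracket (modulation y) + jbracket (modulation z)"
    by (intro add_mono abs_le_jbracket)
  finally show ?thesis by (simp add: abs_mult)
qed

text \<open>One weight for the intersection: its squared norm is the sum of the two squared norms
  and hence at most the square of \<open>XD_norm\<close>.\<close>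

definition XD_weight :: "real \<Rightarrow> real \<Rightarrow> real \<Rightarrow> real \<times> real \<Rightarrow> real" where
  "XD_weight s b \<alpha> z = X_weight s b z + D_weight \<alpha> z"

lemma XD_weight_pos: "0 < XD_weight s b \<alpha> z"
  unfolding XD_weight_def by (intro add_pos_nonneg X_weight_pos) simp

lemma XD_weight_measurable [measurable]: "XD_weight s b \<alpha> \<in> borel_measurable borel"
  unfolding XD_weight_def[abs_def] by measurable

text \<open>For \<open>\<bar>\<xi>\<bar> > 1\<close> the weight of \<open>X_norm\<close> alone is
  used. For \<open>\<bar>\<xi>\<bar> \<le> 1\<close> the modulation bracket is at most 4 times the
  bracket of \<tau>, so the weight of \<open>D_norm\<close> dominates its power \<theta> up to
  \<open>4 powr \<theta>\<close>. The frequency bracket then lies between 1 and 2, whence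
  \<open>2 powr (2 * \<bar>s\<bar>)\<close>.\<close>

lemma inverse_XD_weight_le:
  assumes \<theta>: "0 \<le> \<theta>" "\<theta> \<le> 2 * \<alpha>"
  shows "1 / XD_weight s b \<alpha> z \<le> 4 powr \<theta> * 2 powr (2 * \<bar>s\<bar>) *
     (jbracket (snd z) powr (- 2 * s) * input_decay \<theta> b (snd z) (jbracket (modulation z)))"
proof (cases "\<bar>snd z\<bar> \<le> 1")
  case False
  have "1 / XD_weight s b \<alpha> z \<le> 1 / X_weight s b z"
    by (intro divide_left_mono mult_pos_pos XD_weight_pos X_weight_pos) (auto simp: XD_weight_def)
  also have "... = 1 * 1 * (jbracket (snd z) powr (- 2 * s) * jbracket (modulation z) powr (- (2 * b)))"
    by (simp add: X_weight_def powr_minus_divide)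
  also have "... \<le> 4 powr \<theta> * 2 powr (2 * \<bar>s\<bar>) * (jbracket (snd z) powr (- 2 * s) * jbracket (modulation z) powr (- (2 * b)))"
    using \<theta> by (intro mult_right_mono mult_mono ge_one_powr_ge_zero) auto
  finally show ?thesis using False by (simp add: input_decay_def)
next
  case True
  have k5: "\<bar>snd z ^ 5\<bar> \<le> 1" unfolding power_abs by (rule power_le_one) (use True in auto)
  have "jbracket (modulation z) \<le> 2 * jbracket (fst z) * jbracket (- (snd z ^ 5))"
    using jbracket_add_mult[of "fst z" "- (snd z ^ 5)"] by (simp add: modulation_def)
  also have "... \<le> 2 * jbracket (fst z) * 2"
    using jbracket_le[of "- (snd z ^ 5)"] k5 by (intro mult_left_mono) (auto simp: less_imp_le)
  finally have L: "jbracket (modulation z) / 4 \<le> jbracket (fst z)" by simp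
  have "(jbracket (modulation z) / 4) powr \<theta> \<le> jbracket (fst z) powr \<theta>"
    using L \<theta> by (intro powr_mono2) (auto simp: less_imp_le)
  also have "... \<le> jbracket (fst z) powr (2 * \<alpha>)" using \<theta> jbracket_ge_1 by (intro powr_mono) auto
  also have "... \<le> XD_weight s b \<alpha> z" using True by (simp add: XD_weight_def D_weight_def)
  finally have "1 / XD_weight s b \<alpha> z \<le> 1 / (jbracket (modulation z) / 4) powr \<theta>"
    by (intro divide_left_mono mult_pos_pos XD_weight_pos)
       (auto simp: less_imp_neq[OF jbracket_pos, symmetric])
  also have "... = 4 powr \<theta> * (1 * jbracket (modulation z) powr (- \<theta>))"
    by (simp add: powr_divide powr_minus_divide)
  also have "... \<le> 4 powr \<theta> * ((2 powr (2 * \<bar>s\<bar>) * jbracket (snd z) powr (- 2 * s)) * jbracket (modulation z) powr (- \<theta>))"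
  proof (intro mult_left_mono mult_right_mono)
    have "jbracket (snd z) powr (2 * s) \<le> jbracket (snd z) powr (2 * \<bar>s\<bar>)"
      using jbracket_ge_1 by (intro powr_mono) auto
    also have "... \<le> 2 powr (2 * \<bar>s\<bar>)"
      using jbracket_le[of "snd z"] True by (intro powr_mono2) (auto simp: less_imp_le)
    finally show "1 \<le> 2 powr (2 * \<bar>s\<bar>) * jbracket (snd z) powr (- 2 * s)"
      by (simp add: powr_minus_divide less_imp_neq[OF jbracket_pos, symmetric])
  qed auto
  finally show ?thesis using True by (simp add: input_decay_def mult.assoc)
qed

text \<open>Reduction to the lowest regularity \<open>- p / 2\<close>: the surplus
  \<open>2 * s + p\<close> is nonnegative, so the corresponding power of the output bracket can be
  distributed over the input brackets.\<close>

lemma sobolev_factor_le: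
  assumes sum: "k1 + k2 + k3 = 0" and p: "- 2 * s \<le> p"
  shows "jbracket k3 powr (2 * s) * (jbracket k1 powr (- 2 * s) * jbracket k2 powr (- 2 * s))
     \<le> 2 powr (2 * s + p) * (jbracket k3 powr (- p) * (jbracket k1 powr p * jbracket k2 powr p))"
proof -
  have k3: "jbracket k3 \<le> 2 * jbracket k1 * jbracket k2"
  proof -
    have "k3 = - (k1 + k2)" using sum by linarith
    then show ?thesis using jbracket_add_mult[of k1 k2] by (simp only: jbracket_minus)
  qed
  have split: "jbracket k powr (2 * s) = jbracket k powr (2 * s + p) * jbracket k powr (- p)"
    "jbracket k powr (2 * s + p) * jbracket k powr (- 2 * s) = jbracket k powr p" for k
    unfolding powr_add[symmetric] by simp_all
  have "jbracket k3 powr (2 * s + p) \<le> (2 * jbracket k1 * jbracket k2) powr (2 * s + p)"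
    using k3 p by (intro powr_mono2) (auto simp: less_imp_le)
  also have "... = 2 powr (2 * s + p) * (jbracket k1 powr (2 * s + p) * jbracket k2 powr (2 * s + p))"
    by (simp add: powr_mult)
  finally have "jbracket k3 powr (2 * s + p) * (jbracket k3 powr (- p) * (jbracket k1 powr (- 2 * s) * jbracket k2 powr (- 2 * s)))
     \<le> 2 powr (2 * s + p) * (jbracket k1 powr (2 * s + p) * jbracket k2 powr (2 * s + p))
       * (jbracket k3 powr (- p) * (jbracket k1 powr (- 2 * s) * jbracket k2 powr (- 2 * s)))"
    by (intro mult_right_mono) auto
  also have "... = 2 powr (2 * s + p) * (jbracket k3 powr (- p) *
      ((jbracket k1 powr (2 * s + p) * jbracket k1 powr (- 2 * s)) * (jbracket k2 powr (2 * s + p) * jbracket k2 powr (- 2 * s))))"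
    by (simp only: mult_ac)
  finally show ?thesis unfolding split(2) split(1)[of k3] by (simp only: mult.assoc)
qed

text \<open>The multiplier seen by inputs normalised in L2: \<open>x\<close> and \<open>y\<close>
  are the inputs, \<open>x + y\<close> is the output with its weight and its derivative.\<close>

definition bilinear_kernel :: "real \<Rightarrow> real \<Rightarrow> real \<Rightarrow> real \<times> real \<Rightarrow> real \<times> real \<Rightarrow> real" where
  "bilinear_kernel s b \<alpha> x y =
     sqrt (X_weight s (- b) (x + y) * (snd (x + y))\<^sup>2 / (XD_weight s b \<alpha> x * XD_weight s b \<alpha> y))"

definition kernel_const :: "real \<Rightarrow> real \<Rightarrow> real \<Rightarrow> real" where
  "kernel_const s \<kappa> \<theta> =
     (4 powr \<theta> * 2 powr (2 * \<bar>s\<bar>))\<^sup>2 * 2 powr (2 * s + (7/2 - 16 * \<kappa>)) * (64 * 16 ^ 8)"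

lemma kernel_const_nonneg: "0 \<le> kernel_const s \<kappa> \<theta>"
  by (simp add: kernel_const_def)

text \<open>The third point is minus the output, which is harmless because \<open>X_weight\<close>
  is even. The factors of \<open>kernel_const\<close> come in turn from the two inverse weights,
  from lowering the regularity, and from \<open>multiplier_bound\<close>.\<close>

lemma bilinear_kernel_bound:
  assumes \<kappa>: "0 < \<kappa>" "\<kappa> \<le> 1/100" and s: "- (7/4 - 8 * \<kappa>) \<le> s"
    and \<theta>: "1 \<le> \<theta>" "\<theta> \<le> 1 + \<kappa>" "\<theta> \<le> 2 * \<alpha>"
  shows "(bilinear_kernel s (1/2 - \<kappa>) \<alpha> x y)\<^sup>2 \<le> kernel_const s \<kappa> \<theta> *
    (schur_kernel \<theta> x y (- x - y) + schur_kernel \<theta> y x (- x - y) + schur_kernel \<theta> (- x - y) x y)"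
proof -
  define z where "z = - x - y"
  have xyz: "x + y + z = 0" by (simp add: z_def)
  have k: "snd x + snd y + snd z = 0" using arg_cong[OF xyz, of snd] by simp
  let ?b = "1/2 - \<kappa>" and ?p = "7/2 - 16 * \<kappa>" and ?a = "4 powr \<theta> * 2 powr (2 * \<bar>s\<bar>)"
  let ?W = "XD_weight s (1/2 - \<kappa>) \<alpha>"
  let ?l = "\<lambda>x. input_decay \<theta> ?b (snd x) (jbracket (modulation x))"
  let ?L = "\<lambda>x. jbracket (modulation x)"
  let ?S = "schur_kernel \<theta> x y z + schur_kernel \<theta> y x z + schur_kernel \<theta> z x y"
  have Xz: "X_weight s (- ?b) (x + y) * (snd (x + y))\<^sup>2 = (snd z)\<^sup>2 * (jbracket (snd z) powr (2 * s) * ?L z powr (- (1 - 2 * \<kappa>)))"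
  proof -
    have "x + y = - z" by (simp add: z_def)
    then show ?thesis by (simp only: X_weight_minus) (simp add: X_weight_def mult_ac)
  qed
  have dpos: "0 \<le> ?l w" for w by (simp add: input_decay_def)
  have inv: "1 / ?W w \<le> ?a * (jbracket (snd w) powr (- 2 * s) * ?l w)" for w
    using \<theta> by (intro inverse_XD_weight_le) auto
  have "(bilinear_kernel s ?b \<alpha> x y)\<^sup>2 = X_weight s (- ?b) (x + y) * (snd (x + y))\<^sup>2 / (?W x * ?W y)"
    unfolding bilinear_kernel_def
    by (intro real_sqrt_pow2 divide_nonneg_nonneg mult_nonneg_nonneg) (auto simp: less_imp_le[OF XD_weight_pos])
  also have "... = (snd z)\<^sup>2 * (jbracket (snd z) powr (2 * s) * ?L z powr (- (1 - 2 * \<kappa>))) * ((1 / ?W x) * (1 / ?W y))"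
    unfolding Xz by simp
  also have "... \<le> (snd z)\<^sup>2 * (jbracket (snd z) powr (2 * s) * ?L z powr (- (1 - 2 * \<kappa>))) *
      ((?a * (jbracket (snd x) powr (- 2 * s) * ?l x)) * (?a * (jbracket (snd y) powr (- 2 * s) * ?l y)))"
    using dpos by (intro mult_left_mono mult_mono inv) (auto simp: less_imp_le[OF XD_weight_pos])
  also have "... = ?a\<^sup>2 * ((snd z)\<^sup>2 * (?l x * ?l y * ?L z powr (- (1 - 2 * \<kappa>)))) *
      (jbracket (snd z) powr (2 * s) * (jbracket (snd x) powr (- 2 * s) * jbracket (snd y) powr (- 2 * s)))"
    by (simp only: power2_eq_square mult_ac)
  also have "... \<le> ?a\<^sup>2 * ((snd z)\<^sup>2 * (?l x * ?l y * ?L z powr (- (1 - 2 * \<kappa>)))) *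
      (2 powr (2 * s + ?p) * (jbracket (snd z) powr (- ?p) * (jbracket (snd x) powr ?p * jbracket (snd y) powr ?p)))"
    using dpos s by (intro mult_left_mono sobolev_factor_le k) auto
  also have "... = ?a\<^sup>2 * 2 powr (2 * s + ?p) *
      (derivative_weight ?p (snd x) (snd y) (snd z) * (?l x * ?l y * ?L z powr (- (1 - 2 * \<kappa>))))"
    unfolding derivative_weight_def by (simp only: mult_ac)
  also have "... \<le> ?a\<^sup>2 * 2 powr (2 * s + ?p) * (64 * 16 ^ 8 * ?S)"
    unfolding schur_kernel_def
    by (intro mult_left_mono multiplier_bound \<kappa> \<theta> k jbracket_ge_1 resonance_le_modulations xyz) auto
  also have "... = kernel_const s \<kappa> \<theta> * ?S"
    unfolding kernel_const_def by (simp only: mult.assoc)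
  finally show ?thesis unfolding z_def .
qed

lemma nn_integral_lborel_translate:
  fixes f :: "real \<times> real \<Rightarrow> ennreal"
  assumes [measurable]: "f \<in> borel_measurable borel"
  shows "(\<integral>\<^sup>+z. f (t + z) \<partial>lborel) = (\<integral>\<^sup>+z. f z \<partial>lborel)"
  using nn_integral_lborel_reflect[of f t] nn_integral_lborel_reflect[of "\<lambda>z. f (t - z)" 0] by simp

text \<open>\<open>E\<close> normalises an input to L2, and \<open>T\<close> majorises the weighted
  transform of the output. Testing \<open>T\<close> against \<open>H\<close> and writing the output
  as the sum of the input variables gives the trilinear form of \<open>bilinear_kernel\<close>;
  \<open>H\<close> is reflected because there the three points sum to zero. Duality converts this
  into a bound on \<open>T\<close>.\<close>

lemma bilinear_estimate_schwartz:
  assumes \<kappa>: "0 < \<kappa>" "\<kappa> \<le> 1/100" and s: "- (7/4 - 8 * \<kappa>) \<le> s"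
    and \<theta>: "1 < \<theta>" "\<theta> \<le> 1 + \<kappa>" "\<theta> \<le> 2 * \<alpha>"
    and u: "schwartz u" and v: "schwartz v"
  shows "X_norm s (- (1/2 - \<kappa>)) (partial_x (\<lambda>z. u z * v z))
    \<le> sqrt (27 * (kernel_const s \<kappa> \<theta> * schur_const \<theta>)) * XD_norm s (1/2 - \<kappa>) \<alpha> u * XD_norm s (1/2 - \<kappa>) \<alpha> v"
proof -
  let ?b = "1/2 - \<kappa>"
  let ?W = "XD_weight s ?b \<alpha>" and ?X = "X_weight s (- ?b)"
  let ?u = "\<lambda>z. ennreal (norm (fourier u z))" and ?v = "\<lambda>z. ennreal (norm (fourier v z))"
  define A where "A = kernel_const s \<kappa> \<theta> * schur_const \<theta>"
  have A0: "0 \<le> A"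
    unfolding A_def schur_const_def using kernel_const_nonneg jbracket_mass(2)[OF \<theta>(1)] by simp
  let ?x = "\<lambda>w z. X_weight s ?b z * (norm (fourier w z))\<^sup>2"
    and ?d = "\<lambda>w z. D_weight \<alpha> z * (norm (fourier w z))\<^sup>2"
  define E where "E w = (\<lambda>z. ennreal (sqrt (?W z) * norm (fourier w z)))" for w
  have fm [measurable]: "fourier u \<in> borel_measurable borel" "fourier v \<in> borel_measurable borel"
    using u v by (auto intro: fourier_measurable tame_measurable schwartz_imp_tame)
  have [measurable]: "E u \<in> borel_measurable borel" "E v \<in> borel_measurable borel"
    unfolding E_def by measurable
  have E2: "(\<integral>\<^sup>+z. (E w z)\<^sup>2 \<partial>lborel) \<le> ennreal ((XD_norm s ?b \<alpha> w)\<^sup>2)" if w: "schwartz w" for w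
  proof -
    have int: "integrable lborel (?x w)"
      "integrable lborel (?d w)"
      by (intro integrable_weighted moderate_X_weight moderate_D_weight w)+
    have "(\<integral>\<^sup>+z. (E w z)\<^sup>2 \<partial>lborel) = (\<integral>\<^sup>+z. ennreal (?x w z + ?d w z) \<partial>lborel)"
      unfolding E_def
      by (intro nn_integral_cong)
         (simp add: ennreal_power power_mult_distrib less_imp_le[OF XD_weight_pos] XD_weight_def distrib_right)
    also have "... = ennreal (\<integral>z. ?x w z + ?d w z \<partial>lborel)"
      by (intro nn_integral_eq_integral Bochner_Integration.integrable_add int) simp
    also have "(\<integral>z. ?x w z + ?d w z \<partial>lborel)
        = (X_norm s ?b w)\<^sup>2 + (D_norm \<alpha> w)\<^sup>2"
      using int by (simp add: X_norm_weighted D_norm_weighted weighted_norm_def integral_nonneg_AE)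
    also have "... \<le> (XD_norm s ?b \<alpha> w)\<^sup>2"
    proof -
      have "0 \<le> X_norm s ?b w" "0 \<le> D_norm \<alpha> w"
        by (simp_all add: X_norm_weighted D_norm_weighted weighted_norm_def integral_nonneg_AE)
      then show ?thesis by (simp add: XD_norm_def power2_sum)
    qed
    finally show ?thesis by (simp add: ennreal_leI)
  qed
  define T where "T \<zeta> = ennreal (sqrt (?X \<zeta>) * \<bar>snd \<zeta>\<bar>) *
      (\<integral>\<^sup>+\<eta>. ?v \<eta> * ?u (\<zeta> - \<eta>) \<partial>lborel)" for \<zeta>
  have [measurable]: "T \<in> borel_measurable borel" unfolding T_def by measurable
  let ?UV = "(\<integral>\<^sup>+z. (E v z)\<^sup>2 \<partial>lborel) * (\<integral>\<^sup>+z. (E u z)\<^sup>2 \<partial>lborel)"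
  have T2: "(\<integral>\<^sup>+\<zeta>. (T \<zeta>)\<^sup>2 \<partial>lborel) \<le> 27 * ennreal A * ?UV"
  proof (rule nn_integral_duality)
    fix H :: "real \<times> real \<Rightarrow> ennreal" assume [measurable]: "H \<in> borel_measurable borel"
    let ?k = "\<lambda>\<zeta>. ennreal (sqrt (?X \<zeta>) * \<bar>snd \<zeta>\<bar>)"
    have "(\<integral>\<^sup>+\<zeta>. H \<zeta> * T \<zeta> \<partial>lborel) = (\<integral>\<^sup>+\<zeta>. \<integral>\<^sup>+\<eta>. H \<zeta> * (?k \<zeta> * (?v \<eta> * ?u (\<zeta> - \<eta>))) \<partial>lborel \<partial>lborel)"
      unfolding T_def by (simp add: nn_integral_cmult)
    also have "... = (\<integral>\<^sup>+\<eta>. \<integral>\<^sup>+\<zeta>. H \<zeta> * (?k \<zeta> * (?v \<eta> * ?u (\<zeta> - \<eta>))) \<partial>lborel \<partial>lborel)"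
      by (rule trilinear_swap) measurable
    also have "... = (\<integral>\<^sup>+\<eta>. \<integral>\<^sup>+y. H (\<eta> + y) * (?k (\<eta> + y) * (?v \<eta> * ?u (\<eta> + y - \<eta>))) \<partial>lborel \<partial>lborel)"
      by (intro nn_integral_cong nn_integral_lborel_translate[symmetric]) measurable
    also have "... = (\<integral>\<^sup>+x. \<integral>\<^sup>+y. ennreal (bilinear_kernel s ?b \<alpha> x y) * (E v x * E u y * H (- (- x - y))) \<partial>lborel \<partial>lborel)"
    proof (intro nn_integral_cong)
      fix x y :: "real \<times> real"
      have "bilinear_kernel s ?b \<alpha> x y * (sqrt (?W x) * norm (fourier v x)) * (sqrt (?W y) * norm (fourier u y))
          = sqrt (?X (x + y)) * \<bar>snd (x + y)\<bar> * (norm (fourier v x) * norm (fourier u y))"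
        using XD_weight_pos[of s ?b \<alpha> x] XD_weight_pos[of s ?b \<alpha> y]
        by (simp add: bilinear_kernel_def real_sqrt_mult real_sqrt_divide)
      then have "ennreal (bilinear_kernel s ?b \<alpha> x y) * (E v x * E u y) = ?k (x + y) * (?v x * ?u y)"
        unfolding E_def
        by (simp flip: ennreal_mult add: less_imp_le[OF XD_weight_pos] bilinear_kernel_def mult.assoc)
      note K = this
      have "ennreal (bilinear_kernel s ?b \<alpha> x y) * (E v x * E u y * H (- (- x - y)))
          = ennreal (bilinear_kernel s ?b \<alpha> x y) * (E v x * E u y) * H (x + y)"
        by (simp add: mult.assoc add.commute)
      also have "... = ?k (x + y) * (?v x * ?u y) * H (x + y)"
        by (simp only: K)
      finally show "H (x + y) * (?k (x + y) * (?v x * ?u (x + y - x)))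
          = ennreal (bilinear_kernel s ?b \<alpha> x y) * (E v x * E u y * H (- (- x - y)))"
        by (simp only: mult.commute[of "H (x + y)"] add_diff_cancel_left')
    qed
    finally have HT: "(\<integral>\<^sup>+\<zeta>. H \<zeta> * T \<zeta> \<partial>lborel) = ..." .
    have "(\<integral>\<^sup>+\<zeta>. H \<zeta> * T \<zeta> \<partial>lborel)\<^sup>2 \<le> 27 * ennreal A *
        ((\<integral>\<^sup>+z. (E v z)\<^sup>2 \<partial>lborel) * (\<integral>\<^sup>+z. (E u z)\<^sup>2 \<partial>lborel) * (\<integral>\<^sup>+z. (H (- z))\<^sup>2 \<partial>lborel))"
      unfolding HT A_def
    proof (rule trilinear_schur_kernel[OF \<theta>(1) kernel_const_nonneg, where H = "\<lambda>z. H (- z)"])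
      show "0 \<le> bilinear_kernel s ?b \<alpha> x y" for x y
        unfolding bilinear_kernel_def by (simp add: less_imp_le[OF XD_weight_pos])
      show "(bilinear_kernel s ?b \<alpha> x y)\<^sup>2 \<le> kernel_const s \<kappa> \<theta> *
          (schur_kernel \<theta> x y (- x - y) + schur_kernel \<theta> y x (- x - y) + schur_kernel \<theta> (- x - y) x y)" for x y
        using \<theta> by (intro bilinear_kernel_bound \<kappa> s) auto
    qed measurable
    also have "(\<integral>\<^sup>+z. (H (- z))\<^sup>2 \<partial>lborel) = (\<integral>\<^sup>+z. (H z)\<^sup>2 \<partial>lborel)"
      using nn_integral_lborel_reflect[of "\<lambda>z. (H z)\<^sup>2" 0] by simp
    finally show "(\<integral>\<^sup>+\<zeta>. H \<zeta> * T \<zeta> \<partial>lborel)\<^sup>2 \<le> 27 * ennreal A * ?UV * (\<integral>\<^sup>+z. (H z)\<^sup>2 \<partial>lborel)"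
      by (simp only: mult.assoc)
  qed measurable
  let ?B = "partial_x (\<lambda>z. u z * v z)"
  have B: "schwartz ?B" by (intro schwartz_partial_x schwartz_mult u v)
  have "ennreal ((X_norm s (- ?b) ?B)\<^sup>2) = (\<integral>\<^sup>+\<zeta>. ennreal (?X \<zeta> * (norm (fourier ?B \<zeta>))\<^sup>2) \<partial>lborel)"
    using nn_integral_eq_integral[OF integrable_weighted[OF moderate_X_weight B]]
    by (simp add: X_norm_weighted weighted_norm_def integral_nonneg_AE)
  also have "... \<le> (\<integral>\<^sup>+\<zeta>. (T \<zeta>)\<^sup>2 \<partial>lborel)"
  proof (intro nn_integral_mono)
    fix \<zeta>
    have "ennreal (sqrt (?X \<zeta>) * norm (fourier ?B \<zeta>)) = ennreal (sqrt (?X \<zeta>)) * ennreal (norm (fourier ?B \<zeta>))"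
      by (rule ennreal_mult) auto
    also have "... \<le> ennreal (sqrt (?X \<zeta>)) * (ennreal \<bar>snd \<zeta>\<bar> *
        (\<integral>\<^sup>+\<eta>. ?v \<eta> * ?u (\<zeta> - \<eta>) \<partial>lborel))"
      by (intro mult_left_mono norm_fourier_dx_mult u v) auto
    also have "... = T \<zeta>" unfolding T_def by (simp add: ennreal_mult mult.assoc)
    finally have "(ennreal (sqrt (?X \<zeta>) * norm (fourier ?B \<zeta>)))\<^sup>2 \<le> (T \<zeta>)\<^sup>2" by (rule ennreal_square_mono)
    then show "ennreal (?X \<zeta> * (norm (fourier ?B \<zeta>))\<^sup>2) \<le> (T \<zeta>)\<^sup>2"
      by (simp add: ennreal_power power_mult_distrib)
  qed
  also have "... \<le> 27 * ennreal A * ?UV" by (rule T2)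
  also have "... \<le> 27 * ennreal A * (ennreal ((XD_norm s ?b \<alpha> v)\<^sup>2) * ennreal ((XD_norm s ?b \<alpha> u)\<^sup>2))"
    by (intro mult_left_mono mult_mono E2 u v) auto
  also have "27 * ennreal A = ennreal (27 * A)" using A0 by (simp add: ennreal_mult)
  also have "ennreal (27 * A) * (ennreal ((XD_norm s ?b \<alpha> v)\<^sup>2) * ennreal ((XD_norm s ?b \<alpha> u)\<^sup>2))
      = ennreal (27 * A * ((XD_norm s ?b \<alpha> u)\<^sup>2 * (XD_norm s ?b \<alpha> v)\<^sup>2))"
    using A0 by (simp flip: ennreal_mult add: mult.commute)
  finally have "(X_norm s (- ?b) ?B)\<^sup>2 \<le> 27 * A * ((XD_norm s ?b \<alpha> u)\<^sup>2 * (XD_norm s ?b \<alpha> v)\<^sup>2)"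
    using A0 by (subst (asm) ennreal_le_iff) auto
  also have "... = (sqrt (27 * A) * XD_norm s ?b \<alpha> u * XD_norm s ?b \<alpha> v)\<^sup>2"
    using A0 by (simp add: power_mult_distrib)
  finally have "(X_norm s (- ?b) ?B)\<^sup>2 \<le> (sqrt (27 * A) * XD_norm s ?b \<alpha> u * XD_norm s ?b \<alpha> v)\<^sup>2" .
  moreover have "0 \<le> XD_norm s ?b \<alpha> w" for w
    by (simp add: XD_norm_def X_norm_weighted D_norm_weighted weighted_norm_def integral_nonneg_AE)
  ultimately show ?thesis
    unfolding A_def[symmetric] using A0 by (intro power2_le_imp_le[of "X_norm s (- ?b) ?B"]) auto
qed

theorem proposition5p1:
  fixes s :: real
  assumes "s > - 7 / 4"
  shows "\<exists>b::real. b < 1 / 2 \<and>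
    (\<forall>\<alpha>::real. \<alpha> > 1 / 2 \<longrightarrow>
      (\<exists>c::real. c > 0 \<and>
        (\<forall>U \<in> XD_space s b \<alpha>. \<forall>V \<in> XD_space s b \<alpha>.
          \<exists>W \<in> X_space s (- b). is_dx_product U V W \<and>
            completion_norm (X_norm s (- b)) W
              \<le> c * completion_norm (XD_norm s b \<alpha>) U * completion_norm (XD_norm s b \<alpha>) V)))"
proof -
  \<comment> \<open>The second entry of the minimum is exactly what keeps \<open>s\<close> at or
    above \<open>- (7/4 - 8 * \<kappa>)\<close>. Since \<kappa> depends on \<open>s\<close> only, so
    does \<open>b\<close>.\<close>
  define \<kappa> where "\<kappa> = min (1/100) ((s + 7/4) / 8)"
  have \<kappa>: "0 < \<kappa>" "\<kappa> \<le> 1/100" "- (7/4 - 8 * \<kappa>) \<le> s"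
    using assms unfolding \<kappa>_def by (auto simp: min_def field_simps)
  define b where "b = 1/2 - \<kappa>"
  have "\<exists>c>0. \<forall>U \<in> XD_space s b \<alpha>. \<forall>V \<in> XD_space s b \<alpha>.
          \<exists>W \<in> X_space s (- b). is_dx_product U V W \<and>
            completion_norm (X_norm s (- b)) W
              \<le> c * completion_norm (XD_norm s b \<alpha>) U * completion_norm (XD_norm s b \<alpha>) V"
    if \<alpha>: "\<alpha> > 1/2" for \<alpha>
  proof -
    \<comment> \<open>The weight of \<open>D_norm\<close> supplies at most the exponent
      \<open>2 * \<alpha>\<close>, and the modulations can lend at most \<open>1 + \<kappa>\<close>.
      Both exceed 1, and \<alpha> thus affects only the constant.\<close>
    define \<theta> where "\<theta> = min (1 + \<kappa>) (2 * \<alpha>)"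
    have \<theta>: "1 < \<theta>" "\<theta> \<le> 1 + \<kappa>" "\<theta> \<le> 2 * \<alpha>" using \<kappa> \<alpha> by (auto simp: \<theta>_def)
    \<comment> \<open>Adding 1 to the root makes the constant strictly positive.\<close>
    define c where "c = sqrt (27 * (kernel_const s \<kappa> \<theta> * schur_const \<theta>)) + 1"
    have root0: "0 \<le> sqrt (27 * (kernel_const s \<kappa> \<theta> * schur_const \<theta>))"
      unfolding schur_const_def using kernel_const_nonneg jbracket_mass(2)[OF \<theta>(1)] by simp
    then have c: "0 < c" unfolding c_def by linarith
    have X: "schwartz_seminorm (X_norm s b')" for b'
      unfolding X_norm_weighted by (intro schwartz_seminorm_weighted moderate_X_weight)
    have D: "schwartz_seminorm (D_norm \<alpha>)"
      unfolding D_norm_weighted by (intro schwartz_seminorm_weighted moderate_D_weight)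
    have XD: "schwartz_seminorm (XD_norm s b \<alpha>)"
      using schwartz_seminorm_add[OF X D] by (simp add: XD_norm_def[abs_def])
    have ext: "\<exists>W\<in>schwartz_completion (X_norm s (- b)).
        (\<forall>u\<in>U. \<forall>v\<in>V. (\<lambda>n. partial_x (\<lambda>z. u n z * v n z)) \<in> W) \<and>
        completion_norm (X_norm s (- b)) W \<le> c * completion_norm (XD_norm s b \<alpha>) U * completion_norm (XD_norm s b \<alpha>) V"
      if U: "U \<in> schwartz_completion (XD_norm s b \<alpha>)" and V: "V \<in> schwartz_completion (XD_norm s b \<alpha>)" for U V
    proof (rule schwartz_bilinear_extension[OF XD X _ _ _ _ c _ U V, where B = "\<lambda>f g. partial_x (\<lambda>z. f z * g z)"])
      fix f g assume f: "schwartz f" and g: "schwartz g"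
      show "schwartz (\<lambda>z. f z - g z)" by (rule schwartz_diff[OF f g])
      show "schwartz (partial_x (\<lambda>z. f z * g z))" by (intro schwartz_partial_x schwartz_mult f g)
      have nn: "0 \<le> XD_norm s b \<alpha> f * XD_norm s b \<alpha> g"
        by (intro mult_nonneg_nonneg schwartz_seminorm_nonneg[OF XD] f g)
      have "X_norm s (- b) (partial_x (\<lambda>z. f z * g z)) \<le>
          sqrt (27 * (kernel_const s \<kappa> \<theta> * schur_const \<theta>)) * XD_norm s b \<alpha> f * XD_norm s b \<alpha> g"
        unfolding b_def by (intro bilinear_estimate_schwartz \<kappa> \<theta> f g)
      then show "X_norm s (- b) (partial_x (\<lambda>z. f z * g z)) \<le> c * XD_norm s b \<alpha> f * XD_norm s b \<alpha> g"
        using nn unfolding c_def by (simp add: algebra_simps)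
      fix h assume h: "schwartz h"
      have t: "tame (\<lambda>z. f z * h z)" "tame (\<lambda>z. g z * h z)" "tame (\<lambda>z. h z * f z)" "tame (\<lambda>z. h z * g z)"
        by (intro schwartz_imp_tame schwartz_mult f g h)+
      show "partial_x (\<lambda>z. (f z - g z) * h z) = (\<lambda>z. partial_x (\<lambda>z. f z * h z) z - partial_x (\<lambda>z. g z * h z) z)"
        unfolding left_diff_distrib by (rule partial_diff(2)[OF t(1,2)])
      show "partial_x (\<lambda>z. h z * (f z - g z)) = (\<lambda>z. partial_x (\<lambda>z. h z * f z) z - partial_x (\<lambda>z. h z * g z) z)"
        unfolding right_diff_distrib by (rule partial_diff(2)[OF t(3,4)])
    qed
    show ?thesis
      unfolding XD_space_def X_space_def is_dx_product_def using c ext by blast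
  qed
  moreover have "b < 1/2" using \<kappa> by (simp add: b_def)
  ultimately show ?thesis by blast
qed

end
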